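(* Let $G$ be a finitely generated group. The following assertions are equivalent: (1) $G$ is a limit group in the sense of Sela. (2) Some marking of $G$ is a limit of markings of free groups in a compact space of marked groups $\mathcal{G}_n$ (equivalently, any marking of $G$, by any finite number $n$ of generators, is a limit of markings of free groups in $\mathcal{G}_n$). (3) $G$ has the same universal theory as a free group. (4) $G$ is isomorphic to a subgroup of a non-standard free group. (5) $G$ is fully residually free.
   Context: Marked groups: a marked group $(G,S)$ is a group $G$ with an ordered finite generating family $S=(s_1,\dots,s_n)$ (repetitions allowed); two marked groups are identified if $s_i\mapsto s_i'$ extends to a group isomorphism. $\mathcal{G}_n$ is the set of groups marked by $n$ elements up to this identification. It is identified with the set of normal subgroups of the free group $F_n=\langle e_1,\dots,e_n\rangle$ (via the kernel of $e_i\mapsto s_i$) and carries the topology induced by the product topology on $2^{F_n}$; it is compact. Thus $(G_i,S_i)\to(G,S)$ iff for every $R$, for $i$ large, exactly the same words of length at most $R$ are trivial in $(G_i,S_i)$ and in $(G,S)$. A marking of $G$ is a marked group whose underlying group is $G$. Free groups may have any rank, including $0$ and $1$. Limit group in the sense of Sela: a sequence of homomorphisms $h_i:E\to F$ from a finitely generated group $E$ to a finitely generated free group $F$ is stable if for every $g\in E$, either $h_i(g)=1$ for all large $i$ or $h_i(g)\ne 1$ for all large $i$; its stable kernel is $\{g\in E: h_i(g)=1 \text{ for all large } i\}$. A group is a limit group in the sense of Sela if it is isomorphic to the quotient of a finitely generated group $E$ by the stable kernel of such a stable sequence. Universal theory: the set of first-order sentences of the form $\forall x_1\dots\forall x_p\,\phi(x_1,\dots,x_p)$,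 with $\phi$ quantifier-free in the language of groups $(\cdot,{}^{-1},1,=)$, that hold in the group. Non-standard free group: an ultrapower $F^{\mathbb{N}}/\!\sim_\omega$ of a free group $F$ with respect to a non-principal ultrafilter $\omega$ on $\mathbb{N}$. Fully residually free: for any finite set of distinct elements $x_1,\dots,x_k\in G$ there is a homomorphism $h$ from $G$ to a free group such that $h(x_1),\dots,h(x_k)$ are distinct. *)

theory Defs
  imports
    "HOL-Algebra.Coset"
    "HOL-Algebra.Generated_Groups"
    "HOL-Algebra.Product_Groups"
    "HOL-Analysis.Function_Topology"
    "HOL-Library.Infinite_Typeclass"
begin

section \<open>Free groups\<close>

text \<open>
  The letter \<open>(x, True)\<close> stands for the basis element \<open>x\<close> and \<open>(x, False)\<close> for its inverse.
  The free group on \<open>X\<close> consists of the reduced words; a product is computed by pushing the letters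
  of the left factor, last one first, onto the right factor, cancelling when possible.
\<close>

type_synonym 'x fword = "('x \<times> bool) list"

definition inv_letter :: "'x \<times> bool \<Rightarrow> 'x \<times> bool" where
  "inv_letter l = (fst l, \<not> snd l)"

definition reduced :: "'x fword \<Rightarrow> bool" where
  "reduced w \<longleftrightarrow> successively (\<lambda>l m. m \<noteq> inv_letter l) w"

fun push_letter :: "'x \<times> bool \<Rightarrow> 'x fword \<Rightarrow> 'x fword" where
  "push_letter l [] = [l]"
| "push_letter l (m # w) = (if m = inv_letter l then w else l # m # w)"

definition free_group :: "'x set \<Rightarrow> 'x fword monoid" where
  "free_group X =
     \<lparr>carrier = {w. set w \<subseteq> X \<times> UNIV \<and> reduced w},
      monoid.mult = (\<lambda>u v. foldr push_letter u v),
      one = []\<rparr>"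

text \<open>The value of a word in \<open>H\<close> when each basis element \<open>x\<close> is replaced by \<open>f x\<close>:\<close>

definition word_eval :: "('a, 'm) monoid_scheme \<Rightarrow> ('x \<Rightarrow> 'a) \<Rightarrow> 'x fword \<Rightarrow> 'a" where
  "word_eval H f w =
     foldr (\<lambda>l a. (if snd l then f (fst l) else inv\<^bsub>H\<^esub> (f (fst l))) \<otimes>\<^bsub>H\<^esub> a) w \<one>\<^bsub>H\<^esub>"

definition is_free_group :: "('a, 'm) monoid_scheme \<Rightarrow> bool" where
  "is_free_group F \<longleftrightarrow>
     group F \<and> (\<exists>B \<subseteq> carrier F. word_eval F (\<lambda>x. x) \<in> iso (free_group B) F)"

definition finitely_generated :: "('a, 'm) monoid_scheme \<Rightarrow> bool" where
  "finitely_generated G \<longleftrightarrow> (\<exists>S. finite S \<and> S \<subseteq> carrier G \<and> generate G S = carrier G)"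

lemma inv_letter_inv_letter [simp]: "inv_letter (inv_letter l) = l"
  by (simp add: inv_letter_def)

lemma inv_letter_eq_iff: "inv_letter l = m \<longleftrightarrow> l = inv_letter m"
  by (metis inv_letter_inv_letter)

lemma reduced_Nil [simp]: "reduced []"
  by (simp add: reduced_def)

lemma reduced_ConsD: "reduced (l # w) \<Longrightarrow> reduced w"
  by (auto simp: reduced_def successively_Cons)

lemma reduced_push_letter: "reduced w \<Longrightarrow> reduced (push_letter l w)"
  by (cases w) (auto simp: reduced_def successively_Cons)

lemma set_push_letter: "set (push_letter l w) \<subseteq> insert l (set w)"
  by (cases w) auto

lemma push_letter_inv: "reduced w \<Longrightarrow> push_letter l (push_letter (inv_letter l) w) = w"
  by (cases w; cases "tl w") (auto simp: reduced_def)

lemma reduced_foldr_push: "reduced v \<Longrightarrow> reduced (foldr push_letter u v)"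
  by (induction u) (auto simp: reduced_push_letter)

lemma set_foldr_push: "set (foldr push_letter u v) \<subseteq> set u \<union> set v"
proof (induction u)
  case (Cons l u)
  then show ?case using set_push_letter[of l "foldr push_letter u v"] by auto
qed simp

lemma foldr_push_push:
  assumes "reduced w"
  shows "foldr push_letter (push_letter l v) w = push_letter l (foldr push_letter v w)"
proof (cases v)
  case (Cons m v')
  have "reduced (foldr push_letter v' w)"
    using assms by (rule reduced_foldr_push)
  then show ?thesis using Cons by (auto simp: push_letter_inv)
qed simp

lemma foldr_push_assoc:
  "reduced w \<Longrightarrow>
     foldr push_letter (foldr push_letter u v) w = foldr push_letter u (foldr push_letter v w)"
  by (induction u) (auto simp: foldr_push_push)

lemma foldr_push_reduced: "reduced u \<Longrightarrow> foldr push_letter u [] = u"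
proof (induction u)
  case (Cons l u)
  then show ?case by (cases u) (auto simp: reduced_def)
qed simp

lemma foldr_push_inverse:
  "reduced w \<Longrightarrow> foldr push_letter (rev (map inv_letter u)) (foldr push_letter u w) = w"
proof (induction u)
  case (Cons l u)
  have "reduced (foldr push_letter u w)"
    using Cons.prems by (rule reduced_foldr_push)
  from push_letter_inv[OF this, of "inv_letter l"] Cons show ?case by simp
qed simp

lemma group_free_group: "group (free_group X)"
proof (rule groupI)
  fix u assume u: "u \<in> carrier (free_group X)"
  define v where "v = foldr push_letter (rev (map inv_letter u)) []"
  have "set v \<subseteq> set (rev (map inv_letter u))"
    using set_foldr_push[of "rev (map inv_letter u)" "[]"] by (simp add: v_def)
  also have "\<dots> \<subseteq> X \<times> UNIV"
    using u by (auto simp: free_group_def inv_letter_def)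
  finally have "v \<in> carrier (free_group X)"
    by (simp add: free_group_def v_def reduced_foldr_push)
  moreover have "v \<otimes>\<^bsub>free_group X\<^esub> u = \<one>\<^bsub>free_group X\<^esub>"
  proof -
    have red: "reduced u" using u by (simp add: free_group_def)
    have "foldr push_letter v u = foldr push_letter (rev (map inv_letter u)) u"
      using red by (simp add: v_def foldr_push_assoc)
    also have "\<dots> = []"
      using foldr_push_inverse[of "[]" u] red by (simp add: foldr_push_reduced)
    finally show ?thesis by (simp add: free_group_def)
  qed
  ultimately show "\<exists>v \<in> carrier (free_group X). v \<otimes>\<^bsub>free_group X\<^esub> u = \<one>\<^bsub>free_group X\<^esub>"
    by blast
next
  fix u v assume "u \<in> carrier (free_group X)" "v \<in> carrier (free_group X)"
  then show "u \<otimes>\<^bsub>free_group X\<^esub> v \<in> carrier (free_group X)"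
    using set_foldr_push[of u v] by (auto simp: free_group_def reduced_foldr_push)
qed (auto simp: free_group_def foldr_push_assoc)

lemma word_eval_closed:
  assumes "group H" "\<And>x. x \<in> X \<Longrightarrow> f x \<in> carrier H" "set w \<subseteq> X \<times> UNIV"
  shows "word_eval H f w \<in> carrier H"
proof -
  interpret group H by fact
  show ?thesis
    using assms(3) by (induction w) (auto simp: word_eval_def assms(2))
qed

lemma word_eval_push_letter:
  assumes "group H" "\<And>x. x \<in> X \<Longrightarrow> f x \<in> carrier H" "set (l # w) \<subseteq> X \<times> UNIV"
  shows "word_eval H f (push_letter l w) = word_eval H f [l] \<otimes>\<^bsub>H\<^esub> word_eval H f w"
proof -
  interpret group H by fact
  have l: "fst l \<in> X" using assms(3) by auto
  show ?thesis
  proof (cases w)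
    case Nil
    then show ?thesis using l assms(2) by (simp add: word_eval_def)
  next
    case (Cons m w')
    have "word_eval H f w' \<in> carrier H"
      using Cons assms by (intro word_eval_closed[where X = X]) auto
    moreover have "fst m \<in> X" using Cons assms(3) by auto
    ultimately show ?thesis
      using Cons l assms(2) by (auto simp: word_eval_def inv_letter_def m_assoc [symmetric])
  qed
qed

lemma word_eval_hom:
  assumes "group H" "\<And>x. x \<in> X \<Longrightarrow> f x \<in> carrier H"
  shows "word_eval H f \<in> hom (free_group X) H"
proof (rule homI)
  interpret group H by fact
  fix u v assume u: "u \<in> carrier (free_group X)" and v: "v \<in> carrier (free_group X)"
  have v': "set v \<subseteq> X \<times> UNIV" using v by (simp add: free_group_def)
  have "set u \<subseteq> X \<times> UNIV" using u by (simp add: free_group_def)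
  then have "word_eval H f (foldr push_letter u v) = word_eval H f u \<otimes>\<^bsub>H\<^esub> word_eval H f v"
  proof (induction u)
    case Nil
    show ?case
      using word_eval_closed[OF assms v'] by (simp add: word_eval_def[of H f "[]"])
  next
    case (Cons l u)
    have set: "set (l # foldr push_letter u v) \<subseteq> X \<times> UNIV"
      using Cons.prems v' set_foldr_push[of u v] by auto
    have c: "word_eval H f [l] \<in> carrier H" "word_eval H f u \<in> carrier H"
      "word_eval H f v \<in> carrier H"
      using Cons.prems v' by (auto intro!: word_eval_closed[OF assms])
    have lu: "word_eval H f (l # u) = word_eval H f [l] \<otimes>\<^bsub>H\<^esub> word_eval H f u"
      using Cons.prems assms(2) by (auto simp: word_eval_def)
    show ?case
      using Cons word_eval_push_letter[OF assms set] c by (simp add: lu m_assoc)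
  qed
  then show "word_eval H f (u \<otimes>\<^bsub>free_group X\<^esub> v) = word_eval H f u \<otimes>\<^bsub>H\<^esub> word_eval H f v"
    by (simp add: free_group_def)
qed (use assms in \<open>auto simp: free_group_def intro: word_eval_closed\<close>)


section \<open>Quantifying over groups\<close>

text \<open>
  HOL cannot quantify over types inside a formula. Where a definition below existentially quantifies
  over a group that need not be related to the given one (\<^emph>\<open>there is a free group\<close>, \<^emph>\<open>there is a
  finitely generated group\<close>), the group ranges over all groups whose carrier is a subset of a type
  \<open>'u\<close>, passed as an argument of type \<open>'u itself\<close>. In the main theorem \<open>'u\<close> is an arbitrary infinite
  type, so that these groups have unrestricted cardinality; infinite, because the free groups that
  are needed could not live on a finite type.
\<close>


section \<open>Marked groups\<close>

text \<open>
  A marked group \<open>(G, S)\<close> with \<open>S = (s\<^sub>0, \<dots>, s\<^sub>n\<^sub>-\<^sub>1)\<close>, up to isomorphism of marked groups, is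
  identified with the kernel of the map from the free group on \<open>{..<n}\<close> to \<open>G\<close> that sends \<open>i\<close> to
  \<open>s\<^sub>i\<close>. A set of words is viewed as a point of a product of copies of the discrete space \<open>bool\<close>.
\<close>

definition marked_group_space :: "nat \<Rightarrow> nat fword set topology" where
  "marked_group_space n =
     pullback_topology
       {N. N \<lhd> free_group {..<n}}
       (\<lambda>N. \<lambda>w \<in> carrier (free_group {..<n}). w \<in> N)
       (product_topology (\<lambda>_. discrete_topology (UNIV :: bool set)) (carrier (free_group {..<n})))"

definition marked_kernel :: "('a, 'm) monoid_scheme \<Rightarrow> 'a list \<Rightarrow> nat fword set" where
  "marked_kernel G S = kernel (free_group {..<length S}) G (word_eval G (\<lambda>i. S ! i))"

text \<open>The points of the space of groups marked by \<open>n\<close> elements whose underlying group is \<open>G\<close>:\<close>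

definition markings :: "nat \<Rightarrow> ('a, 'm) monoid_scheme \<Rightarrow> nat fword set set" where
  "markings n G =
     {marked_kernel G S | S. length S = n \<and> set S \<subseteq> carrier G \<and> generate G (set S) = carrier G}"

lemma markings_normal:
  assumes "group G" "N \<in> markings n G"
  shows "N \<lhd> free_group {..<n}"
proof -
  obtain S where S: "N = marked_kernel G S" "length S = n" "set S \<subseteq> carrier G"
    using assms(2) by (auto simp: markings_def)
  have "word_eval G (\<lambda>i. S ! i) \<in> hom (free_group {..<n}) G"
    using S assms(1) by (intro word_eval_hom) auto
  then interpret group_hom "free_group {..<n}" G "word_eval G (\<lambda>i. S ! i)"
    using assms(1) group_free_group by (simp add: group_hom_def group_hom_axioms_def)
  show ?thesis using normal_kernel S by (simp add: marked_kernel_def)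
qed

definition limit_of_free_markings :: "'u itself \<Rightarrow> nat \<Rightarrow> nat fword set \<Rightarrow> bool" where
  "limit_of_free_markings _ n N \<longleftrightarrow>
     (\<exists>M. (\<forall>i :: nat. \<exists>F :: 'u monoid. is_free_group F \<and> M i \<in> markings n F) \<and>
          limitin (marked_group_space n) M N sequentially)"


section \<open>Limit groups in the sense of Sela\<close>

definition stable_sequence ::
    "('a, 'm) monoid_scheme \<Rightarrow> ('b, 'k) monoid_scheme \<Rightarrow> (nat \<Rightarrow> 'a \<Rightarrow> 'b) \<Rightarrow> bool" where
  "stable_sequence E F h \<longleftrightarrow>
     (\<forall>i. h i \<in> hom E F) \<and>
     (\<forall>g \<in> carrier E. (\<forall>\<^sub>F i in sequentially. h i g = \<one>\<^bsub>F\<^esub>) \<or> (\<forall>\<^sub>F i in sequentially. h i g \<noteq> \<one>\<^bsub>F\<^esub>))"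

definition stable_kernel ::
    "('a, 'm) monoid_scheme \<Rightarrow> ('b, 'k) monoid_scheme \<Rightarrow> (nat \<Rightarrow> 'a \<Rightarrow> 'b) \<Rightarrow> 'a set" where
  "stable_kernel E F h = {g \<in> carrier E. \<forall>\<^sub>F i in sequentially. h i g = \<one>\<^bsub>F\<^esub>}"

definition sela_limit_group :: "'u itself \<Rightarrow> ('a, 'm) monoid_scheme \<Rightarrow> bool" where
  "sela_limit_group _ G \<longleftrightarrow>
     (\<exists>(E :: 'u monoid) (F :: 'u monoid) h.
        group E \<and> finitely_generated E \<and> is_free_group F \<and> finitely_generated F \<and>
        stable_sequence E F h \<and> G \<cong> E Mod stable_kernel E F h)"


section \<open>Universal theory\<close>

datatype gterm = Var nat | One | Mult gterm gterm | Inv gterm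

datatype qf_formula = Eq gterm gterm | Neg qf_formula
  | Conj qf_formula qf_formula | Disj qf_formula qf_formula

fun term_vars :: "gterm \<Rightarrow> nat set" where
  "term_vars (Var i) = {i}"
| "term_vars One = {}"
| "term_vars (Mult s t) = term_vars s \<union> term_vars t"
| "term_vars (Inv t) = term_vars t"

fun formula_vars :: "qf_formula \<Rightarrow> nat set" where
  "formula_vars (Eq s t) = term_vars s \<union> term_vars t"
| "formula_vars (Neg p) = formula_vars p"
| "formula_vars (Conj p q) = formula_vars p \<union> formula_vars q"
| "formula_vars (Disj p q) = formula_vars p \<union> formula_vars q"

fun term_value :: "('a, 'm) monoid_scheme \<Rightarrow> (nat \<Rightarrow> 'a) \<Rightarrow> gterm \<Rightarrow> 'a" where
  "term_value G v (Var i) = v i"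
| "term_value G v One = \<one>\<^bsub>G\<^esub>"
| "term_value G v (Mult s t) = term_value G v s \<otimes>\<^bsub>G\<^esub> term_value G v t"
| "term_value G v (Inv t) = inv\<^bsub>G\<^esub> (term_value G v t)"

fun satisfies :: "('a, 'm) monoid_scheme \<Rightarrow> (nat \<Rightarrow> 'a) \<Rightarrow> qf_formula \<Rightarrow> bool" where
  "satisfies G v (Eq s t) \<longleftrightarrow> term_value G v s = term_value G v t"
| "satisfies G v (Neg p) \<longleftrightarrow> \<not> satisfies G v p"
| "satisfies G v (Conj p q) \<longleftrightarrow> satisfies G v p \<and> satisfies G v q"
| "satisfies G v (Disj p q) \<longleftrightarrow> satisfies G v p \<or> satisfies G v q"

text \<open>The pair \<open>(p, \<phi>)\<close> encodes the universal sentence \<open>\<forall>x\<^sub>0 \<dots> x\<^sub>p\<^sub>-\<^sub>1. \<phi>\<close>.\<close>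

definition universal_theory :: "('a, 'm) monoid_scheme \<Rightarrow> (nat \<times> qf_formula) set" where
  "universal_theory G =
     {(p, \<phi>). formula_vars \<phi> \<subseteq> {..<p} \<and> (\<forall>v \<in> {..<p} \<rightarrow> carrier G. satisfies G v \<phi>)}"


section \<open>Non-standard free groups\<close>

text \<open>A set \<open>A\<close> belongs to the ultrafilter iff \<open>eventually (\<lambda>i. i \<in> A) \<omega>\<close>.\<close>

definition nonprincipal_ultrafilter :: "'i filter \<Rightarrow> bool" where
  "nonprincipal_ultrafilter \<omega> \<longleftrightarrow>
     \<omega> \<noteq> bot \<and>
     (\<forall>P. eventually P \<omega> \<or> eventually (\<lambda>i. \<not> P i) \<omega>) \<and>
     (\<forall>j. \<not> eventually (\<lambda>i. i = j) \<omega>)"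

definition ultra_rel :: "nat filter \<Rightarrow> ('a, 'm) monoid_scheme \<Rightarrow> ((nat \<Rightarrow> 'a) \<times> (nat \<Rightarrow> 'a)) set" where
  "ultra_rel \<omega> F =
     {(x, y). x \<in> UNIV \<rightarrow> carrier F \<and> y \<in> UNIV \<rightarrow> carrier F \<and> (\<forall>\<^sub>F i in \<omega>. x i = y i)}"

definition ultrapower :: "nat filter \<Rightarrow> ('a, 'm) monoid_scheme \<Rightarrow> (nat \<Rightarrow> 'a) set monoid" where
  "ultrapower \<omega> F = (let P = product_group UNIV (\<lambda>_ :: nat. F) in
     \<lparr>carrier = carrier P // ultra_rel \<omega> F,
      monoid.mult = (\<lambda>A B. \<Union>a \<in> A. \<Union>b \<in> B. ultra_rel \<omega> F `` {a \<otimes>\<^bsub>P\<^esub> b}),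
      one = ultra_rel \<omega> F `` {\<one>\<^bsub>P\<^esub>}\<rparr>)"

definition embeds_in_nonstandard_free_group :: "'u itself \<Rightarrow> ('a, 'm) monoid_scheme \<Rightarrow> bool" where
  "embeds_in_nonstandard_free_group _ G \<longleftrightarrow>
     (\<exists>(F :: 'u monoid) \<omega> H.
        is_free_group F \<and> nonprincipal_ultrafilter \<omega> \<and>
        subgroup H (ultrapower \<omega> F) \<and> G \<cong> (ultrapower \<omega> F)\<lparr>carrier := H\<rparr>)"


section \<open>Fully residually free groups\<close>

definition fully_residually_free :: "'u itself \<Rightarrow> ('a, 'm) monoid_scheme \<Rightarrow> bool" where
  "fully_residually_free _ G \<longleftrightarrow>
     (\<forall>A. finite A \<and> A \<subseteq> carrier G \<longrightarrow>
        (\<exists>F :: 'u monoid. is_free_group F \<and> (\<exists>h \<in> hom G F. inj_on h A)))"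

end

theory Submission
  imports Defs "HOL-Computational_Algebra.Polynomial" "HOL-Library.Function_Algebras"
begin

text \<open>
  Everything is compared with full residual freeness. Free groups embed in \<open>SL\<^sub>2(\<real>)\<close> by ping-pong,
  so by Hilbert's basis theorem they are equationally noetherian: the relations satisfied by the
  generators of \<open>G\<close> follow, in every free group, from finitely many of them. Hence, if finite
  systems of equations and inequations satisfied by the generators of \<open>G\<close> can be satisfied in free
  groups, then the solutions define homomorphisms, and \<open>G\<close> is fully residually free. Each of the
  other conditions provides such solutions.

  Conversely, the image of \<open>G\<close> in a free group is free by the Nielsen--Schreier theorem, which makes
  \<open>G\<close> a limit of free marked groups. The rank of such an image is bounded by the number of
  generators. An image \<open>F\<close> of maximal rank embeds in \<open>G\<close>, and \<open>G\<close> is separated by its homomorphisms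
  to this one group \<open>F\<close>. This gives the remaining conditions, in the case of the universal theory
  with no distinction between trivial, abelian and non-abelian groups.
\<close>


section \<open>Noetherian rings of functions\<close>

text \<open>The obstacle in one direction is that a tuple in a free group may satisfy all relations
  of \<open>G\<close> that have been tested and still define no homomorphism on \<open>G\<close>,
  because no finite presentation of \<open>G\<close> is at hand. Noetherianity removes it: finitely
  many relators, chosen before the free group and the tuple, force all the others. A finite test set
  can then both make a map on \<open>G\<close> well defined and keep given elements apart. The
  choice has to serve every rank, so one linear group must receive all free groups of finite rank;
  there the entries of a word are polynomials in the entries of the matrices.

  In the other direction, full residual freeness allows a new free group for each finite set,
  whereas a stable sequence, an ultrapower and a universal theory refer to a single one. Embedding
  all of them in a free group of rank two would give a group too large for the universal theory of
  an abelian \<open>G\<close>. An image of maximal rank has the right size in all cases, and lifting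
  its basis makes it a retract of \<open>G\<close>.\<close>

definition subring_set :: "'r::comm_ring_1 set \<Rightarrow> bool" where
  "subring_set R \<longleftrightarrow> 0 \<in> R \<and> 1 \<in> R \<and>
     (\<forall>x \<in> R. \<forall>y \<in> R. x + y \<in> R \<and> x * y \<in> R) \<and> (\<forall>x \<in> R. - x \<in> R)"

text \<open>Rings are subsets of one ambient type, so that elements can be adjoined one at a time
  without changing the type; hence the coefficients in an ideal are restricted to
  \<open>R\<close>.\<close>

inductive_set ideal_gen :: "'r::comm_ring_1 set \<Rightarrow> 'r set \<Rightarrow> 'r set" for R A where
  zero: "0 \<in> ideal_gen R A"
| step: "s \<in> R \<Longrightarrow> a \<in> A \<Longrightarrow> x \<in> ideal_gen R A \<Longrightarrow> s * a + x \<in> ideal_gen R A"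

text \<open>The generators have to come from \<open>A\<close> itself: this is the form that cuts an
  infinite system of equations down to a finite subsystem.\<close>

definition noetherian_set :: "'r::comm_ring_1 set \<Rightarrow> bool" where
  "noetherian_set R \<longleftrightarrow> (\<forall>A \<subseteq> R. \<exists>A0 \<subseteq> A. finite A0 \<and> A \<subseteq> ideal_gen R A0)"

lemma noetherian_setE:
  assumes "noetherian_set R" "A \<subseteq> R"
  obtains A0 where "A0 \<subseteq> A" "finite A0" "A \<subseteq> ideal_gen R A0"
  using assms(1)[unfolded noetherian_set_def, rule_format, OF assms(2)] by auto

lemma ideal_gen_add:
  "x \<in> ideal_gen R A \<Longrightarrow> y \<in> ideal_gen R A \<Longrightarrow> x + y \<in> ideal_gen R A"
  by (induction rule: ideal_gen.induct) (auto simp: add.assoc intro: ideal_gen.step)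

lemma ideal_gen_mult:
  "x \<in> ideal_gen R A \<Longrightarrow> subring_set R \<Longrightarrow> r \<in> R \<Longrightarrow> r * x \<in> ideal_gen R A"
proof (induction rule: ideal_gen.induct)
  case (step s a x)
  then have "(r * s) * a + r * x \<in> ideal_gen R A"
    by (intro ideal_gen.step) (auto simp: subring_set_def)
  then show ?case by (simp add: algebra_simps)
qed (simp add: ideal_gen.zero)

lemma ideal_gen_incl: "subring_set R \<Longrightarrow> a \<in> A \<Longrightarrow> a \<in> ideal_gen R A"
  using ideal_gen.step[OF _ _ ideal_gen.zero, of 1 R a A] by (simp add: subring_set_def)

lemma ideal_gen_subset: "subring_set R \<Longrightarrow> A \<subseteq> R \<Longrightarrow> ideal_gen R A \<subseteq> R"
proof
  fix x assume *: "subring_set R" "A \<subseteq> R" "x \<in> ideal_gen R A"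
  from *(3) show "x \<in> R"
    by induction (use * in \<open>auto simp: subring_set_def\<close>)
qed

lemma ideal_gen_trans:
  assumes "subring_set R" "A \<subseteq> ideal_gen R B"
  shows "ideal_gen R A \<subseteq> ideal_gen R B"
proof
  fix x assume "x \<in> ideal_gen R A"
  then show "x \<in> ideal_gen R B"
    by induction (use assms in \<open>auto intro!: ideal_gen.zero ideal_gen_add ideal_gen_mult\<close>)
qed

lemma ideal_gen_mono: "subring_set R \<Longrightarrow> A \<subseteq> B \<Longrightarrow> ideal_gen R A \<subseteq> ideal_gen R B"
  using ideal_gen_incl by (intro ideal_gen_trans) auto

lemma ideal_gen_finite_support:
  assumes "subring_set R" "x \<in> ideal_gen R A"
  shows "\<exists>A0 \<subseteq> A. finite A0 \<and> x \<in> ideal_gen R A0"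
  using assms(2)
proof induction
  case zero
  then show ?case using ideal_gen.zero by blast
next
  case (step s a x)
  then obtain A0 where "A0 \<subseteq> A" "finite A0" "x \<in> ideal_gen R A0" by blast
  with step have "s * a + x \<in> ideal_gen R (insert a A0)"
    using ideal_gen_mono[OF assms(1), of A0 "insert a A0"] by (auto intro: ideal_gen.step)
  with \<open>A0 \<subseteq> A\<close> \<open>finite A0\<close> step(2) show ?case
    by (intro exI[of _ "insert a A0"]) auto
qed

lemma ideal_gen_finite_support_set:
  assumes "subring_set R" "finite X" "X \<subseteq> ideal_gen R A"
  shows "\<exists>A0 \<subseteq> A. finite A0 \<and> X \<subseteq> ideal_gen R A0"
  using assms(2,3)
proof induction
  case (insert x X)
  then obtain A0 where A0: "A0 \<subseteq> A" "finite A0" "X \<subseteq> ideal_gen R A0" by auto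
  obtain A1 where A1: "A1 \<subseteq> A" "finite A1" "x \<in> ideal_gen R A1"
    using ideal_gen_finite_support[OF assms(1), of x A] insert.prems by auto
  show ?case
    using A0 A1 ideal_gen_mono[OF assms(1), of A0 "A0 \<union> A1"]
      ideal_gen_mono[OF assms(1), of A1 "A0 \<union> A1"]
    by (intro exI[of _ "A0 \<union> A1"]) auto
qed auto

section \<open>Hilbert's basis theorem and finitely generated extensions\<close>

definition polys_over :: "'r::comm_ring_1 set \<Rightarrow> 'r poly set" where
  "polys_over R = {p. \<forall>i. coeff p i \<in> R}"

lemma subring_set_sum:
  "subring_set R \<Longrightarrow> (\<And>i. i \<in> I \<Longrightarrow> f i \<in> R) \<Longrightarrow> sum f I \<in> R"
  by (induction I rule: infinite_finite_induct) (auto simp: subring_set_def)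

lemma subring_polys_over:
  assumes "subring_set R"
  shows "subring_set (polys_over R)"
proof -
  have "coeff (p * q) i \<in> R" if "p \<in> polys_over R" "q \<in> polys_over R" for p q i
    unfolding coeff_mult using assms that
    by (intro subring_set_sum) (auto simp: subring_set_def polys_over_def)
  then show ?thesis
    using assms by (auto simp: subring_set_def polys_over_def coeff_1)
qed

text \<open>Hilbert's argument: choose \<open>f k\<close> of minimal degree outside the ideal generated by its
  predecessors; a linear relation between the leading coefficients contradicts minimality.\<close>

theorem hilbert_basis:
  assumes R: "subring_set R" and noeth: "noetherian_set R"
  shows "noetherian_set (polys_over R)"
  unfolding noetherian_set_def
proof (intro allI impI, rule ccontr)
  fix A assume A: "A \<subseteq> polys_over R"
    and nfg: "\<not> (\<exists>A0 \<subseteq> A. finite A0 \<and> A \<subseteq> ideal_gen (polys_over R) A0)"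
  let ?P = "polys_over R"
  have P: "subring_set ?P" using subring_polys_over[OF R] .
  define J where "J = ideal_gen ?P A"
  have JP: "J \<subseteq> ?P" unfolding J_def by (rule ideal_gen_subset[OF P A])
  \<comment> \<open>No finite \<open>B\<close> generates \<open>J\<close>: each of its elements is a
    combination of finitely many elements of \<open>A\<close>, and together these would form a
    finite generating subset of \<open>A\<close>.\<close>
  have ex: "\<exists>p. p \<in> J - ideal_gen ?P B" if B: "finite B" "B \<subseteq> J" for B
  proof (rule ccontr)
    assume "\<not> ?thesis"
    then have JB: "J \<subseteq> ideal_gen ?P B" by blast
    obtain A0 where A0: "A0 \<subseteq> A" "finite A0" "B \<subseteq> ideal_gen ?P A0"
      using ideal_gen_finite_support_set[OF P B(1) B(2)[unfolded J_def]] by blast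
    have "A \<subseteq> J" unfolding J_def using ideal_gen_incl[OF P] by blast
    also note JB
    also note ideal_gen_trans[OF P A0(3)]
    finally have "A \<subseteq> ideal_gen ?P A0" .
    with A0 nfg show False by blast
  qed
  \<comment> \<open>\<open>Q f k\<close> looks at \<open>f\<close> only below \<open>k\<close>,
    which allows the sequence to be built by dependent choice along \<open><\<close>.\<close>
  define Q where "Q f k p \<longleftrightarrow> p \<in> J - ideal_gen ?P (f ` {..<k}) \<and>
      (\<forall>q \<in> J - ideal_gen ?P (f ` {..<k}). degree p \<le> degree q)"
    for f :: "nat \<Rightarrow> 'a poly" and k p
  have "\<exists>f. \<forall>k. Q f k (f k)"
  proof (rule dependent_wf_choice[of "{(x, y :: nat). x < y}"])
    show "wf {(x, y :: nat). x < y}" by (rule wf_less)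
    show "Q f x r = Q g x r" if "\<And>z. (z, x) \<in> {(x, y). x < y} \<Longrightarrow> f z = g z" for f g x r
    proof -
      have "f ` {..<x} = g ` {..<x}" using that by (intro image_cong) auto
      then show ?thesis by (simp add: Q_def)
    qed
    show "\<exists>r. Q f x r" if "\<And>y. (y, x) \<in> {(x, y). x < y} \<Longrightarrow> Q f y (f y)" for f x
    proof -
      have "f ` {..<x} \<subseteq> J" using that by (auto simp: Q_def)
      then obtain p where "p \<in> J - ideal_gen ?P (f ` {..<x})" using ex by blast
      then show ?thesis
        using ex_has_least_nat[of "\<lambda>p. p \<in> J - ideal_gen ?P (f ` {..<x})" p degree]
        unfolding Q_def by blast
    qed
  qed
  then obtain f where f: "\<And>k. Q f k (f k)" by blast
  have fJ: "f k \<in> J" and fn: "f k \<notin> ideal_gen ?P (f ` {..<k})" for k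
    using f[of k] by (auto simp: Q_def)
  have mon: "degree (f j) \<le> degree (f k)" if "j \<le> k" for j k
  proof -
    have "ideal_gen ?P (f ` {..<j}) \<subseteq> ideal_gen ?P (f ` {..<k})"
      using that by (intro ideal_gen_mono[OF P]) auto
    then show ?thesis using f[of j] fJ[of k] fn[of k] by (auto simp: Q_def)
  qed
  define a where "a k = lead_coeff (f k)" for k
  have "range a \<subseteq> R" using fJ JP by (auto simp: a_def polys_over_def)
  then obtain A0 where A0: "A0 \<subseteq> range a" "finite A0" "range a \<subseteq> ideal_gen R A0"
    by (rule noetherian_setE[OF noeth])
  then obtain K where K: "finite K" "A0 = a ` K" by (meson finite_subset_image)
  then obtain N where N: "\<And>k. k \<in> K \<Longrightarrow> k < N" using finite_nat_set_iff_bounded by auto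
  let ?d = "degree (f N)"
  \<comment> \<open>Finitely many leading coefficients generate all of them, and \<open>N\<close>
    exceeds their indices.\<close>
  have "a N \<in> ideal_gen R (a ` {..<N})"
    proof -
    have "a ` K \<subseteq> a ` {..<N}" using N by auto
    from ideal_gen_mono[OF R this] A0(3) K(2) show ?thesis by auto
  qed
  \<comment> \<open>Follow the linear combination for \<open>a N\<close> term by term, lifting
    \<open>s * a j\<close> to \<open>monom s (?d - degree (f j)) * f j\<close>. Degrees increase
    along \<open>f\<close>, so the subtraction is not truncated.\<close>
  then have "\<exists>g \<in> ideal_gen ?P (f ` {..<N}). degree g \<le> ?d \<and> coeff g ?d = a N"
  proof induction
    case zero
    show ?case by (intro bexI[of _ 0]) (auto intro: ideal_gen.zero)
  next
    case (step s b x)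
    then obtain g j where g: "g \<in> ideal_gen ?P (f ` {..<N})" "degree g \<le> ?d" "coeff g ?d = x"
      and j: "j < N" "b = a j" by blast
    let ?m = "monom s (?d - degree (f j))"
    have dj: "degree (f j) \<le> ?d" using mon j by simp
    have m: "?m \<in> ?P" using step R by (auto simp: polys_over_def subring_set_def)
    have "degree (?m * f j) \<le> ?d"
      using degree_mult_le[of ?m "f j"] degree_monom_le[of s "?d - degree (f j)"] dj by linarith
    moreover have "coeff (?m * f j) ?d = s * b"
      using dj by (simp add: coeff_monom_mult j a_def)
    ultimately show ?case
      using g j m
      by (intro bexI[of _ "?m * f j + g"]) (auto intro!: ideal_gen.step degree_add_le)
  qed
  then obtain g where g: "g \<in> ideal_gen ?P (f ` {..<N})" "degree g \<le> ?d" "coeff g ?d = a N"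
    by blast
  define h where "h = f N - g"
  have "- 1 \<in> ?P" using P by (simp add: subring_set_def)
  then have hn: "h \<notin> ideal_gen ?P (f ` {..<N})"
    using ideal_gen_add[OF _ g(1), of h] fn[of N] by (auto simp: h_def)
  have "f ` {..<N} \<subseteq> J" using fJ by auto
  then have "g \<in> J" using g(1) ideal_gen_trans[OF P, of "f ` {..<N}" A] by (auto simp: J_def)
  then have "h \<in> J"
    using ideal_gen_add[OF fJ[of N, unfolded J_def] ideal_gen_mult[OF _ P \<open>- 1 \<in> ?P\<close>, of g A]]
    by (simp add: h_def J_def)
  \<comment> \<open>Subtracting \<open>g\<close> does not lead into the ideal of the predecessors,
    so minimality gives \<open>h\<close> degree at least \<open>?d\<close>, exactly where its
    coefficient has been cancelled.\<close>
  then have "?d \<le> degree h" using f[of N] hn by (auto simp: Q_def)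
  moreover have "coeff h ?d = 0" using g by (simp add: h_def a_def)
  moreover have "degree h \<le> ?d" using g by (simp add: h_def degree_diff_le)
  ultimately have "h = 0" using leading_coeff_0_iff[of h] by simp
  with hn show False by (simp add: ideal_gen.zero)
qed

definition adjoin :: "'r::comm_ring_1 set \<Rightarrow> 'r \<Rightarrow> 'r set" where
  "adjoin R x = (\<lambda>p. poly p x) ` polys_over R"

lemma subring_adjoin: "subring_set R \<Longrightarrow> subring_set (adjoin R x)"
proof -
  assume "subring_set R"
  then have P: "subring_set (polys_over R)" by (rule subring_polys_over)
  have "poly p x + poly q x \<in> adjoin R x" "poly p x * poly q x \<in> adjoin R x"
       "- poly p x \<in> adjoin R x"
    if "p \<in> polys_over R" "q \<in> polys_over R" for p q
    using P that unfolding adjoin_def subring_set_def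
    by (auto simp flip: poly_add poly_mult poly_minus)
  moreover have "0 \<in> adjoin R x" "1 \<in> adjoin R x"
    using P unfolding adjoin_def subring_set_def by (auto intro: rev_image_eqI)
  ultimately show ?thesis unfolding subring_set_def adjoin_def by blast
qed

lemma adjoin_incl: "subring_set R \<Longrightarrow> r \<in> R \<Longrightarrow> r \<in> adjoin R x"
  unfolding adjoin_def
  by (intro image_eqI[of _ _ "[:r:]"])
     (auto simp: polys_over_def subring_set_def coeff_pCons split: nat.split)

lemma adjoin_gen: "subring_set R \<Longrightarrow> x \<in> adjoin R x"
  unfolding adjoin_def
  by (intro image_eqI[of _ _ "[:0, 1:]"])
     (auto simp: polys_over_def subring_set_def coeff_pCons split: nat.split)

text \<open>A quotient of a noetherian ring is noetherian: \<open>adjoin R x\<close> is the image of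
  \<open>polys_over R\<close> under evaluation at \<open>x\<close>, so \<open>A\<close> is pulled
  back and the finitely many generators are pushed forward.\<close>

lemma noetherian_adjoin:
  assumes "subring_set R" "noetherian_set R"
  shows "noetherian_set (adjoin R x)"
  unfolding noetherian_set_def
proof (intro allI impI)
  fix A assume A: "A \<subseteq> adjoin R x"
  define B where "B = {p \<in> polys_over R. poly p x \<in> A}"
  obtain B0 where B0: "B0 \<subseteq> B" "finite B0" "B \<subseteq> ideal_gen (polys_over R) B0"
    using noetherian_setE[OF hilbert_basis[OF assms], of B] by (auto simp: B_def)
  have "poly p x \<in> ideal_gen (adjoin R x) ((\<lambda>p. poly p x) ` B0)"
    if "p \<in> ideal_gen (polys_over R) B0" for p
    using that
    by induction (auto simp: adjoin_def intro!: ideal_gen.intros)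
  then have "A \<subseteq> ideal_gen (adjoin R x) ((\<lambda>p. poly p x) ` B0)"
    using A B0(3) by (auto simp: adjoin_def B_def)
  with B0 show "\<exists>A0\<subseteq>A. finite A0 \<and> A \<subseteq> ideal_gen (adjoin R x) A0"
    by (intro exI[of _ "(\<lambda>p. poly p x) ` B0"]) (auto simp: B_def)
qed

lemma noetherian_extension:
  assumes "subring_set R" "noetherian_set R" "finite X"
  shows "\<exists>R'. subring_set R' \<and> noetherian_set R' \<and> R \<subseteq> R' \<and> X \<subseteq> R'"
  using assms(3)
proof induction
  case empty
  then show ?case using assms by blast
next
  case (insert x X)
  then obtain R' where R': "subring_set R'" "noetherian_set R'" "R \<subseteq> R'" "X \<subseteq> R'" by blast
  then show ?case
    using subring_adjoin[OF R'(1), of x] noetherian_adjoin[OF R'(1,2), of x]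
      adjoin_incl[OF R'(1), of _ x] adjoin_gen[OF R'(1), of x]
    by (intro exI[of _ "adjoin R' x"]) auto
qed

text \<open>The assumption on \<open>A\<close> says that its members are polynomial expressions in
  the finitely many functions in \<open>X\<close>. They lie in a noetherian ring of functions, and
  every function in an ideal vanishes wherever the generators do.\<close>

lemma finite_system_of_equations:
  fixes X A :: "('t \<Rightarrow> 'k::field) set"
  assumes "finite X" and A: "\<And>R. subring_set R \<Longrightarrow> X \<subseteq> R \<Longrightarrow> A \<subseteq> R"
  shows "\<exists>A0 \<subseteq> A. finite A0 \<and> (\<forall>t. (\<forall>f \<in> A0. f t = 0) \<longrightarrow> (\<forall>f \<in> A. f t = 0))"
proof -
  \<comment> \<open>The constant functions are a copy of the field. They form the noetherian base
    ring to which \<open>X\<close> is adjoined.\<close>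
  define K where "K = range (\<lambda>(c :: 'k) (_ :: 't). c)"
  have K: "subring_set K"
    by (auto simp: subring_set_def K_def fun_eq_iff plus_fun_def times_fun_def)
  have "noetherian_set K"
    unfolding noetherian_set_def
  proof (intro allI impI)
    fix B assume B: "B \<subseteq> K"
    show "\<exists>B0 \<subseteq> B. finite B0 \<and> B \<subseteq> ideal_gen K B0"
    proof (cases "B \<subseteq> {0}")
      case True
      then show ?thesis by (intro exI[of _ "{}"]) (auto intro: ideal_gen.zero)
    next
      case False
      then obtain b where b: "b \<in> B" "b \<noteq> 0" by blast
      with B obtain c where c: "b = (\<lambda>_. c)" by (auto simp: K_def)
      with b have "c \<noteq> 0" by auto
      have "x \<in> ideal_gen K {b}" if x: "x \<in> B" for x
      proof -
        obtain d where d: "x = (\<lambda>_. d)" using B x by (auto simp: K_def)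
        have "(\<lambda>_. d / c) * b + 0 \<in> ideal_gen K {b}"
          by (rule ideal_gen.step) (auto simp: K_def intro: ideal_gen.zero)
        also have "(\<lambda>_. d / c) * b + 0 = x"
          using \<open>c \<noteq> 0\<close> by (simp add: c d fun_eq_iff)
        finally show ?thesis .
      qed
      then show ?thesis using b by (intro exI[of _ "{b}"]) auto
    qed
  qed
  then obtain R where R: "subring_set R" "noetherian_set R" "X \<subseteq> R"
    using noetherian_extension[OF K _ assms(1)] by blast
  obtain A0 where A0: "A0 \<subseteq> A" "finite A0" "A \<subseteq> ideal_gen R A0"
    by (rule noetherian_setE[OF R(2) A[OF R(1,3)]])
  have "f t = 0" if "f \<in> ideal_gen R A0" "\<forall>g \<in> A0. g t = 0" for f t
    using that by induction auto
  then have "\<forall>f \<in> A. f t = 0" if "\<forall>f \<in> A0. f t = 0" for t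
    using A0(3) that by (meson subsetD)
  with A0 show ?thesis by (intro exI[of _ A0]) auto
qed

section \<open>Free groups are equationally noetherian\<close>

lemma word_eval_Nil [simp]: "word_eval H f [] = \<one>\<^bsub>H\<^esub>"
  by (simp add: word_eval_def)

lemma word_eval_Cons:
  "word_eval H f (l # w) = (if snd l then f (fst l) else inv\<^bsub>H\<^esub> f (fst l)) \<otimes>\<^bsub>H\<^esub> word_eval H f w"
  by (simp add: word_eval_def)

lemma word_eval_cong:
  "(\<And>x. x \<in> X \<Longrightarrow> f x = g x) \<Longrightarrow> set w \<subseteq> X \<times> UNIV \<Longrightarrow> word_eval H f w = word_eval H g w"
  by (induction w) (auto simp: word_eval_Cons)

lemma word_eval_in_subgroup:
  assumes "group H" "subgroup K H" "\<And>x. x \<in> X \<Longrightarrow> f x \<in> K" "set w \<subseteq> X \<times> UNIV"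
  shows "word_eval H f w \<in> K"
  using assms(4)
  by (induction w)
     (auto simp: word_eval_Cons assms(3) subgroup.one_closed[OF assms(2)]
        subgroup.m_closed[OF assms(2)] subgroup.m_inv_closed[OF assms(2)])

lemma hom_word_eval:
  assumes "group G" "group H" "\<phi> \<in> hom G H"
    and f: "\<And>x. x \<in> X \<Longrightarrow> f x \<in> carrier G" and "set w \<subseteq> X \<times> UNIV"
  shows "\<phi> (word_eval G f w) = word_eval H (\<lambda>x. \<phi> (f x)) w"
proof -
  interpret group_hom G H \<phi> using assms by (simp add: group_hom_def group_hom_axioms_def)
  show ?thesis using assms(5)
  proof (induction w)
    case (Cons l w)
    have "word_eval G f w \<in> carrier G" using Cons.prems by (intro word_eval_closed[OF assms(1) f]) auto
    then show ?case using Cons f[of "fst l"] by (auto simp: word_eval_Cons)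
  qed simp
qed

lemma subgroup_free_group:
  assumes "Y \<subseteq> X"
  shows "subgroup (carrier (free_group Y)) (free_group X)"
proof (rule group.group_incl_imp_subgroup[OF group_free_group])
  show "carrier (free_group Y) \<subseteq> carrier (free_group X)"
    using assms by (auto simp: free_group_def)
  show "group (free_group X\<lparr>carrier := carrier (free_group Y)\<rparr>)"
    using group_free_group[of Y] by (simp add: free_group_def)
qed

text \<open>A quadruple \<open>(a, b, c, d)\<close> is the matrix with rows \<open>(a, b)\<close>
  and \<open>(c, d)\<close>. The entries come from any commutative ring, because matrices of
  functions are used as well as matrices over a field.\<close>

definition SL2 :: "('r::comm_ring_1 \<times> 'r \<times> 'r \<times> 'r) monoid" where
  "SL2 = \<lparr>carrier = {(a, b, c, d). a * d - b * c = 1},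
     monoid.mult = (\<lambda>(a, b, c, d) (a', b', c', d').
       (a * a' + b * c', a * b' + b * d', c * a' + d * c', c * b' + d * d')),
     one = (1, 0, 0, 1)\<rparr>"

lemma SL2_simps [simp]:
  "(a, b, c, d) \<in> carrier SL2 \<longleftrightarrow> a * d - b * c = 1"
  "\<one>\<^bsub>SL2\<^esub> = (1, 0, 0, 1)"
  "(a, b, c, d) \<otimes>\<^bsub>SL2\<^esub> (a', b', c', d') =
     (a * a' + b * c', a * b' + b * d', c * a' + d * c', c * b' + d * d')"
  by (simp_all add: SL2_def)

lemma SL2_inverse_left:
  fixes a b c d :: "'r::comm_ring_1"
  assumes "(a, b, c, d) \<in> carrier SL2"
  shows "(d, - b, - c, a) \<otimes>\<^bsub>SL2\<^esub> (a, b, c, d) = \<one>\<^bsub>SL2\<^esub>"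
  using assms by (simp add: algebra_simps)

lemma group_SL2: "group (SL2 :: ('r::comm_ring_1 \<times> 'r \<times> 'r \<times> 'r) monoid)"
proof (rule groupI)
  fix x y :: "'r \<times> 'r \<times> 'r \<times> 'r" assume xy: "x \<in> carrier SL2" "y \<in> carrier SL2"
  obtain a b c d where x: "x = (a, b, c, d)" by (metis surj_pair)
  obtain a' b' c' d' where y: "y = (a', b', c', d')" by (metis surj_pair)
  have "(a * a' + b * c') * (c * b' + d * d') - (a * b' + b * d') * (c * a' + d * c')
      = (a * d - b * c) * (a' * d' - b' * c')"
    by (simp add: algebra_simps)
  also have "\<dots> = 1" using xy by (simp add: x y)
  finally show "x \<otimes>\<^bsub>SL2\<^esub> y \<in> carrier SL2" by (simp add: x y)
next
  fix x :: "'r \<times> 'r \<times> 'r \<times> 'r" assume xc: "x \<in> carrier SL2"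
  obtain a b c d where x: "x = (a, b, c, d)" by (metis surj_pair)
  show "\<exists>y \<in> carrier SL2. y \<otimes>\<^bsub>SL2\<^esub> x = \<one>\<^bsub>SL2\<^esub>"
    using xc SL2_inverse_left[of a b c d]
    by (intro bexI[of _ "(d, - b, - c, a)"]) (simp_all only: x, simp add: algebra_simps)
qed (auto simp: SL2_def algebra_simps)

lemma inv_SL2:
  fixes a b c d :: "'r::comm_ring_1"
  assumes "(a, b, c, d) \<in> carrier SL2"
  shows "inv\<^bsub>SL2\<^esub> (a, b, c, d) = (d, - b, - c, a)"
proof -
  have "(d, - b, - c, a) \<in> carrier SL2" using assms by (simp add: algebra_simps)
  with group.inv_equality[OF group_SL2 SL2_inverse_left[OF assms] assms] show ?thesis by simp
qed

text \<open>The letter \<open>l\<close> acts on the projective line, up to the sign of the matrix, by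
  \<open>z \<mapsto> c\<^sub>l - 1 / (z - c\<^sub>m)\<close> with \<open>m = inv_letter l\<close>, where the points \<open>c\<^sub>l\<close> lie at mutual distance at
  least 3. Hence it maps the complement of the unit disc around \<open>c\<^sub>m\<close> to the unit disc around \<open>c\<^sub>l\<close>.\<close>

definition schottky_center :: "nat \<times> bool \<Rightarrow> real" where
  "schottky_center l = 6 * of_nat (fst l) + (if snd l then 0 else 3)"

definition schottky :: "nat \<Rightarrow> real \<times> real \<times> real \<times> real" where
  "schottky i = (let c = schottky_center (i, True); c' = schottky_center (i, False)
     in (c, - 1 - c * c', 1, - c'))"

lemma schottky_center_dist:
  assumes "l \<noteq> m"
  shows "3 \<le> \<bar>schottky_center l - schottky_center m\<bar>"
proof -
  define k :: "nat \<times> bool \<Rightarrow> int" where "k l = 2 * int (fst l) + (if snd l then 0 else 1)" for l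
  have k: "schottky_center l = 3 * of_int (k l)" for l
    by (simp add: schottky_center_def k_def)
  have "k l \<noteq> k m"
    using assms by (cases l; cases m) (auto simp: k_def split: if_splits; presburger)
  then have "1 \<le> \<bar>k l - k m\<bar>" by linarith
  then have "1 \<le> \<bar>of_int (k l) - of_int (k m) :: real\<bar>" by linarith
  then show ?thesis by (simp add: k abs_if split: if_splits)
qed

lemma schottky_SL2: "schottky i \<in> carrier SL2"
  by (simp add: schottky_def Let_def algebra_simps)

text \<open>The first column \<open>(p, q)\<close> is the image of the point at infinity. The claim
  is that \<open>p / q\<close> is finite and lies in the unit disc around the centre of the first
  letter. Infinity lies outside all discs, which starts the game; reducedness keeps it
  going.\<close>

lemma schottky_ping_pong:
  assumes j: "inj_on j X" and "reduced w" "w \<noteq> []" "set w \<subseteq> X \<times> UNIV"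
    and "word_eval SL2 (\<lambda>x. schottky (j x)) w = (p, b, q, d)"
  shows "q \<noteq> 0 \<and> \<bar>p - schottky_center (j (fst (hd w)), snd (hd w)) * q\<bar> \<le> \<bar>q\<bar>"
  using assms(2-)
proof (induction w arbitrary: p b q d)
  case (Cons l w)
  obtain x s where l: "l = (x, s)" by (cases l)
  have x: "x \<in> X" using Cons.prems l by auto
  let ?c = "schottky_center (j x, s)" and ?c' = "schottky_center (j x, \<not> s)"
  obtain p' b' q' d' where w: "word_eval SL2 (\<lambda>x. schottky (j x)) w = (p', b', q', d')"
    by (metis surj_pair)
  \<comment> \<open>Inverting a Schottky matrix exchanges its two centres and changes the sign of
    the matrix, so one formula with the sign \<open>\<epsilon>\<close> covers both kinds of
    letters.\<close>
  define \<epsilon> :: real where "\<epsilon> = (if s then 1 else - 1)"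
  have \<epsilon>: "\<epsilon> * \<epsilon> = 1" "\<bar>\<epsilon>\<bar> = 1" by (simp_all add: \<epsilon>_def)
  have mat: "(if s then schottky (j x) else inv\<^bsub>SL2\<^esub> (schottky (j x)))
      = (\<epsilon> * ?c, - \<epsilon> * (1 + ?c * ?c'), \<epsilon>, - \<epsilon> * ?c')"
    using schottky_SL2[of "j x"] by (simp add: schottky_def Let_def \<epsilon>_def inv_SL2 algebra_simps)
  have "(p, b, q, d) = (\<epsilon> * ?c, - \<epsilon> * (1 + ?c * ?c'), \<epsilon>, - \<epsilon> * ?c') \<otimes>\<^bsub>SL2\<^esub> (p', b', q', d')"
    using Cons.prems(4) w by (simp only: word_eval_Cons l fst_conv snd_conv mat)
  then have pq: "p = \<epsilon> * ?c * p' - \<epsilon> * (1 + ?c * ?c') * q'" "q = \<epsilon> * (p' - ?c' * q')"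
    by (simp_all add: algebra_simps)
  have "p - ?c * q = - \<epsilon> * q'" by (simp add: pq algebra_simps)
  then have eq: "\<bar>p - ?c * q\<bar> = \<bar>q'\<bar>" using \<epsilon> by (simp add: abs_mult)
  have q: "\<bar>q\<bar> = \<bar>p' - ?c' * q'\<bar>" using \<epsilon> by (simp add: pq abs_mult)
  have red: "reduced w" using Cons.prems(1) by (cases l) (auto dest: reduced_ConsD)
  have wX: "set w \<subseteq> X \<times> UNIV" using Cons.prems(3) by simp
  \<comment> \<open>By \<open>eq\<close> it remains to show that \<open>p' / q'\<close> has distance
    at least 1 from \<open>?c'\<close>. For the empty word this point is infinity, with
    \<open>q' = 0\<close> and \<open>p' = 1\<close>.\<close>
  have "\<bar>q'\<bar> \<le> \<bar>q\<bar> \<and> q \<noteq> 0"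
  proof (cases w)
    case Nil
    then show ?thesis using w q by auto
  next
    case (Cons m w')
    let ?m = "schottky_center (j (fst m), snd m)"
    have IH: "q' \<noteq> 0 \<and> \<bar>p' - ?m * q'\<bar> \<le> \<bar>q'\<bar>"
      using Cons.IH[OF red _ wX w] Cons by simp
    have "m \<noteq> (x, \<not> s)" "fst m \<in> X"
      using Cons Cons.prems by (auto simp: l reduced_def inv_letter_def)
    then have "(j (fst m), snd m) \<noteq> (j x, \<not> s)"
      using x inj_onD[OF j, of "fst m" x] by (cases m) auto
    \<comment> \<open>The point \<open>p' / q'\<close> is within 1 of \<open>?m\<close>, hence at
      least 3 - 1 = 2 away from \<open>?c'\<close>.\<close>
    then have "3 * \<bar>q'\<bar> \<le> \<bar>?m - ?c'\<bar> * \<bar>q'\<bar>"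
      using schottky_center_dist by (intro mult_right_mono) auto
    also have "\<dots> = \<bar>?m * q' - ?c' * q'\<bar>" by (simp add: abs_mult algebra_simps flip: abs_mult)
    finally show ?thesis using IH q by auto
  qed
  then show ?case using eq by (simp add: l)
qed simp

text \<open>The identity matrix fixes infinity, that is, has \<open>q = 0\<close>, whereas a
  nonempty reduced word moves infinity.\<close>

lemma schottky_faithful:
  assumes "inj_on j X" "w \<in> carrier (free_group X)"
    and "word_eval SL2 (\<lambda>x. schottky (j x)) w = \<one>\<^bsub>SL2\<^esub>"
  shows "w = []"
  using schottky_ping_pong[OF assms(1), of w 1 0 0 1] assms by (auto simp: free_group_def)

text \<open>Evaluating \<open>w\<close> once at a generic tuple of matrices, whose entries are
  functions of the tuple \<open>t\<close>, turns the equation for \<open>w\<close> into four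
  equations between polynomial functions of \<open>t\<close>. The system of all these equations has
  an equivalent finite subsystem.\<close>

lemma SL2_equationally_noetherian:
  fixes n :: nat
  assumes "W \<subseteq> carrier (free_group {..<n})"
  shows "\<exists>W0 \<subseteq> W. finite W0 \<and>
    (\<forall>t :: nat \<Rightarrow> 'k \<times> 'k \<times> 'k \<times> 'k::field. t \<in> {..<n} \<rightarrow> carrier SL2 \<longrightarrow>
       (\<forall>w \<in> W0. word_eval SL2 t w = \<one>\<^bsub>SL2\<^esub>) \<longrightarrow> (\<forall>w \<in> W. word_eval SL2 t w = \<one>\<^bsub>SL2\<^esub>))"
proof -
  \<comment> \<open>Components outside \<open>SL2\<close> are replaced by the identity, so that the
    determinant equation holds as an identity of functions of all \<open>t\<close>.\<close>
  define g :: "(nat \<Rightarrow> 'k \<times> 'k \<times> 'k \<times> 'k) \<Rightarrow> nat \<Rightarrow> _"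
    where "g t i = (if t i \<in> carrier SL2 then t i else \<one>\<^bsub>SL2\<^esub>)" for t i
  \<comment> \<open>The generic matrices: the coordinate functions of \<open>g t i\<close>, regarded
    as entries in the ring of functions of \<open>t\<close>.\<close>
  define x where "x i = (\<lambda>t. fst (g t i), \<lambda>t. fst (snd (g t i)),
     \<lambda>t. fst (snd (snd (g t i))), \<lambda>t. snd (snd (snd (g t i))))" for i
  define ev :: "_ \<Rightarrow> _ \<Rightarrow> 'k \<times> 'k \<times> 'k \<times> 'k"
    where "ev t = (\<lambda>(a, b, c, d). (a t, b t, c t, d t))" for t :: "nat \<Rightarrow> 'k \<times> 'k \<times> 'k \<times> 'k"
  have ev_hom: "ev t \<in> hom SL2 SL2" for t
    by (rule homI) (auto simp: ev_def fun_eq_iff SL2_def)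
  have gc: "g t i \<in> carrier SL2" for t i by (simp add: g_def)
  have xc: "x i \<in> carrier SL2" for i
  proof -
    have "fst y * snd (snd (snd y)) - fst (snd y) * fst (snd (snd y)) = 1"
      if "y \<in> carrier SL2" for y :: "'k \<times> 'k \<times> 'k \<times> 'k"
      using that by (cases y) simp
    from this[OF gc] show ?thesis by (simp add: x_def fun_eq_iff)
  qed
  have evx: "ev t (x i) = g t i" for t i by (simp add: ev_def x_def)
  define E where "E w = (case word_eval SL2 x w of (a, b, c, d) \<Rightarrow> {a - 1, b, c, d - 1})" for w
  have E: "(\<forall>f \<in> E w. f t = 0) \<longleftrightarrow> word_eval SL2 (g t) w = \<one>\<^bsub>SL2\<^esub>" for w t
  proof -
    have "word_eval SL2 (g t) w = ev t (word_eval SL2 x w)"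
      using hom_word_eval[OF group_SL2 group_SL2 ev_hom[of t], of UNIV x w] xc by (simp add: evx)
    then show ?thesis
      by (cases "word_eval SL2 x w") (simp add: E_def ev_def)
  qed
  define X where "X = (\<Union>i<n. case x i of (a, b, c, d) \<Rightarrow> {a, b, c, d})"
  have finE: "finite (E w)" for w by (cases "word_eval SL2 x w") (simp add: E_def)
  have "finite X" by (auto simp: X_def split: prod.split)
  \<comment> \<open>Words evaluate inside \<open>?K\<close>, the matrices with entries in
    \<open>R\<close>, since inverting a matrix of determinant one merely moves entries and changes
    signs.\<close>
  have inR: "\<Union> (E ` W) \<subseteq> R" if R: "subring_set R" "X \<subseteq> R" for R
  proof -
    let ?K = "{(a, b, c, d). a \<in> R \<and> b \<in> R \<and> c \<in> R \<and> d \<in> R} \<inter> carrier SL2"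
    have "subgroup ?K SL2"
    proof (rule group.subgroupI[OF group_SL2])
      have "\<one>\<^bsub>SL2\<^esub> \<in> ?K" using R by (auto simp: subring_set_def)
      then show "?K \<noteq> {}" by (rule ex_in_conv[THEN iffD1, OF exI])
      fix u assume u: "u \<in> ?K"
      obtain a b c d where abcd: "u = (a, b, c, d)" by (metis surj_pair)
      have "inv\<^bsub>SL2\<^esub> u \<in> carrier SL2" using u group.inv_closed[OF group_SL2] by blast
      moreover have "inv\<^bsub>SL2\<^esub> u = (d, - b, - c, a)"
        using u inv_SL2[of a b c d] by (simp add: abcd)
      ultimately show "inv\<^bsub>SL2\<^esub> u \<in> ?K"
        using u R by (simp add: abcd subring_set_def)
      fix v assume v: "v \<in> ?K"
      obtain a' b' c' d' where abcd': "v = (a', b', c', d')" by (metis surj_pair)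
      have "u \<otimes>\<^bsub>SL2\<^esub> v \<in> carrier SL2"
        using u v by (intro monoid.m_closed group.is_monoid group_SL2) auto
      then show "u \<otimes>\<^bsub>SL2\<^esub> v \<in> ?K"
        using u v R by (simp add: abcd abcd' subring_set_def)
    qed simp
    moreover have "x i \<in> ?K" if "i < n" for i
      using R(2) that xc[of i] unfolding X_def by (cases "x i") (fastforce)
    ultimately have "word_eval SL2 x w \<in> ?K" if "w \<in> W" for w
      using that assms by (intro word_eval_in_subgroup[OF group_SL2, of _ "{..<n}"])
        (auto simp: free_group_def)
    moreover have "a - 1 \<in> R" if "a \<in> R" for a
    proof -
      have "a + - 1 \<in> R" using R that unfolding subring_set_def by blast
      then show ?thesis by simp
    qed
    ultimately show ?thesis
      by (fastforce simp: E_def split: prod.splits)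
  qed
  obtain A0 where A0: "A0 \<subseteq> \<Union> (E ` W)" "finite A0"
    "\<And>t. \<forall>f \<in> A0. f t = 0 \<Longrightarrow> \<forall>f \<in> \<Union> (E ` W). f t = 0"
    using finite_system_of_equations[OF \<open>finite X\<close> inR] by metis
  obtain W0 where W0: "W0 \<subseteq> W" "finite W0" "A0 \<subseteq> \<Union> (E ` W0)"
  proof -
    have "\<forall>a \<in> A0. \<exists>w \<in> W. a \<in> E w" using A0(1) by blast
    then obtain c where "\<forall>a \<in> A0. c a \<in> W \<and> a \<in> E (c a)" by metis
    with A0(2) that[of "c ` A0"] show ?thesis by blast
  qed
  show ?thesis
  proof (intro exI[of _ W0] conjI allI impI)
    fix t :: "nat \<Rightarrow> 'k \<times> 'k \<times> 'k \<times> 'k"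
    assume t: "t \<in> {..<n} \<rightarrow> carrier SL2" and sat: "\<forall>w \<in> W0. word_eval SL2 t w = \<one>\<^bsub>SL2\<^esub>"
    have tg: "word_eval SL2 t w = word_eval SL2 (g t) w" if "w \<in> W" for w
      using t that assms
      by (intro word_eval_cong[of "{..<n}"]) (auto simp: g_def free_group_def Pi_iff)
    have "\<forall>w \<in> W0. \<forall>f \<in> E w. f t = 0" using sat W0(1) tg by (metis E subsetD)
    with W0(3) have "\<forall>f \<in> A0. f t = 0" by blast
    from A0(3)[OF this] have "\<forall>w \<in> W. \<forall>f \<in> E w. f t = 0" by blast
    then show "\<forall>w \<in> W. word_eval SL2 t w = \<one>\<^bsub>SL2\<^esub>" using tg by (metis E)
  qed (use W0 in auto)
qed

text \<open>\<open>W0\<close> is taken from \<open>SL2\<close> over the reals and works for all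
  \<open>F\<close> and \<open>t\<close>: a finite tuple involves finitely many basis elements, and
  the subgroup that they generate maps faithfully to \<open>SL2\<close>.\<close>

theorem free_groups_equationally_noetherian:
  fixes n :: nat
  assumes W: "W \<subseteq> carrier (free_group {..<n})"
  shows "\<exists>W0 \<subseteq> W. finite W0 \<and>
    (\<forall>(F :: ('u, 'm) monoid_scheme) t. is_free_group F \<longrightarrow> t \<in> {..<n} \<rightarrow> carrier F \<longrightarrow>
       (\<forall>w \<in> W0. word_eval F t w = \<one>\<^bsub>F\<^esub>) \<longrightarrow> (\<forall>w \<in> W. word_eval F t w = \<one>\<^bsub>F\<^esub>))"
proof -
  obtain W0 where W0: "W0 \<subseteq> W" "finite W0"
    and sat: "\<And>(t :: nat \<Rightarrow> real \<times> real \<times> real \<times> real) w. t \<in> {..<n} \<rightarrow> carrier SL2 \<Longrightarrow>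
       (\<And>w. w \<in> W0 \<Longrightarrow> word_eval SL2 t w = \<one>\<^bsub>SL2\<^esub>) \<Longrightarrow> w \<in> W \<Longrightarrow> word_eval SL2 t w = \<one>\<^bsub>SL2\<^esub>"
    using SL2_equationally_noetherian[OF W] by metis
  have main: "word_eval F t w = \<one>\<^bsub>F\<^esub>"
    if F: "is_free_group F" and t: "t \<in> {..<n} \<rightarrow> carrier F"
      and W0F: "\<forall>w \<in> W0. word_eval F t w = \<one>\<^bsub>F\<^esub>" and w: "w \<in> W"
    for F :: "('u, 'm) monoid_scheme" and t w
  proof -
    obtain B where "group F" and B: "B \<subseteq> carrier F" "word_eval F (\<lambda>x. x) \<in> iso (free_group B) F"
      using F by (auto simp: is_free_group_def)
    then have hom: "word_eval F (\<lambda>x. x) \<in> hom (free_group B) F"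
      and bij: "bij_betw (word_eval F (\<lambda>x. x)) (carrier (free_group B)) (carrier F)"
      by (auto simp: iso_def)
    have "\<forall>i<n. \<exists>u \<in> carrier (free_group B). word_eval F (\<lambda>x. x) u = t i"
      using bij t unfolding bij_betw_def by (metis PiE image_iff lessThan_iff)
    then obtain u where u: "\<And>i. i < n \<Longrightarrow> u i \<in> carrier (free_group B)"
      "\<And>i. i < n \<Longrightarrow> word_eval F (\<lambda>x. x) (u i) = t i" by metis
    \<comment> \<open>Only the basis elements that occur in the tuple matter. There are finitely
      many, whatever the size of \<open>B\<close>, so \<open>j\<close> can number them.\<close>
    define B0 where "B0 = (\<Union>i<n. fst ` set (u i))"
    have B0: "finite B0" "B0 \<subseteq> B" using u(1) by (fastforce simp: B0_def free_group_def)+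
    have uB0: "u i \<in> carrier (free_group B0)" if "i < n" for i
      using u(1)[OF that] that by (force simp: B0_def free_group_def)
    obtain j :: "'u \<Rightarrow> nat" where j: "inj_on j B0"
      using finite_imp_inj_to_nat_seg[OF B0(1)] by blast
    \<comment> \<open>This is a homomorphism on all of \<open>free_group B\<close>, but faithful
      only on words over \<open>B0\<close>, where \<open>j\<close> is injective;
      \<open>closed\<close> puts all values of words in \<open>W\<close> there.\<close>
    let ?\<rho> = "word_eval SL2 (\<lambda>x. schottky (j x))"
    have \<rho>: "?\<rho> \<in> hom (free_group B) SL2" by (rule word_eval_hom[OF group_SL2 schottky_SL2])
    have Wn: "set v \<subseteq> {..<n} \<times> UNIV" if "v \<in> W" for v
      using that W by (auto simp: free_group_def)
    have closed: "word_eval (free_group B) u v \<in> carrier (free_group B0)" if "v \<in> W" for v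
      using Wn[OF that] uB0
      by (intro word_eval_in_subgroup[OF group_free_group subgroup_free_group[OF B0(2)]]) auto
    have eqF: "word_eval F t v = \<one>\<^bsub>F\<^esub> \<longleftrightarrow> word_eval (free_group B) u v = []" if "v \<in> W" for v
    proof -
      have "word_eval F t v = word_eval F (\<lambda>x. x) (word_eval (free_group B) u v)"
        using hom_word_eval[OF group_free_group \<open>group F\<close> hom, of "{..<n}" u v] u Wn[OF that]
          word_eval_cong[of "{..<n}" t "\<lambda>i. word_eval F (\<lambda>x. x) (u i)" v F] by auto
      moreover have "word_eval (free_group B) u v \<in> carrier (free_group B)"
        using Wn[OF that] u by (intro word_eval_closed[OF group_free_group]) auto
      moreover have "[] \<in> carrier (free_group B)" by (simp add: free_group_def)
      ultimately show ?thesis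
        using inj_onD[OF bij_betw_imp_inj_on[OF bij], of "word_eval (free_group B) u v" "[]"] by auto
    qed
    have eqS: "word_eval SL2 (\<lambda>i. ?\<rho> (u i)) v = \<one>\<^bsub>SL2\<^esub> \<longleftrightarrow> word_eval (free_group B) u v = []"
      if "v \<in> W" for v
    proof -
      have "word_eval SL2 (\<lambda>i. ?\<rho> (u i)) v = ?\<rho> (word_eval (free_group B) u v)"
        using hom_word_eval[OF group_free_group group_SL2 \<rho>, of "{..<n}" u v] u Wn[OF that] by auto
      with schottky_faithful[OF j closed[OF that]] show ?thesis by auto
    qed
    have "(\<lambda>i. ?\<rho> (u i)) \<in> {..<n} \<rightarrow> carrier SL2" using u(1) hom_in_carrier[OF \<rho>] by auto
    moreover have "word_eval SL2 (\<lambda>i. ?\<rho> (u i)) v = \<one>\<^bsub>SL2\<^esub>" if "v \<in> W0" for v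
      using that W0(1) W0F eqF[of v] eqS[of v] by blast
    ultimately have "word_eval SL2 (\<lambda>i. ?\<rho> (u i)) w = \<one>\<^bsub>SL2\<^esub>" using w by (rule sat)
    then show ?thesis using eqF[OF w] eqS[OF w] by blast
  qed
  show ?thesis
  proof (rule exI[of _ W0], intro conjI allI impI)
    fix F :: "('u, 'm) monoid_scheme" and t
    assume "is_free_group F" "t \<in> {..<n} \<rightarrow> carrier F" "\<forall>w \<in> W0. word_eval F t w = \<one>\<^bsub>F\<^esub>"
    from main[OF this] show "\<forall>w \<in> W. word_eval F t w = \<one>\<^bsub>F\<^esub>" by (rule ballI)
  qed (fact W0)+
qed

section \<open>Approximation by free groups\<close>

lemma one_free_group: "\<one>\<^bsub>free_group X\<^esub> = []"
  by (simp add: free_group_def)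

lemma mult_free_group: "u \<otimes>\<^bsub>free_group X\<^esub> v = foldr push_letter u v"
  by (simp add: free_group_def)

lemma word_eval_single: "group H \<Longrightarrow> f x \<in> carrier H \<Longrightarrow> word_eval H f [(x, True)] = f x"
  by (simp add: word_eval_def group.is_monoid)

lemma word_eval_group_hom:
  assumes "group H" "\<And>x. x \<in> X \<Longrightarrow> f x \<in> carrier H"
  shows "group_hom (free_group X) H (word_eval H f)"
  using word_eval_hom[of H X f, OF assms] assms(1) group_free_group
  by (simp add: group_hom_def group_hom_axioms_def)

lemma word_eval_image:
  assumes "group H" "\<And>x. x \<in> X \<Longrightarrow> f x \<in> carrier H"
  shows "word_eval H f ` carrier (free_group X) = generate H (f ` X)"
proof -
  interpret group_hom "free_group X" H "word_eval H f"
    using assms by (rule word_eval_group_hom)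
  show ?thesis
  proof
    show "word_eval H f ` carrier (free_group X) \<subseteq> generate H (f ` X)"
    proof (intro image_subsetI word_eval_in_subgroup[OF assms(1), where X = X])
      show "subgroup (generate H (f ` X)) H" using assms(2) by (intro H.generate_is_subgroup) auto
    qed (auto simp: free_group_def intro: generate.incl)
    have "f x \<in> word_eval H f ` carrier (free_group X)" if "x \<in> X" for x
      using word_eval_single[OF assms(1), of f x] assms(2)[OF that] that
      by (intro image_eqI[of _ _ "[(x, True)]"]) (auto simp: free_group_def reduced_def)
    then show "generate H (f ` X) \<subseteq> word_eval H f ` carrier (free_group X)"
      by (intro H.generate_subgroup_incl img_is_subgroup) auto
  qed
qed

lemma (in group_hom) hom_eq_iff:
  assumes "x \<in> carrier G" "y \<in> carrier G"
  shows "h x = h y \<longleftrightarrow> h (x \<otimes> inv y) = \<one>\<^bsub>H\<^esub>"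
proof
  assume "h (x \<otimes> inv y) = \<one>\<^bsub>H\<^esub>"
  then have "h x \<otimes>\<^bsub>H\<^esub> inv\<^bsub>H\<^esub> h y = \<one>\<^bsub>H\<^esub>" using assms by simp
  then have "inv\<^bsub>H\<^esub> (inv\<^bsub>H\<^esub> h y) = h x" using assms by (intro H.inv_equality) auto
  then show "h x = h y" using assms by simp
qed (use assms in simp)

lemma finitely_generated_list:
  assumes "finitely_generated G"
  obtains S where "set S \<subseteq> carrier G" "generate G (set S) = carrier G"
  using assms unfolding finitely_generated_def by (metis finite_list)

text \<open>The common target of all implications towards full residual freeness: a finite pattern
  of trivial and nontrivial words in the generators must be realisable in a free group. Words that
  generate the relations in the sense of equational noetherianity turn the realising tuple into a
  homomorphism, and further words separate \<open>A\<close>.\<close>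

lemma fully_residually_freeI:
  fixes G :: "('a, 'm) monoid_scheme"
  assumes "group G" "set S \<subseteq> carrier G" "generate G (set S) = carrier G"
    and approx: "\<And>W. finite W \<Longrightarrow> W \<subseteq> carrier (free_group {..<length S}) \<Longrightarrow>
      \<exists>(F :: 'u monoid) t. is_free_group F \<and> t \<in> {..<length S} \<rightarrow> carrier F \<and>
        (\<forall>w \<in> W. word_eval F t w = \<one>\<^bsub>F\<^esub> \<longleftrightarrow> word_eval G ((!) S) w = \<one>\<^bsub>G\<^esub>)"
  shows "fully_residually_free TYPE('u) G"
  unfolding fully_residually_free_def
proof (intro allI impI, elim conjE)
  fix A assume A: "finite A" "A \<subseteq> carrier G"
  let ?X = "{..<length S}"
  let ?FS = "free_group ?X" and ?e = "word_eval G ((!) S)"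
  have SG: "S ! i \<in> carrier G" if "i \<in> ?X" for i using assms(2) that by auto
  interpret e: group_hom ?FS G ?e by (rule word_eval_group_hom[OF assms(1) SG])
  have "(!) S ` ?X = set S" by (auto simp: set_conv_nth)
  then have "?e ` carrier ?FS = carrier G"
    using word_eval_image[where X = ?X and f = "(!) S", OF assms(1) SG] assms(3) by auto
  then have "\<forall>g \<in> carrier G. \<exists>w \<in> carrier ?FS. ?e w = g" by (metis imageE)
  then obtain c where c: "\<And>g. g \<in> carrier G \<Longrightarrow> c g \<in> carrier ?FS"
    "\<And>g. g \<in> carrier G \<Longrightarrow> ?e (c g) = g" by metis
  define W where "W = {w \<in> carrier ?FS. ?e w = \<one>\<^bsub>G\<^esub>}"
  have "W \<subseteq> carrier ?FS" by (auto simp: W_def)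
  then have "\<exists>W0 \<subseteq> W. finite W0 \<and> (\<forall>(F :: 'u monoid) t. is_free_group F \<longrightarrow>
      t \<in> ?X \<rightarrow> carrier F \<longrightarrow> (\<forall>w \<in> W0. word_eval F t w = \<one>\<^bsub>F\<^esub>) \<longrightarrow> (\<forall>w \<in> W. word_eval F t w = \<one>\<^bsub>F\<^esub>))"
    by (rule free_groups_equationally_noetherian)
  then obtain W0 where W0: "W0 \<subseteq> W" "finite W0"
    and sat: "\<forall>(F :: 'u monoid) t. is_free_group F \<longrightarrow> t \<in> ?X \<rightarrow> carrier F \<longrightarrow>
       (\<forall>w \<in> W0. word_eval F t w = \<one>\<^bsub>F\<^esub>) \<longrightarrow> (\<forall>w \<in> W. word_eval F t w = \<one>\<^bsub>F\<^esub>)"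
    by (elim exE conjE)
  \<comment> \<open>These words represent the quotients of pairs from \<open>A\<close>; keeping the
    nontrivial ones nontrivial makes the map injective on \<open>A\<close>.\<close>
  define V where "V = (\<lambda>(a, b). c a \<otimes>\<^bsub>?FS\<^esub> inv\<^bsub>?FS\<^esub> c b) ` (A \<times> A)"
  have V: "V \<subseteq> carrier ?FS" using A c by (auto simp: V_def)
  have "finite (W0 \<union> V)" "W0 \<union> V \<subseteq> carrier ?FS"
    using W0 V A by (auto simp: W_def V_def)
  from approx[OF this] obtain F :: "'u monoid" and t where F: "is_free_group F" "t \<in> ?X \<rightarrow> carrier F"
    and t: "\<And>w. w \<in> W0 \<union> V \<Longrightarrow> word_eval F t w = \<one>\<^bsub>F\<^esub> \<longleftrightarrow> ?e w = \<one>\<^bsub>G\<^esub>" by blast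
  have "group F" using F(1) by (simp add: is_free_group_def)
  interpret f: group_hom ?FS F "word_eval F t"
    using F(2) by (intro word_eval_group_hom[OF \<open>group F\<close>]) auto
  have "\<forall>w \<in> W0. word_eval F t w = \<one>\<^bsub>F\<^esub>"
    using t W0(1) by (auto simp: W_def)
  then have "\<forall>w \<in> W. word_eval F t w = \<one>\<^bsub>F\<^esub>"
    by (rule sat[THEN spec, THEN spec, THEN mp, THEN mp, THEN mp, OF F])
  then have W: "word_eval F t w = \<one>\<^bsub>F\<^esub>" if "w \<in> W" for w using that by blast
  \<comment> \<open>All relators vanish at \<open>t\<close>, so the value there depends only on the
    element of \<open>G\<close> and not on the word \<open>c\<close> chosen for it.\<close>
  have wd: "word_eval F t u = word_eval F t v"
    if "u \<in> carrier ?FS" "v \<in> carrier ?FS" "?e u = ?e v" for u v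
    using that e.hom_eq_iff[of u v] f.hom_eq_iff[of u v] W[of "u \<otimes>\<^bsub>?FS\<^esub> inv\<^bsub>?FS\<^esub> v"]
    by (auto simp: W_def)
  show "\<exists>F :: 'u monoid. is_free_group F \<and> (\<exists>h \<in> hom G F. inj_on h A)"
  proof (intro exI[of _ F] conjI bexI[of _ "\<lambda>g. word_eval F t (c g)"])
    show "inj_on (\<lambda>g. word_eval F t (c g)) A"
    proof (rule inj_onI)
      fix a b assume ab: "a \<in> A" "b \<in> A" "word_eval F t (c a) = word_eval F t (c b)"
      then have abG: "a \<in> carrier G" "b \<in> carrier G" using A by auto
      have "c a \<otimes>\<^bsub>?FS\<^esub> inv\<^bsub>?FS\<^esub> c b \<in> V" using ab by (auto simp: V_def)
      then have "?e (c a) = ?e (c b)"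
        using ab(3) t[OF UnI2] f.hom_eq_iff[OF c(1)[OF abG(1)] c(1)[OF abG(2)]]
          e.hom_eq_iff[OF c(1)[OF abG(1)] c(1)[OF abG(2)]] by blast
      with abG c show "a = b" by auto
    qed
    show "(\<lambda>g. word_eval F t (c g)) \<in> hom G F"
    proof (rule homI)
      fix g g' assume g: "g \<in> carrier G" "g' \<in> carrier G"
      then have "word_eval F t (c (g \<otimes>\<^bsub>G\<^esub> g')) = word_eval F t (c g \<otimes>\<^bsub>?FS\<^esub> c g')"
        using c by (intro wd) auto
      with g c show "word_eval F t (c (g \<otimes>\<^bsub>G\<^esub> g')) = word_eval F t (c g) \<otimes>\<^bsub>F\<^esub> word_eval F t (c g')"
        by simp
    qed (use c in auto)
  qed (rule F(1))
qed

text \<open>One frame for three limits: \<open>P\<close> is a free group with \<open>Q = G\<close>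
  for marked groups, the group \<open>E\<close> with its quotient for stable sequences, and a power
  of \<open>F\<close> with its ultrapower for non-standard free groups. The maps \<open>p i\<close>
  decide the triviality of each element of \<open>P\<close> as \<open>q\<close> does, for most
  \<open>i\<close>; generators of \<open>G\<close> are lifted through \<open>q\<close>.\<close>

lemma fully_residually_free_of_limit:
  fixes G :: "('a, 'm) monoid_scheme" and F :: "'i \<Rightarrow> 'u monoid"
  assumes "group G" "finitely_generated G" "group P" "group Q"
    and q: "q \<in> hom P Q" and \<phi>: "\<phi> \<in> hom G Q" "inj_on \<phi> (carrier G)" "\<phi> ` carrier G \<subseteq> q ` carrier P"
    and F: "\<And>i. is_free_group (F i)" and p: "\<And>i. p i \<in> hom P (F i)" and "\<omega> \<noteq> bot"
    and lim: "\<And>x. x \<in> carrier P \<Longrightarrow> \<forall>\<^sub>F i in \<omega>. p i x = \<one>\<^bsub>F i\<^esub> \<longleftrightarrow> q x = \<one>\<^bsub>Q\<^esub>"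
  shows "fully_residually_free TYPE('u) G"
proof -
  obtain S where S: "set S \<subseteq> carrier G" "generate G (set S) = carrier G"
    using finitely_generated_list[OF assms(2)] .
  have SG: "S ! i \<in> carrier G" if "i \<in> {..<length S}" for i using S that by auto
  have "\<forall>i \<in> {..<length S}. \<exists>x \<in> carrier P. q x = \<phi> (S ! i)"
  proof
    fix i assume "i \<in> {..<length S}"
    from subsetD[OF \<phi>(3) imageI[OF SG[OF this]]]
    show "\<exists>x \<in> carrier P. q x = \<phi> (S ! i)" by (auto simp del: lessThan_iff)
  qed
  then obtain e where e: "\<And>i. i \<in> {..<length S} \<Longrightarrow> e i \<in> carrier P"
    "\<And>i. i \<in> {..<length S} \<Longrightarrow> q (e i) = \<phi> (S ! i)" by metis
  show ?thesis
  proof (rule fully_residually_freeI[OF assms(1) S])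
    fix W assume W: "finite W" "W \<subseteq> carrier (free_group {..<length S})"
    then have Wn: "set w \<subseteq> {..<length S} \<times> UNIV" if "w \<in> W" for w
      using that by (auto simp: free_group_def)
    have "\<forall>\<^sub>F i in \<omega>. p i (word_eval P e w) = \<one>\<^bsub>F i\<^esub> \<longleftrightarrow> q (word_eval P e w) = \<one>\<^bsub>Q\<^esub>"
      if "w \<in> W" for w
      using Wn[OF that] e by (intro lim word_eval_closed[OF \<open>group P\<close>])
    with W(1) have "\<forall>\<^sub>F i in \<omega>. \<forall>w \<in> W. p i (word_eval P e w) = \<one>\<^bsub>F i\<^esub> \<longleftrightarrow> q (word_eval P e w) = \<one>\<^bsub>Q\<^esub>"
      by (simp add: eventually_ball_finite_distrib)
    \<comment> \<open>Finitely many words are decided correctly at once, and the filter is proper,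
      so some single index serves for all of \<open>W\<close>.\<close>
    then obtain i where i: "\<And>w. w \<in> W \<Longrightarrow> p i (word_eval P e w) = \<one>\<^bsub>F i\<^esub> \<longleftrightarrow> q (word_eval P e w) = \<one>\<^bsub>Q\<^esub>"
      using eventually_happens'[OF \<open>\<omega> \<noteq> bot\<close>] by blast
    have "group (F i)" using F by (simp add: is_free_group_def)
    have "word_eval (F i) (\<lambda>j. p i (e j)) w = \<one>\<^bsub>F i\<^esub> \<longleftrightarrow> word_eval G ((!) S) w = \<one>\<^bsub>G\<^esub>"
      if w: "w \<in> W" for w
    proof -
      have "word_eval (F i) (\<lambda>j. p i (e j)) w = p i (word_eval P e w)"
        using hom_word_eval[OF \<open>group P\<close> \<open>group (F i)\<close> p e(1) Wn[OF w]] by simp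
      moreover have "q (word_eval P e w) = word_eval Q (\<lambda>j. q (e j)) w"
        using hom_word_eval[OF \<open>group P\<close> \<open>group Q\<close> q e(1) Wn[OF w]] by simp
      moreover have "\<dots> = word_eval Q (\<lambda>j. \<phi> (S ! j)) w"
        using e(2) Wn[OF w] by (rule word_eval_cong)
      moreover have "\<dots> = \<phi> (word_eval G ((!) S) w)"
        using hom_word_eval[OF \<open>group G\<close> \<open>group Q\<close> \<phi>(1) SG Wn[OF w]] by simp
      moreover have "\<phi> (word_eval G ((!) S) w) = \<one>\<^bsub>Q\<^esub> \<longleftrightarrow> word_eval G ((!) S) w = \<one>\<^bsub>G\<^esub>"
      proof -
        have "\<phi> \<one>\<^bsub>G\<^esub> = \<one>\<^bsub>Q\<^esub>" using hom_one[OF \<phi>(1) \<open>group G\<close> \<open>group Q\<close>] .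
        moreover have "word_eval G ((!) S) w \<in> carrier G" "\<one>\<^bsub>G\<^esub> \<in> carrier G"
          using word_eval_closed[OF \<open>group G\<close> SG Wn[OF w]] \<open>group G\<close> by (auto simp: group.is_monoid)
        ultimately show ?thesis using inj_onD[OF \<phi>(2)] by metis
      qed
      ultimately show ?thesis using i[OF w] by metis
    qed
    moreover have "(\<lambda>j. p i (e j)) \<in> {..<length S} \<rightarrow> carrier (F i)"
      using e(1) hom_in_carrier[OF p] by auto
    ultimately show "\<exists>(F :: 'u monoid) t. is_free_group F \<and> t \<in> {..<length S} \<rightarrow> carrier F \<and>
        (\<forall>w \<in> W. word_eval F t w = \<one>\<^bsub>F\<^esub> \<longleftrightarrow> word_eval G ((!) S) w = \<one>\<^bsub>G\<^esub>)"
      using F by blast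
  qed
qed

section \<open>The Nielsen--Schreier theorem\<close>

lemma foldr_push_append:
  "reduced (u @ v) \<Longrightarrow> foldr push_letter u v = u @ v"
proof (induction u)
  case (Cons l u)
  then have "foldr push_letter u v = u @ v" by (auto dest: reduced_ConsD[of l])
  with Cons.prems show ?case
    by (cases "u @ v") (auto simp: reduced_def)
qed simp

lemma foldr_push_singleton:
  assumes "reduced u"
  shows "foldr push_letter u [l] =
    (if u \<noteq> [] \<and> last u = inv_letter l then butlast u else u @ [l])"
proof (cases u rule: rev_cases)
  case (snoc v m)
  show ?thesis
  proof (cases "m = inv_letter l")
    case True
    have "reduced v" using assms by (auto simp: snoc reduced_def successively_append_iff)
    with True show ?thesis by (simp add: snoc foldr_push_reduced)
  next
    case False
    then have "reduced (v @ [m, l])"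
      using assms
      by (auto simp: snoc reduced_def successively_append_iff successively_Cons inv_letter_eq_iff)
    from foldr_push_append[OF this] show ?thesis
      using False by (auto simp: snoc inv_letter_eq_iff)
  qed
qed simp

lemma free_group_Nil [simp]:
  "[] \<in> carrier (free_group X)"
  "[] \<otimes>\<^bsub>free_group X\<^esub> v = v"
  "u \<in> carrier (free_group X) \<Longrightarrow> u \<otimes>\<^bsub>free_group X\<^esub> [] = u"
  "inv\<^bsub>free_group X\<^esub> [] = []"
  using monoid.inv_one[OF group.is_monoid[OF group_free_group], of X]
  by (simp_all add: free_group_def foldr_push_reduced)

lemma letter_in_free_group: "fst l \<in> X \<Longrightarrow> [l] \<in> carrier (free_group X)"
  by (cases l) (auto simp: free_group_def reduced_def)

lemma inv_letter_free_group:
  assumes "fst l \<in> X"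
  shows "inv\<^bsub>free_group X\<^esub> [l] = [inv_letter l]"
proof -
  have "[inv_letter l] \<in> carrier (free_group X)"
    using assms by (intro letter_in_free_group) (simp add: inv_letter_def)
  then show ?thesis
    using group.inv_equality[OF group_free_group, of X "[inv_letter l]" "[l]"]
      letter_in_free_group[OF assms] by (simp add: mult_free_group one_free_group)
qed

lemma word_eval_free_group:
  assumes "w \<in> carrier (free_group X)"
  shows "word_eval (free_group X) (\<lambda>x. [(x, True)]) w = w"
proof -
  have "set w \<subseteq> X \<times> UNIV \<Longrightarrow> word_eval (free_group X) (\<lambda>x. [(x, True)]) w = foldr push_letter w []"
  proof (induction w)
    case (Cons l w)
    have "(if snd l then [(fst l, True)] else inv\<^bsub>free_group X\<^esub> [(fst l, True)]) = [l]"
      using Cons.prems by (cases l) (auto simp: inv_letter_free_group inv_letter_def)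
    with Cons show ?case
      by (simp add: word_eval_Cons mult_free_group)
  qed (simp add: one_free_group)
  then show ?thesis using assms by (simp add: free_group_def foldr_push_reduced)
qed

text \<open>\<open>T\<close> represents the right cosets of \<open>K\<close>, once each. Closure
  under prefixes makes it a tree rooted at \<open>[]\<close> in the coset graph.\<close>

locale schreier_transversal =
  fixes X :: "'x set" and K T :: "'x fword set"
  assumes K: "subgroup K (free_group X)"
    and T_carrier: "T \<subseteq> carrier (free_group X)"
    and Nil_T: "[] \<in> T"
    and T_prefix: "u @ [l] \<in> T \<Longrightarrow> u \<in> T"
    and T_unique: "s \<in> T \<Longrightarrow> t \<in> T \<Longrightarrow>
      s \<otimes>\<^bsub>free_group X\<^esub> inv\<^bsub>free_group X\<^esub> t \<in> K \<Longrightarrow> s = t"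
    and T_complete: "g \<in> carrier (free_group X) \<Longrightarrow>
      \<exists>t \<in> T. g \<otimes>\<^bsub>free_group X\<^esub> inv\<^bsub>free_group X\<^esub> t \<in> K"
begin

abbreviation "F \<equiv> free_group X"

interpretation F: group F by (rule group_free_group)

definition rel :: "'x fword \<Rightarrow> 'x fword \<Rightarrow> bool" where
  "rel g h \<longleftrightarrow> g \<otimes>\<^bsub>F\<^esub> inv\<^bsub>F\<^esub> h \<in> K"

lemma rel_refl: "g \<in> carrier F \<Longrightarrow> rel g g"
  using K by (simp add: rel_def subgroup.one_closed)

lemma rel_sym:
  assumes "g \<in> carrier F" "h \<in> carrier F" "rel g h"
  shows "rel h g"
proof -
  have "inv\<^bsub>F\<^esub> (g \<otimes>\<^bsub>F\<^esub> inv\<^bsub>F\<^esub> h) \<in> K"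
    using assms(3) subgroup.m_inv_closed[OF K] by (simp add: rel_def)
  then show ?thesis using assms by (simp add: rel_def F.inv_mult_group)
qed

lemma rel_trans:
  assumes "g \<in> carrier F" "h \<in> carrier F" "k \<in> carrier F" "rel g h" "rel h k"
  shows "rel g k"
proof -
  have "(g \<otimes>\<^bsub>F\<^esub> inv\<^bsub>F\<^esub> h) \<otimes>\<^bsub>F\<^esub> (h \<otimes>\<^bsub>F\<^esub> inv\<^bsub>F\<^esub> k) \<in> K"
    using assms(4,5) unfolding rel_def by (rule subgroup.m_closed[OF K])
  moreover have "inv\<^bsub>F\<^esub> h \<otimes>\<^bsub>F\<^esub> (h \<otimes>\<^bsub>F\<^esub> inv\<^bsub>F\<^esub> k) = inv\<^bsub>F\<^esub> k"
    using assms(1-3) by (simp add: F.m_assoc[symmetric])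
  ultimately show ?thesis using assms by (simp add: rel_def F.m_assoc)
qed

lemma rel_mult:
  assumes "g \<in> carrier F" "h \<in> carrier F" "k \<in> carrier F"
  shows "rel (g \<otimes>\<^bsub>F\<^esub> k) (h \<otimes>\<^bsub>F\<^esub> k) \<longleftrightarrow> rel g h"
proof -
  have "(g \<otimes>\<^bsub>F\<^esub> k) \<otimes>\<^bsub>F\<^esub> inv\<^bsub>F\<^esub> (h \<otimes>\<^bsub>F\<^esub> k) = g \<otimes>\<^bsub>F\<^esub> ((k \<otimes>\<^bsub>F\<^esub> inv\<^bsub>F\<^esub> k) \<otimes>\<^bsub>F\<^esub> inv\<^bsub>F\<^esub> h)"
    using assms by (simp only: F.inv_mult_group F.m_assoc F.inv_closed F.m_closed)
  then show ?thesis using assms by (simp add: rel_def)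
qed

definition rep :: "'x fword \<Rightarrow> 'x fword" where
  "rep g = (SOME t. t \<in> T \<and> rel g t)"

lemma rep_T: "g \<in> carrier F \<Longrightarrow> rep g \<in> T"
  and rel_rep: "g \<in> carrier F \<Longrightarrow> rel g (rep g)"
  using someI_ex[of "\<lambda>t. t \<in> T \<and> rel g t"] T_complete[of g]
  by (auto simp: rep_def rel_def)

lemma rep_carrier: "g \<in> carrier F \<Longrightarrow> rep g \<in> carrier F"
  using rep_T T_carrier by auto

lemma rep_eqI:
  assumes "g \<in> carrier F" "t \<in> T" "rel g t"
  shows "rep g = t"
proof -
  have t: "t \<in> carrier F" using assms(2) T_carrier by auto
  have "rel (rep g) t"
    using rel_trans[OF rep_carrier _ t rel_sym] assms rel_rep[OF assms(1)] rep_carrier by blast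
  with assms T_unique[OF rep_T] show ?thesis by (simp add: rel_def)
qed

text \<open>The free group acts on right cosets by right multiplication, so an intermediate passage
  to the representative does not change the coset reached.\<close>

lemma rep_rep_mult:
  assumes "g \<in> carrier F" "h \<in> carrier F"
  shows "rep (rep g \<otimes>\<^bsub>F\<^esub> h) = rep (g \<otimes>\<^bsub>F\<^esub> h)"
proof (rule rep_eqI)
  have "rel (rep g \<otimes>\<^bsub>F\<^esub> h) (g \<otimes>\<^bsub>F\<^esub> h)"
    using assms rel_rep rel_sym rep_carrier by (simp add: rel_mult)
  then show "rel (rep g \<otimes>\<^bsub>F\<^esub> h) (rep (g \<otimes>\<^bsub>F\<^esub> h))"
    using assms rel_rep[of "g \<otimes>\<^bsub>F\<^esub> h"] rep_carrier by (auto intro: rel_trans)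
qed (use assms rep_carrier rep_T in auto)

lemma rep_self: "t \<in> T \<Longrightarrow> rep t = t"
  using T_carrier by (intro rep_eqI) (auto intro: rel_refl)

lemma rep_K: "k \<in> K \<Longrightarrow> rep k = []"
  using subgroup.subset[OF K] Nil_T
  by (intro rep_eqI) (auto simp: rel_def one_free_group[of X, symmetric])

text \<open>The pairs \<open>(t, l)\<close> are the edges of the coset graph; \<open>edge t l\<close> is the Schreier generator of
  such an edge, and it is trivial on the spanning tree \<open>T\<close>.\<close>

definition edge :: "'x fword \<Rightarrow> 'x \<times> bool \<Rightarrow> 'x fword" where
  "edge t l = (t \<otimes>\<^bsub>F\<^esub> [l]) \<otimes>\<^bsub>F\<^esub> inv\<^bsub>F\<^esub> rep (t \<otimes>\<^bsub>F\<^esub> [l])"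

definition basis :: "'x fword set" where
  "basis = {edge t (x, True) | t x. t \<in> T \<and> x \<in> X} - {[]}"

text \<open>\<open>basis\<close> uses positive letters only. An edge along an inverse letter is
  therefore recorded as the formal inverse of the generator of the reversed edge.\<close>

definition label :: "'x fword \<Rightarrow> 'x \<times> bool \<Rightarrow> 'x fword fword" where
  "label t l = (if edge t l = [] then []
     else if snd l then [(edge t l, True)] else [(inv\<^bsub>F\<^esub> edge t l, False)])"

lemma edge_K:
  assumes "t \<in> T" "fst l \<in> X"
  shows "edge t l \<in> K"
  using rel_rep[of "t \<otimes>\<^bsub>F\<^esub> [l]"] assms T_carrier letter_in_free_group[of l X]
  by (auto simp: edge_def rel_def)

lemma inv_letter_fst [simp]: "fst (inv_letter l) = fst l" "snd (inv_letter l) = (\<not> snd l)"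
  by (simp_all add: inv_letter_def)

lemma letter_mult_inv_letter:
  assumes "t \<in> carrier F" "fst l \<in> X"
  shows "t \<otimes>\<^bsub>F\<^esub> [l] \<otimes>\<^bsub>F\<^esub> [inv_letter l] = t"
  using assms letter_in_free_group[of l X]
  by (simp add: inv_letter_free_group[symmetric] F.m_assoc)

lemma rep_edge_end:
  assumes "t \<in> T" "fst l \<in> X"
  shows "rep (rep (t \<otimes>\<^bsub>F\<^esub> [l]) \<otimes>\<^bsub>F\<^esub> [inv_letter l]) = t"
  using assms T_carrier letter_in_free_group[of l X] letter_in_free_group[of "inv_letter l" X]
  by (subst rep_rep_mult) (auto simp: letter_mult_inv_letter rep_self)

lemma edge_inv:
  assumes "t \<in> T" "fst l \<in> X"
  shows "edge (rep (t \<otimes>\<^bsub>F\<^esub> [l])) (inv_letter l) = inv\<^bsub>F\<^esub> edge t l"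
proof -
  have c: "t \<in> carrier F" "[l] \<in> carrier F" "rep (t \<otimes>\<^bsub>F\<^esub> [l]) \<in> carrier F"
    using assms T_carrier letter_in_free_group[of l X] rep_carrier by auto
  have "edge (rep (t \<otimes>\<^bsub>F\<^esub> [l])) (inv_letter l)
      = rep (t \<otimes>\<^bsub>F\<^esub> [l]) \<otimes>\<^bsub>F\<^esub> [inv_letter l] \<otimes>\<^bsub>F\<^esub> inv\<^bsub>F\<^esub> t"
    by (simp only: edge_def rep_edge_end[OF assms])
  then show ?thesis
    using c assms by (simp add: edge_def F.inv_mult_group F.m_assoc inv_letter_free_group[symmetric])
qed

lemma label_carrier:
  assumes "t \<in> T" "fst l \<in> X"
  shows "label t l \<in> carrier (free_group basis)"
proof -
  have e: "edge t l \<in> carrier F" using edge_K[OF assms] subgroup.subset[OF K] by auto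
  have "inv\<^bsub>F\<^esub> edge t l \<in> basis" if "\<not> snd l" "edge t l \<noteq> []"
  proof -
    have "inv\<^bsub>F\<^esub> edge t l \<noteq> []"
      using e that F.inv_eq_1_iff[OF e] by (simp add: one_free_group)
    moreover have "inv\<^bsub>F\<^esub> edge t l = edge (rep (t \<otimes>\<^bsub>F\<^esub> [l])) (fst l, True)"
      using edge_inv[OF assms] that by (simp add: inv_letter_def)
    moreover have "rep (t \<otimes>\<^bsub>F\<^esub> [l]) \<in> T"
      using assms T_carrier letter_in_free_group[of l X] by (intro rep_T) auto
    ultimately show ?thesis using assms(2) unfolding basis_def by blast
  qed
  moreover have "edge t l \<in> basis" if "snd l" "edge t l \<noteq> []"
    using that assms by (cases l) (auto simp: basis_def)
  ultimately show ?thesis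
    by (auto simp: label_def intro!: letter_in_free_group)
qed

lemma label_inv:
  assumes "t \<in> T" "fst l \<in> X"
  shows "label (rep (t \<otimes>\<^bsub>F\<^esub> [l])) (inv_letter l) = inv\<^bsub>free_group basis\<^esub> label t l"
proof -
  interpret B: group "free_group basis" by (rule group_free_group)
  have e: "edge t l \<in> carrier F" using edge_K[OF assms] subgroup.subset[OF K] by auto
  have *: "fst m \<in> basis" if "label t l = [m]" for m
    using label_carrier[OF assms] that by (auto simp: free_group_def)
  show ?thesis
  proof (cases "edge t l = []")
    case True
    then show ?thesis
      using edge_inv[OF assms] B.inv_one F.inv_one by (simp add: label_def one_free_group)
  next
    case False
    then have "inv\<^bsub>F\<^esub> edge t l \<noteq> []"
      using F.inv_eq_1_iff[OF e] by (simp add: one_free_group)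
    with False * show ?thesis
      using edge_inv[OF assms] e by (auto simp: label_def inv_letter_free_group inv_letter_def)
  qed
qed

text \<open>The free group on \<open>X\<close> acts from the right on the pairs \<open>(u, t)\<close> of a word \<open>u\<close> over \<open>basis\<close> and
  a representative \<open>t\<close>, and \<open>rewrite w t\<close> is the word over \<open>basis\<close> in \<open>([], t) \<cdot> w\<close>. On \<open>K\<close>,
  \<open>\<lambda>k. rewrite k []\<close> is the inverse of the evaluation of words over \<open>basis\<close>.\<close>

primrec rewrite :: "'x fword \<Rightarrow> 'x fword \<Rightarrow> 'x fword fword" where
  "rewrite [] t = []"
| "rewrite (l # w) t = label t l \<otimes>\<^bsub>free_group basis\<^esub> rewrite w (rep (t \<otimes>\<^bsub>F\<^esub> [l]))"

lemma step_T: "t \<in> T \<Longrightarrow> fst l \<in> X \<Longrightarrow> rep (t \<otimes>\<^bsub>F\<^esub> [l]) \<in> T"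
  using T_carrier letter_in_free_group[of l X] by (intro rep_T) auto

lemma rewrite_carrier:
  "t \<in> T \<Longrightarrow> set w \<subseteq> X \<times> UNIV \<Longrightarrow> rewrite w t \<in> carrier (free_group basis)"
proof (induction w arbitrary: t)
  case Nil
  show ?case by (simp add: free_group_def)
next
  case (Cons l w)
  then have "fst l \<in> X" by auto
  with Cons show ?case
    using label_carrier step_T group_free_group[of basis]
    by (auto intro!: monoid.m_closed group.is_monoid)
qed

text \<open>A cancelling pair of letters walks along an edge and back, and by
  \<open>label_inv\<close> the two labels cancel. Hence rewriting is compatible with
  reduction.\<close>

lemma rewrite_push:
  assumes "t \<in> T" "set (l # w) \<subseteq> X \<times> UNIV"
  shows "rewrite (push_letter l w) t = rewrite (l # w) t"
proof (cases "\<exists>w'. w = inv_letter l # w'")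
  case True
  then obtain w' where w: "w = inv_letter l # w'" by blast
  interpret B: group "free_group basis" by (rule group_free_group)
  have l: "fst l \<in> X" using assms by auto
  have "label t l \<in> carrier (free_group basis)" by (rule label_carrier[OF assms(1) l])
  moreover have "rewrite w' t \<in> carrier (free_group basis)"
    using assms by (intro rewrite_carrier) (auto simp: w)
  ultimately show ?thesis
    using assms l by (simp add: w rep_edge_end label_inv B.m_assoc[symmetric])
next
  case False
  then have "push_letter l w = l # w" by (cases w) auto
  then show ?thesis by simp
qed

text \<open>The cocycle identity of the action: the second factor is read from the coset that the
  first one reaches. On \<open>K\<close> that coset is again \<open>[]\<close>, which gives a
  homomorphism.\<close>

lemma rewrite_mult:
  assumes "t \<in> T" "u \<in> carrier F" "v \<in> carrier F"
  shows "rewrite (u \<otimes>\<^bsub>F\<^esub> v) t =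
    rewrite u t \<otimes>\<^bsub>free_group basis\<^esub> rewrite v (rep (t \<otimes>\<^bsub>F\<^esub> u))"
proof -
  interpret B: group "free_group basis" by (rule group_free_group)
  have v: "set v \<subseteq> X \<times> UNIV" "reduced v" using assms by (auto simp: free_group_def)
  have "rewrite (foldr push_letter u v) t =
      rewrite u t \<otimes>\<^bsub>free_group basis\<^esub> rewrite v (rep (t \<otimes>\<^bsub>F\<^esub> u))"
    if "t \<in> T" "set u \<subseteq> X \<times> UNIV" "reduced u" for t
    using that
  proof (induction u arbitrary: t)
    case Nil
    then show ?case
      using T_carrier rewrite_carrier[OF Nil(1) v(1)] by (auto simp: rep_self)
  next
    case (Cons l u)
    have l: "fst l \<in> X" using Cons.prems by auto
    have u: "set u \<subseteq> X \<times> UNIV" "reduced u"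
      using Cons.prems by (cases l, auto dest: reduced_ConsD)+
    have cl: "[l] \<in> carrier F" "u \<in> carrier F" "t \<in> carrier F"
      using letter_in_free_group[OF l] u Cons.prems T_carrier by (auto simp: free_group_def)
    have rep_lu: "rep (rep (t \<otimes>\<^bsub>F\<^esub> [l]) \<otimes>\<^bsub>F\<^esub> u) = rep (t \<otimes>\<^bsub>F\<^esub> (l # u))"
    proof -
      have "[l] \<otimes>\<^bsub>F\<^esub> u = l # u"
        using foldr_push_append[of "[l]" u] Cons.prems by (simp add: mult_free_group)
      then show ?thesis using cl by (simp add: rep_rep_mult F.m_assoc)
    qed
    have "set (l # foldr push_letter u v) \<subseteq> X \<times> UNIV"
      using Cons.prems v set_foldr_push[of u v] by auto
    from rewrite_push[OF Cons.prems(1) this]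
    have "rewrite (foldr push_letter (l # u) v) t =
        label t l \<otimes>\<^bsub>free_group basis\<^esub> rewrite (foldr push_letter u v) (rep (t \<otimes>\<^bsub>F\<^esub> [l]))"
      by simp
    also have "\<dots> = label t l \<otimes>\<^bsub>free_group basis\<^esub> (rewrite u (rep (t \<otimes>\<^bsub>F\<^esub> [l]))
        \<otimes>\<^bsub>free_group basis\<^esub> rewrite v (rep (t \<otimes>\<^bsub>F\<^esub> (l # u))))"
      using Cons.IH[OF step_T[OF Cons.prems(1) l] u] by (simp add: rep_lu)
    also have "\<dots> = rewrite (l # u) t \<otimes>\<^bsub>free_group basis\<^esub> rewrite v (rep (t \<otimes>\<^bsub>F\<^esub> (l # u)))"
    proof -
      have "l # u \<in> carrier F" using Cons.prems by (simp add: free_group_def)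
      then have "rewrite v (rep (t \<otimes>\<^bsub>F\<^esub> (l # u))) \<in> carrier (free_group basis)"
        using cl(3) by (intro rewrite_carrier[OF rep_T v(1)]) simp
      then show ?thesis
        using label_carrier[OF Cons.prems(1) l] rewrite_carrier[OF step_T[OF Cons.prems(1) l] u(1)]
        by (simp only: rewrite.simps B.m_assoc)
    qed
    finally show ?case .
  qed
  with assms show ?thesis by (auto simp: mult_free_group free_group_def[of X])
qed

text \<open>Every prefix of \<open>t\<close> is its own representative, so all edges on the path
  from \<open>[]\<close> to \<open>t\<close> lie in the tree and have empty labels.\<close>

lemma rewrite_tree: "t \<in> T \<Longrightarrow> rewrite t [] = []"
proof (induction t rule: rev_induct)
  case (snoc l s)
  interpret B: group "free_group basis" by (rule group_free_group)
  have s: "s \<in> T" using snoc.prems by (rule T_prefix)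
  have l: "fst l \<in> X" and c: "s \<in> carrier F" "s @ [l] \<in> carrier F"
    using snoc.prems s T_carrier by (cases l, force simp: free_group_def)+
  have sl: "s \<otimes>\<^bsub>F\<^esub> [l] = s @ [l]"
    using c(2) by (simp add: mult_free_group foldr_push_append free_group_def)
  have "rewrite (s @ [l]) [] = rewrite s [] \<otimes>\<^bsub>free_group basis\<^esub> rewrite [l] (rep ([] \<otimes>\<^bsub>F\<^esub> s))"
    using rewrite_mult[OF Nil_T c(1) letter_in_free_group[OF l]] by (simp add: sl)
  also have "rep ([] \<otimes>\<^bsub>F\<^esub> s) = s" using s by (simp add: rep_self)
  also have "rewrite [l] s = []"
    using c(2) snoc.prems by (simp add: label_def edge_def sl rep_self one_free_group)
  finally show ?case using snoc.IH[OF s] by simp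
qed simp

lemma rewrite_hom: "(\<lambda>k. rewrite k []) \<in> hom (F\<lparr>carrier := K\<rparr>) (free_group basis)"
proof (rule homI)
  fix u v assume "u \<in> carrier (F\<lparr>carrier := K\<rparr>)" "v \<in> carrier (F\<lparr>carrier := K\<rparr>)"
  then have "u \<in> K" "u \<in> carrier F" "v \<in> carrier F" using subgroup.subset[OF K] by auto
  then show "rewrite (u \<otimes>\<^bsub>F\<lparr>carrier := K\<rparr>\<^esub> v) [] =
      rewrite u [] \<otimes>\<^bsub>free_group basis\<^esub> rewrite v []"
    using rewrite_mult[OF Nil_T, of u v] rep_K[of u]
    by simp
qed (use subgroup.subset[OF K] rewrite_carrier[OF Nil_T] in \<open>auto simp: free_group_def[of X]\<close>)

text \<open>The word \<open>t\<close> followed by the letter equals \<open>b\<close> followed by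
  \<open>?r\<close>. The paths of \<open>t\<close> and \<open>?r\<close> lie in the tree and
  contribute nothing, so both readings leave just one label.\<close>

lemma rewrite_basis:
  assumes "b \<in> basis"
  shows "rewrite b [] = [(b, True)]"
proof -
  obtain t x where b: "b = edge t (x, True)" and t: "t \<in> T" and x: "x \<in> X" and "b \<noteq> []"
    using assms by (auto simp: basis_def)
  interpret B: group "free_group basis" by (rule group_free_group)
  let ?l = "(x, True)" let ?r = "rep (t \<otimes>\<^bsub>F\<^esub> [?l])"
  have r: "?r \<in> T" using step_T[of t ?l] t x by simp
  have c: "t \<in> carrier F" "[?l] \<in> carrier F" "?r \<in> carrier F" "b \<in> carrier F" "b \<in> K"
    using t x r T_carrier letter_in_free_group[of ?l X] edge_K[of t ?l] subgroup.subset[OF K]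
    by (auto simp: b)
  have "rewrite (t \<otimes>\<^bsub>F\<^esub> [?l]) [] = [(b, True)]"
    using rewrite_mult[OF Nil_T c(1,2)] rewrite_tree[OF t] t c \<open>b \<noteq> []\<close>
    by (simp add: rep_self label_def b) (simp add: mult_free_group)
  moreover have "b \<otimes>\<^bsub>F\<^esub> ?r = t \<otimes>\<^bsub>F\<^esub> [?l]"
    using c(1-3) by (simp add: b edge_def F.m_assoc)
  moreover have "rewrite (b \<otimes>\<^bsub>F\<^esub> ?r) [] = rewrite b [] \<otimes>\<^bsub>free_group basis\<^esub> []"
    using rewrite_mult[OF Nil_T c(4,3)] rewrite_tree[OF r] rep_K[OF c(5)] by simp
  moreover have "rewrite b [] \<in> carrier (free_group basis)"
    using c(4) by (intro rewrite_carrier[OF Nil_T]) (simp add: free_group_def)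
  ultimately show ?thesis by simp
qed

text \<open>The product telescopes: each Schreier generator ends with the inverse of the
  representative with which the next one starts.\<close>

lemma word_eval_rewrite:
  assumes "t \<in> T" "w \<in> carrier F"
  shows "word_eval F (\<lambda>x. x) (rewrite w t) = t \<otimes>\<^bsub>F\<^esub> w \<otimes>\<^bsub>F\<^esub> inv\<^bsub>F\<^esub> rep (t \<otimes>\<^bsub>F\<^esub> w)"
proof -
  have bF: "b \<in> carrier F" if "b \<in> basis" for b
    using that edge_K subgroup.subset[OF K] by (fastforce simp: basis_def)
  interpret \<phi>: group_hom "free_group basis" F "word_eval F (\<lambda>x. x)"
    using bF by (rule word_eval_group_hom[OF group_free_group])
  have "set w \<subseteq> X \<times> UNIV" "reduced w" using assms by (auto simp: free_group_def)
  then show ?thesis using assms(1)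
  proof (induction w arbitrary: t)
    case Nil
    then have "t \<in> carrier F" using T_carrier by auto
    then show ?case using Nil(3) by (simp add: rep_self one_free_group)
  next
    case (Cons l w)
    have l: "fst l \<in> X" using Cons.prems by auto
    have w: "set w \<subseteq> X \<times> UNIV" "reduced w"
      using Cons.prems by (cases l, auto dest: reduced_ConsD)+
    let ?r = "rep (t \<otimes>\<^bsub>F\<^esub> [l])"
    have w': "w \<in> carrier F" using w by (simp add: free_group_def)
    have "?r \<in> carrier F" using step_T[OF Cons.prems(3) l] T_carrier by auto
    with w' have "rep (?r \<otimes>\<^bsub>F\<^esub> w) \<in> carrier F" by (intro rep_carrier) simp
    with \<open>?r \<in> carrier F\<close> w' letter_in_free_group[OF l]
    have c: "t \<in> carrier F" "[l] \<in> carrier F" "w \<in> carrier F" "?r \<in> carrier F"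
      "rep (?r \<otimes>\<^bsub>F\<^esub> w) \<in> carrier F"
      using Cons.prems(3) T_carrier by auto
    have e: "edge t l \<in> carrier F" using edge_K[OF Cons.prems(3) l] subgroup.subset[OF K] by auto
    have lw: "[l] \<otimes>\<^bsub>F\<^esub> w = l # w"
      using foldr_push_append[of "[l]" w] Cons.prems by (simp add: mult_free_group)
    have "word_eval F (\<lambda>x. x) (label t l) = edge t l"
      using e by (auto simp: label_def word_eval_Cons one_free_group)
    then have "word_eval F (\<lambda>x. x) (rewrite (l # w) t)
        = edge t l \<otimes>\<^bsub>F\<^esub> (?r \<otimes>\<^bsub>F\<^esub> w \<otimes>\<^bsub>F\<^esub> inv\<^bsub>F\<^esub> rep (?r \<otimes>\<^bsub>F\<^esub> w))"
      using Cons.IH[OF w step_T[OF Cons.prems(3) l]] label_carrier[OF Cons.prems(3) l]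
        rewrite_carrier[OF step_T[OF Cons.prems(3) l] w(1)]
      by simp
    also have "\<dots> = t \<otimes>\<^bsub>F\<^esub> ([l] \<otimes>\<^bsub>F\<^esub> w) \<otimes>\<^bsub>F\<^esub> inv\<^bsub>F\<^esub> rep (?r \<otimes>\<^bsub>F\<^esub> w)"
      using c by (simp add: edge_def F.m_assoc F.inv_solve_left')
    also have "rep (?r \<otimes>\<^bsub>F\<^esub> w) = rep (t \<otimes>\<^bsub>F\<^esub> ([l] \<otimes>\<^bsub>F\<^esub> w))"
      using c by (simp add: rep_rep_mult F.m_assoc)
    finally show ?case by (simp add: lw)
  qed
qed

end

lemma word_eval_subgroup:
  assumes "group H" "subgroup K H" "\<And>x. x \<in> X \<Longrightarrow> f x \<in> K" "set w \<subseteq> X \<times> UNIV"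
  shows "word_eval (H\<lparr>carrier := K\<rparr>) f w = word_eval H f w"
  using assms(4)
  by (induction w) (auto simp: word_eval_Cons assms(3) group.m_inv_consistent[OF assms(1,2)])

context schreier_transversal
begin

lemma is_free_subgroup: "is_free_group (F\<lparr>carrier := K\<rparr>)"
proof -
  let ?K = "F\<lparr>carrier := K\<rparr>"
  have K': "group ?K" by (rule group.subgroup_imp_group[OF group_free_group K])
  have basis_K: "b \<in> K" if "b \<in> basis" for b
    using that edge_K by (fastforce simp: basis_def)
  have hom: "word_eval ?K (\<lambda>x. x) \<in> hom (free_group basis) ?K"
    using basis_K by (intro word_eval_hom[OF K']) simp
  have rewrite_eval: "rewrite (word_eval ?K (\<lambda>x. x) w) [] = w" if w: "w \<in> carrier (free_group basis)" for w
  proof -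
    have "set w \<subseteq> basis \<times> UNIV" using w by (simp add: free_group_def)
    then have "rewrite (word_eval ?K (\<lambda>x. x) w) [] = word_eval (free_group basis) (\<lambda>b. rewrite b []) w"
      using basis_K by (intro hom_word_eval[OF K' group_free_group rewrite_hom]) auto
    also have "\<dots> = word_eval (free_group basis) (\<lambda>b. [(b, True)]) w"
      using rewrite_basis \<open>set w \<subseteq> basis \<times> UNIV\<close> by (rule word_eval_cong)
    also have "\<dots> = w" by (rule word_eval_free_group[OF w])
    finally show ?thesis .
  qed
  have eval_rewrite: "word_eval ?K (\<lambda>x. x) (rewrite k []) = k \<and> rewrite k [] \<in> carrier (free_group basis)"
    if k: "k \<in> K" for k
  proof -
    have kF: "k \<in> carrier F" using k subgroup.subset[OF K] by auto
    then have c: "rewrite k [] \<in> carrier (free_group basis)"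
      by (intro rewrite_carrier[OF Nil_T]) (simp add: free_group_def)
    then have "word_eval ?K (\<lambda>x. x) (rewrite k []) = word_eval F (\<lambda>x. x) (rewrite k [])"
      using basis_K by (intro word_eval_subgroup[OF group_free_group K, of basis])
        (auto simp: free_group_def)
    with c kF show ?thesis using word_eval_rewrite[OF Nil_T kF] rep_K[OF k] by simp
  qed
  have "bij_betw (word_eval ?K (\<lambda>x. x)) (carrier (free_group basis)) (carrier ?K)"
    using rewrite_eval eval_rewrite hom_in_carrier[OF hom]
    by (intro bij_betw_byWitness[where f' = "\<lambda>k. rewrite k []"]) auto
  with hom K' basis_K show ?thesis
    unfolding is_free_group_def iso_def by auto
qed

end

text \<open>Zorn's lemma applied to prefix-closed sets that meet each coset at most once. A maximal
  one meets every coset, by induction on the length of a word in the coset.\<close>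

lemma schreier_transversal_exists:
  assumes K: "subgroup K (free_group X)"
  shows "\<exists>T. schreier_transversal X K T"
proof -
  let ?F = "free_group X"
  interpret F: group ?F by (rule group_free_group)
  define \<T> where "\<T> = {T. T \<subseteq> carrier ?F \<and> [] \<in> T \<and> (\<forall>u l. u @ [l] \<in> T \<longrightarrow> u \<in> T) \<and>
     (\<forall>s \<in> T. \<forall>t \<in> T. s \<otimes>\<^bsub>?F\<^esub> inv\<^bsub>?F\<^esub> t \<in> K \<longrightarrow> s = t)}"
  have "{[]} \<in> \<T>" by (auto simp: \<T>_def)
  then have "\<T> \<noteq> {}" by blast
  then have "\<exists>M \<in> \<T>. \<forall>T \<in> \<T>. M \<subseteq> T \<longrightarrow> T = M"
  proof (rule subset_Zorn_nonempty)
    fix C assume C: "C \<noteq> {}" "subset.chain \<T> C"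
    then have CT: "C \<subseteq> \<T>" by (simp add: subset_chain_def)
    show "\<Union> C \<in> \<T>"
      unfolding \<T>_def
    proof (intro CollectI conjI allI ballI impI)
      show "\<Union> C \<subseteq> carrier ?F" using CT by (auto simp: \<T>_def)
      show "[] \<in> \<Union> C" using C(1) CT by (auto simp: \<T>_def)
      show "u \<in> \<Union> C" if ul: "u @ [l] \<in> \<Union> C" for u l
      proof -
        obtain U where "U \<in> C" "u @ [l] \<in> U" using ul by blast
        moreover from this CT have "u \<in> U" unfolding \<T>_def by blast
        ultimately show ?thesis by blast
      qed
      show "s = t" if st: "s \<in> \<Union> C" "t \<in> \<Union> C" "s \<otimes>\<^bsub>?F\<^esub> inv\<^bsub>?F\<^esub> t \<in> K" for s t
      proof -
        obtain S S' where S: "S \<in> C" "s \<in> S" "S' \<in> C" "t \<in> S'" using st by blast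
        then have "S \<subseteq> S' \<or> S' \<subseteq> S" using C(2) by (auto simp: subset_chain_def)
        then obtain U where "U \<in> C" "s \<in> U" "t \<in> U" using S by blast
        then show ?thesis using CT st(3) unfolding \<T>_def by blast
      qed
    qed
  qed
  then obtain T where T: "T \<in> \<T>" and max: "\<And>T'. T' \<in> \<T> \<Longrightarrow> T \<subseteq> T' \<Longrightarrow> T' = T" by blast
  have Tc: "T \<subseteq> carrier ?F" "[] \<in> T" "\<And>u l. u @ [l] \<in> T \<Longrightarrow> u \<in> T"
    and Tu: "\<And>s t. s \<in> T \<Longrightarrow> t \<in> T \<Longrightarrow> s \<otimes>\<^bsub>?F\<^esub> inv\<^bsub>?F\<^esub> t \<in> K \<Longrightarrow> s = t"
    using T unfolding \<T>_def by blast+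
  have complete: "\<exists>t \<in> T. g \<otimes>\<^bsub>?F\<^esub> inv\<^bsub>?F\<^esub> t \<in> K" if "g \<in> carrier ?F" for g
    using that
  proof (induction g rule: rev_induct)
    case Nil
    show ?case using Tc(2) subgroup.one_closed[OF K]
      by (intro bexI[of _ "[]"]) (simp_all add: one_free_group)
  next
    case (snoc l g)
    have l: "fst l \<in> X" and g: "g \<in> carrier ?F"
      using snoc.prems by (cases l, auto simp: free_group_def reduced_def successively_append_iff)+
    have lF: "[l] \<in> carrier ?F" by (rule letter_in_free_group[OF l])
    have gl: "g \<otimes>\<^bsub>?F\<^esub> [l] = g @ [l]"
      using snoc.prems by (simp add: mult_free_group foldr_push_append free_group_def)
    obtain t where t: "t \<in> T" "g \<otimes>\<^bsub>?F\<^esub> inv\<^bsub>?F\<^esub> t \<in> K" using snoc.IH[OF g] by blast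
    have tF: "t \<in> carrier ?F" using t Tc by auto
    have rel: "(g @ [l]) \<otimes>\<^bsub>?F\<^esub> inv\<^bsub>?F\<^esub> (t \<otimes>\<^bsub>?F\<^esub> [l]) \<in> K"
    proof -
      have "(g \<otimes>\<^bsub>?F\<^esub> [l]) \<otimes>\<^bsub>?F\<^esub> inv\<^bsub>?F\<^esub> (t \<otimes>\<^bsub>?F\<^esub> [l])
          = g \<otimes>\<^bsub>?F\<^esub> (([l] \<otimes>\<^bsub>?F\<^esub> inv\<^bsub>?F\<^esub> [l]) \<otimes>\<^bsub>?F\<^esub> inv\<^bsub>?F\<^esub> t)"
        using g lF tF by (simp only: F.inv_mult_group F.m_assoc F.inv_closed F.m_closed)
      then show ?thesis using g lF tF t(2) by (simp add: gl)
    qed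
    show ?case
    proof (cases "t \<noteq> [] \<and> last t = inv_letter l")
      case True
      \<comment> \<open>Multiplying by \<open>[l]\<close> cancels the last letter, which leads to a
        prefix of \<open>t\<close> and hence stays in \<open>T\<close>.\<close>
      then have "t \<otimes>\<^bsub>?F\<^esub> [l] = butlast t"
        using tF by (simp add: mult_free_group foldr_push_singleton free_group_def)
      moreover have "butlast t \<in> T" using True t(1) Tc(3) by (metis append_butlast_last_id)
      ultimately show ?thesis using rel by auto
    next
      case False
      then have tl: "t \<otimes>\<^bsub>?F\<^esub> [l] = t @ [l]"
        using tF by (auto simp: mult_free_group foldr_push_singleton free_group_def)
      show ?thesis
      proof (cases "\<exists>s \<in> T. (t @ [l]) \<otimes>\<^bsub>?F\<^esub> inv\<^bsub>?F\<^esub> s \<in> K")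
        case True
        then obtain s where s: "s \<in> T" "(t @ [l]) \<otimes>\<^bsub>?F\<^esub> inv\<^bsub>?F\<^esub> s \<in> K" by blast
        have c: "g @ [l] \<in> carrier ?F" "t @ [l] \<in> carrier ?F" "s \<in> carrier ?F"
          using snoc.prems F.m_closed[OF tF lF] s Tc by (auto simp: tl)
        have "((g @ [l]) \<otimes>\<^bsub>?F\<^esub> inv\<^bsub>?F\<^esub> (t @ [l])) \<otimes>\<^bsub>?F\<^esub> ((t @ [l]) \<otimes>\<^bsub>?F\<^esub> inv\<^bsub>?F\<^esub> s) \<in> K"
          using subgroup.m_closed[OF K] rel s(2) by (simp add: tl)
        also have "((g @ [l]) \<otimes>\<^bsub>?F\<^esub> inv\<^bsub>?F\<^esub> (t @ [l])) \<otimes>\<^bsub>?F\<^esub> ((t @ [l]) \<otimes>\<^bsub>?F\<^esub> inv\<^bsub>?F\<^esub> s)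
            = (g @ [l]) \<otimes>\<^bsub>?F\<^esub> ((inv\<^bsub>?F\<^esub> (t @ [l]) \<otimes>\<^bsub>?F\<^esub> (t @ [l])) \<otimes>\<^bsub>?F\<^esub> inv\<^bsub>?F\<^esub> s)"
          using c by (simp only: F.m_assoc F.inv_closed F.m_closed)
        also have "\<dots> = (g @ [l]) \<otimes>\<^bsub>?F\<^esub> inv\<^bsub>?F\<^esub> s" using c by simp
        finally show ?thesis using s(1) by blast
      next
        case False
        \<comment> \<open>The coset of \<open>t @ [l]\<close> is not represented and the prefix
          \<open>t\<close> lies in \<open>T\<close>, so \<open>t @ [l]\<close> may be added;
          maximality puts it in \<open>T\<close>.\<close>
        define T' where "T' = insert (t @ [l]) T"
        have c: "t @ [l] \<in> carrier ?F" using F.m_closed[OF tF lF] by (simp add: tl)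
        have "s \<otimes>\<^bsub>?F\<^esub> inv\<^bsub>?F\<^esub> (t @ [l]) \<notin> K" if "s \<in> T" for s
        proof
          assume "s \<otimes>\<^bsub>?F\<^esub> inv\<^bsub>?F\<^esub> (t @ [l]) \<in> K"
          from subgroup.m_inv_closed[OF K this] have "(t @ [l]) \<otimes>\<^bsub>?F\<^esub> inv\<^bsub>?F\<^esub> s \<in> K"
            using c that Tc by (auto simp: F.inv_mult_group)
          with False that show False by blast
        qed
        then have "T' \<in> \<T>"
          using False Tc c t(1) Tu unfolding \<T>_def T'_def by blast
        then have "t @ [l] \<in> T" using max[of T'] by (auto simp: T'_def)
        with rel show ?thesis by (auto simp: tl)
      qed
    qed
  qed
  show ?thesis
    by (rule exI, rule schreier_transversal.intro[OF K Tc Tu complete])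
qed

theorem nielsen_schreier:
  assumes "subgroup K (free_group X)"
  shows "is_free_group (free_group X\<lparr>carrier := K\<rparr>)"
  using schreier_transversal_exists[OF assms] schreier_transversal.is_free_subgroup by blast

section \<open>Bases, subgroups and ranks of free groups\<close>

definition free_basis :: "('a, 'm) monoid_scheme \<Rightarrow> 'a set \<Rightarrow> bool" where
  "free_basis F B \<longleftrightarrow> group F \<and> B \<subseteq> carrier F \<and> word_eval F (\<lambda>x. x) \<in> iso (free_group B) F"

lemma is_free_group_iff: "is_free_group F \<longleftrightarrow> (\<exists>B. free_basis F B)"
  by (auto simp: is_free_group_def free_basis_def)

lemma word_eval_map: "word_eval H g (map (map_prod f id) w) = word_eval H (\<lambda>x. g (f x)) w"
  by (induction w) (auto simp: word_eval_Cons)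

lemma map_free_group:
  assumes "inj_on f X" "w \<in> carrier (free_group X)"
  shows "map (map_prod f id) w \<in> carrier (free_group (f ` X))"
proof -
  have "successively (\<lambda>l m. map_prod f id m \<noteq> inv_letter (map_prod f id l)) w"
    if "set w \<subseteq> X \<times> UNIV" "successively (\<lambda>l m. m \<noteq> inv_letter l) w"
    using that
  proof (induction w rule: induct_list012)
    case (3 l m w)
    then have "fst l \<in> X" "fst m \<in> X" by auto
    with 3 inj_onD[OF assms(1), of "fst m" "fst l"] show ?case
      by (cases l; cases m) (auto simp: inv_letter_def)
  qed auto
  with assms(2) show ?thesis
    by (auto simp: free_group_def reduced_def successively_map)
qed

lemma bij_map_free_group:
  assumes "inj_on f X"
  shows "bij_betw (map (map_prod f id)) (carrier (free_group X)) (carrier (free_group (f ` X)))"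
proof (rule bij_betw_byWitness[where f' = "map (map_prod (inv_into X f) id)"])
  have inj: "inj_on (inv_into X f) (f ` X)" by (rule inj_on_inv_into) simp
  have img: "inv_into X f ` f ` X = X" using assms by (simp add: inv_into_image_cancel)
  show "map (map_prod f id) ` carrier (free_group X) \<subseteq> carrier (free_group (f ` X))"
    using map_free_group[OF assms] by blast
  show "map (map_prod (inv_into X f) id) ` carrier (free_group (f ` X)) \<subseteq> carrier (free_group X)"
    using map_free_group[OF inj] by (simp add: img image_subset_iff)
  show "\<forall>w \<in> carrier (free_group X). map (map_prod (inv_into X f) id) (map (map_prod f id) w) = w"
  proof
    fix w assume "w \<in> carrier (free_group X)"
    then have "set w \<subseteq> X \<times> UNIV" by (simp add: free_group_def)
    then show "map (map_prod (inv_into X f) id) (map (map_prod f id) w) = w"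
      using assms by (induction w) auto
  qed
  show "\<forall>w \<in> carrier (free_group (f ` X)). map (map_prod f id) (map (map_prod (inv_into X f) id) w) = w"
  proof
    fix w assume "w \<in> carrier (free_group (f ` X))"
    then have "set w \<subseteq> f ` X \<times> UNIV" by (simp add: free_group_def)
    then show "map (map_prod f id) (map (map_prod (inv_into X f) id) w) = w"
      by (induction w) (auto simp: f_inv_into_f)
  qed
qed

lemma is_free_group_iso:
  assumes "is_free_group F" "group H" "\<phi> \<in> iso F H"
  shows "is_free_group H"
proof -
  obtain B where F: "group F" and B: "B \<subseteq> carrier F" "word_eval F (\<lambda>x. x) \<in> iso (free_group B) F"
    using assms(1) by (auto simp: is_free_group_def)
  have \<phi>: "\<phi> \<in> hom F H" "bij_betw \<phi> (carrier F) (carrier H)" using assms(3) by (auto simp: iso_def)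
  then have inj: "inj_on \<phi> B" using B(1) by (auto simp: bij_betw_def intro: inj_on_subset)
  have BH: "\<phi> ` B \<subseteq> carrier H" using hom_in_carrier[OF \<phi>(1)] B(1) by auto
  have "bij_betw (\<phi> \<circ> word_eval F (\<lambda>x. x)) (carrier (free_group B)) (carrier H)"
    using B(2) \<phi>(2) by (intro bij_betw_trans) (auto simp: iso_def)
  moreover have "(\<phi> \<circ> word_eval F (\<lambda>x. x)) w = (word_eval H (\<lambda>x. x) \<circ> map (map_prod \<phi> id)) w"
    if "w \<in> carrier (free_group B)" for w
    using hom_word_eval[OF F assms(2) \<phi>(1), of B "\<lambda>x. x" w] B(1) that
    by (auto simp: word_eval_map free_group_def)
  ultimately have "bij_betw (word_eval H (\<lambda>x. x) \<circ> map (map_prod \<phi> id))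
      (carrier (free_group B)) (carrier H)"
    by (simp cong: bij_betw_cong)
  then have "bij_betw (word_eval H (\<lambda>x. x)) (carrier (free_group (\<phi> ` B))) (carrier H)"
    using bij_betw_comp_iff[OF bij_map_free_group[OF inj]] by blast
  moreover have "word_eval H (\<lambda>x. x) \<in> hom (free_group (\<phi> ` B)) H"
    using BH by (intro word_eval_hom[OF assms(2)]) auto
  ultimately show ?thesis
    using BH assms(2) unfolding is_free_group_def iso_def by blast
qed

lemma is_free_group_subgroup:
  assumes "is_free_group F" "subgroup K F"
  shows "is_free_group (F\<lparr>carrier := K\<rparr>)"
proof -
  obtain B where F: "group F" and B: "B \<subseteq> carrier F" "word_eval F (\<lambda>x. x) \<in> iso (free_group B) F"
    using assms(1) by (auto simp: is_free_group_def)
  define \<psi> where "\<psi> = inv_into (carrier (free_group B)) (word_eval F (\<lambda>x. x))"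
  have \<psi>: "\<psi> \<in> iso F (free_group B)"
    unfolding \<psi>_def by (rule group.iso_set_sym[OF group_free_group B(2)])
  interpret \<psi>: group_hom F "free_group B" \<psi>
    using \<psi> F group_free_group by (simp add: group_hom_def group_hom_axioms_def iso_def)
  have K: "subgroup (\<psi> ` K) (free_group B)" by (rule \<psi>.subgroup_img_is_subgroup[OF assms(2)])
  have KF: "K \<subseteq> carrier F" by (rule subgroup.subset[OF assms(2)])
  have inj: "inj_on \<psi> K"
    using \<psi> KF by (auto simp: iso_def bij_betw_def intro: inj_on_subset)
  have "\<psi> \<in> hom (F\<lparr>carrier := K\<rparr>) (free_group B\<lparr>carrier := \<psi> ` K\<rparr>)"
    using KF by (auto intro!: homI simp: subset_iff)
  with inj have iso: "\<psi> \<in> iso (F\<lparr>carrier := K\<rparr>) (free_group B\<lparr>carrier := \<psi> ` K\<rparr>)"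
    by (simp add: iso_def bij_betw_def)
  have G: "group (F\<lparr>carrier := K\<rparr>)" by (rule group.subgroup_imp_group[OF F assms(2)])
  from is_free_group_iso[OF nielsen_schreier[OF K] G group.iso_set_sym[OF G iso]]
  show ?thesis .
qed

lemma is_free_group_image:
  assumes "is_free_group F" "group G" "h \<in> hom G F"
  shows "is_free_group (F\<lparr>carrier := h ` carrier G\<rparr>)"
proof -
  interpret group_hom G F h
    using assms by (simp add: group_hom_def group_hom_axioms_def is_free_group_def)
  show ?thesis by (rule is_free_group_subgroup[OF assms(1) img_is_subgroup])
qed

lemma free_basis_extend:
  assumes "free_basis F B" "group H" "\<And>b. b \<in> B \<Longrightarrow> f b \<in> carrier H"
  shows "\<exists>h \<in> hom F H. (\<forall>w \<in> carrier (free_group B). h (word_eval F (\<lambda>x. x) w) = word_eval H f w)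
    \<and> (\<forall>b \<in> B. h b = f b)"
proof -
  let ?e = "word_eval F (\<lambda>x. x)"
  have F: "group F" "B \<subseteq> carrier F" "?e \<in> iso (free_group B) F"
    using assms(1) by (auto simp: free_basis_def)
  then have bij: "bij_betw ?e (carrier (free_group B)) (carrier F)" by (simp add: iso_def)
  define \<psi> where "\<psi> = inv_into (carrier (free_group B)) ?e"
  have "\<psi> \<in> hom F (free_group B)"
    using group.iso_set_sym[OF group_free_group F(3)] by (simp add: \<psi>_def iso_def)
  then have hom: "word_eval H f \<circ> \<psi> \<in> hom F H"
    using word_eval_hom[OF assms(2,3)] by (rule hom_compose)
  have eq: "(word_eval H f \<circ> \<psi>) (?e w) = word_eval H f w" if "w \<in> carrier (free_group B)" for w
    using bij that by (simp add: \<psi>_def bij_betw_def)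
  have "(word_eval H f \<circ> \<psi>) b = f b" if "b \<in> B" for b
  proof -
    have "[(b, True)] \<in> carrier (free_group B)" using that by (intro letter_in_free_group) simp
    from eq[OF this] show ?thesis
      using that F(2) assms by (auto simp: word_eval_single[OF F(1)] word_eval_single[OF assms(2)])
  qed
  with hom eq show ?thesis by blast
qed

lemma hom_eq_on_generate:
  assumes "group G" "group H" "h \<in> hom G H" "k \<in> hom G H" "S \<subseteq> carrier G"
    and "\<And>s. s \<in> S \<Longrightarrow> h s = k s" and "x \<in> generate G S"
  shows "h x = k x"
proof -
  interpret h: group_hom G H h using assms by (simp add: group_hom_def group_hom_axioms_def)
  interpret k: group_hom G H k using assms by (simp add: group_hom_def group_hom_axioms_def)
  show ?thesis using assms(7)
  proof induction
    case (eng x y)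
    then show ?case using group.generate_in_carrier[OF assms(1,5)] by simp
  qed (use assms(5,6) in auto)
qed

text \<open>Living on \<open>bool\<close>, it lets membership in a subset of a basis serve directly
  as the prescribed values of a homomorphism.\<close>

definition xor_group :: "bool monoid" where
  "xor_group = \<lparr>carrier = UNIV, monoid.mult = (\<noteq>), one = False\<rparr>"

lemma group_xor_group: "group xor_group"
  by (rule groupI) (auto simp: xor_group_def)

text \<open>A basis with \<open>r\<close> elements gives \<open>2\<^sup>r\<close> homomorphisms to the group of order two, and
  a homomorphism is determined by its values on \<open>S\<close>.\<close>

lemma free_basis_card_le:
  assumes "free_basis F B" "set S \<subseteq> carrier F" "generate F (set S) = carrier F"
  shows "finite B \<and> card B \<le> length S"
proof -
  have F: "group F" "B \<subseteq> carrier F" using assms(1) by (auto simp: free_basis_def)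
  have "\<exists>h \<in> hom F xor_group. \<forall>b \<in> B. h b = (b \<in> C)" for C
    using free_basis_extend[OF assms(1) group_xor_group, of "\<lambda>b. b \<in> C"] by (auto simp: xor_group_def)
  then obtain \<chi> where \<chi>: "\<And>C. \<chi> C \<in> hom F xor_group" "\<And>C b. b \<in> B \<Longrightarrow> \<chi> C b = (b \<in> C)" by metis
  define \<Phi> where "\<Phi> C = {i. i < length S \<and> \<chi> C (S ! i)}" for C
  have inj: "inj_on \<Phi> (Pow B)"
  proof (rule inj_onI)
    fix C D assume CD: "C \<in> Pow B" "D \<in> Pow B" "\<Phi> C = \<Phi> D"
    have "\<chi> C s = \<chi> D s" if s: "s \<in> set S" for s
    proof -
      obtain i where i: "i < length S" "s = S ! i" using s by (auto simp: in_set_conv_nth)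
      have "i \<in> \<Phi> C \<longleftrightarrow> i \<in> \<Phi> D" using CD(3) by simp
      with i show ?thesis by (simp add: \<Phi>_def)
    qed
    then have "\<chi> C b = \<chi> D b" if "b \<in> B" for b
      using hom_eq_on_generate[OF F(1) group_xor_group \<chi>(1) \<chi>(1) assms(2)] assms(3) F(2) that by blast
    then show "C = D" using \<chi>(2) CD by blast
  qed
  have sub: "\<Phi> ` Pow B \<subseteq> Pow {..<length S}" by (auto simp: \<Phi>_def)
  have "finite (Pow B)" using inj sub by (meson finite_Pow_iff finite_lessThan inj_on_finite)
  then have fin: "finite B" by simp
  have "card (Pow B) \<le> card (Pow {..<length S})" using inj sub by (intro card_inj_on_le) auto
  then have "(2::nat) ^ card B \<le> 2 ^ length S" using fin by (simp add: card_Pow)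
  with fin show ?thesis by simp
qed

text \<open>Relabelling letters along an injection of bases keeps reduced words reduced and distinct
  words distinct, so the induced homomorphism is injective.\<close>

lemma free_basis_embed:
  assumes "free_basis F B" "free_basis F' B'" "finite B" "finite B'" "card B' \<le> card B"
  shows "\<exists>h \<in> hom F' F. inj_on h (carrier F')"
proof -
  obtain f where f: "f ` B' \<subseteq> B" "inj_on f B'" using card_le_inj[OF assms(4,3,5)] by blast
  have F: "group F" "B \<subseteq> carrier F" "word_eval F (\<lambda>x. x) \<in> iso (free_group B) F"
    and F': "word_eval F' (\<lambda>x. x) \<in> iso (free_group B') F'"
    using assms(1,2) by (auto simp: free_basis_def)
  obtain h where h: "h \<in> hom F' F"
    "\<And>w. w \<in> carrier (free_group B') \<Longrightarrow> h (word_eval F' (\<lambda>x. x) w) = word_eval F f w"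
    using free_basis_extend[OF assms(2) F(1), of f] f(1) F(2) by blast
  have "inj_on h (carrier F')"
  proof (rule inj_onI)
    fix x y assume xy: "x \<in> carrier F'" "y \<in> carrier F'" "h x = h y"
    have "carrier F' = word_eval F' (\<lambda>x. x) ` carrier (free_group B')"
      using F' by (simp add: iso_def bij_betw_def)
    then obtain u v where uv: "u \<in> carrier (free_group B')" "v \<in> carrier (free_group B')"
      "x = word_eval F' (\<lambda>x. x) u" "y = word_eval F' (\<lambda>x. x) v" using xy by blast
    have "word_eval F (\<lambda>x. x) (map (map_prod f id) u) = word_eval F (\<lambda>x. x) (map (map_prod f id) v)"
      using xy(3) h(2) uv by (simp add: word_eval_map)
    moreover have "map (map_prod f id) u \<in> carrier (free_group B)"
      "map (map_prod f id) v \<in> carrier (free_group B)"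
      using map_free_group[OF f(2)] uv f(1) by (auto simp: free_group_def)
    moreover have "inj_on (word_eval F (\<lambda>x. x)) (carrier (free_group B))"
      using F(3) by (simp add: iso_def bij_betw_def)
    ultimately have "map (map_prod f id) u = map (map_prod f id) v" by (meson inj_onD)
    then have "u = v"
      using bij_map_free_group[OF f(2)] uv by (meson bij_betw_def inj_onD)
    then show "x = y" using uv by simp
  qed
  with h(1) show ?thesis by blast
qed

section \<open>Homomorphisms to a free group of maximal rank\<close>

lemma is_free_group_imp_group: "is_free_group F \<Longrightarrow> group F"
  by (simp add: is_free_group_def)

lemma generate_image:
  assumes "group G" "group F" "h \<in> hom G F" "S \<subseteq> carrier G" "generate G S = carrier G"
  shows "generate (F\<lparr>carrier := h ` carrier G\<rparr>) (h ` S) = h ` carrier G"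
proof -
  interpret group_hom G F h using assms by (simp add: group_hom_def group_hom_axioms_def)
  have "generate (F\<lparr>carrier := h ` carrier G\<rparr>) (h ` S) = generate F (h ` S)"
    using assms(4) by (intro H.generate_consistent img_is_subgroup) auto
  also have "\<dots> = h ` generate G S" by (rule generate_img[OF assms(4)])
  finally show ?thesis by (simp add: assms(5))
qed

lemma hom_onto_image: "h \<in> hom G F \<Longrightarrow> h \<in> hom G (F\<lparr>carrier := h ` carrier G\<rparr>)"
  by (auto simp: hom_def)

text \<open>Among the homomorphisms to free groups choose one whose image has maximal rank: this image
  embeds in \<open>G\<close> by freeness, and every other free image of \<open>G\<close> embeds in it.\<close>

lemma fully_residually_free_uniform:
  fixes G :: "('a, 'm) monoid_scheme"
  assumes "group G" "finitely_generated G" and frf: "fully_residually_free TYPE('u) G"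
  shows "\<exists>F :: 'u monoid. is_free_group F \<and> finitely_generated F \<and>
    (\<exists>k \<in> hom F G. inj_on k (carrier F)) \<and>
    (\<forall>A. finite A \<and> A \<subseteq> carrier G \<longrightarrow> (\<exists>h \<in> hom G F. inj_on h A))"
proof -
  obtain S where S: "set S \<subseteq> carrier G" "generate G (set S) = carrier G"
    using finitely_generated_list[OF assms(2)] .
  let ?im = "\<lambda>(F :: 'u monoid) h. F\<lparr>carrier := h ` carrier G\<rparr>"
  define P where "P r \<longleftrightarrow> (\<exists>(F :: 'u monoid) h B. is_free_group F \<and> h \<in> hom G F \<and>
    free_basis (?im F h) B \<and> card B = r)" for r
  have basis: "finite B \<and> card B \<le> length S"
    if "is_free_group F" "h \<in> hom G F" "free_basis (?im F h) B" for F :: "'u monoid" and h B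
    using free_basis_card_le[OF that(3), of "map h S"] S(1)
      generate_image[OF assms(1) is_free_group_imp_group[OF that(1)] that(2) S]
    by auto
  have ex_basis: "\<exists>B. free_basis (?im F h) B" if "is_free_group F" "h \<in> hom G F"
    for F :: "'u monoid" and h
    using is_free_group_image[OF that(1) assms(1) that(2)] by (simp add: is_free_group_iff)
  have bound: "r \<le> length S" if "P r" for r using that basis by (auto simp: P_def)
  obtain F1 :: "'u monoid" and h1 where "is_free_group F1" "h1 \<in> hom G F1"
    using frf unfolding fully_residually_free_def by (metis empty_subsetI finite.emptyI)
  then obtain r1 where "P r1" using ex_basis unfolding P_def by blast
  define r where "r = (GREATEST r. P r)"
  have "P r" unfolding r_def using \<open>P r1\<close> bound by (rule GreatestI_nat) auto
  have max: "r' \<le> r" if "P r'" for r'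
    unfolding r_def using that bound by (rule Greatest_le_nat) auto
  obtain F0 :: "'u monoid" and h B where F0: "is_free_group F0" "h \<in> hom G F0"
    and B: "free_basis (?im F0 h) B" "card B = r"
    using \<open>P r\<close> unfolding P_def by blast
  define F where "F = ?im F0 h"
  have BF: "B \<subseteq> carrier F" "group F" using B(1) by (simp_all add: free_basis_def F_def)
  have "finite B" using basis[OF F0 B(1)] by simp
  have hF: "h \<in> hom G F" unfolding F_def by (rule hom_onto_image[OF F0(2)])
  have free: "is_free_group F" using B(1) by (auto simp: is_free_group_iff F_def)
  have "generate F (h ` set S) = carrier F"
    using generate_image[OF assms(1) is_free_group_imp_group[OF F0(1)] F0(2) S] by (simp add: F_def)
  then have fg: "finitely_generated F"
    unfolding finitely_generated_def using S(1) by (intro exI[of _ "h ` set S"]) (auto simp: F_def)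
  \<comment> \<open>Preimages of the basis elements define \<open>k\<close> by freeness, and
    \<open>h\<close> undoes \<open>k\<close>: the group \<open>F\<close> is a retract of
    \<open>G\<close>.\<close>
  have "\<forall>b \<in> B. \<exists>g \<in> carrier G. h g = b" using BF(1) by (auto simp: F_def)
  then obtain g where g: "\<And>b. b \<in> B \<Longrightarrow> g b \<in> carrier G" "\<And>b. b \<in> B \<Longrightarrow> h (g b) = b" by metis
  obtain k where k: "k \<in> hom F G" "\<And>b. b \<in> B \<Longrightarrow> k b = g b"
    "\<And>w. w \<in> carrier (free_group B) \<Longrightarrow> k (word_eval F (\<lambda>x. x) w) = word_eval G g w"
    using free_basis_extend[where f = g, OF B(1) assms(1) g(1)] by (auto simp: F_def)
  have hk: "h (k x) = x" if x: "x \<in> carrier F" for x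
  proof -
    obtain w where w: "w \<in> carrier (free_group B)" "x = word_eval F (\<lambda>x. x) w"
    proof -
      have "carrier F = word_eval F (\<lambda>x. x) ` carrier (free_group B)"
        using B(1) unfolding free_basis_def F_def iso_def bij_betw_def by blast
      with x that show ?thesis by blast
    qed
    have wB: "set w \<subseteq> B \<times> UNIV" using w(1) by (simp add: free_group_def)
    have "h (k x) = h (word_eval G g w)" using k(3)[OF w(1)] by (simp add: w(2))
    also have "\<dots> = word_eval F (\<lambda>b. h (g b)) w"
      by (rule hom_word_eval[OF assms(1) BF(2) hF g(1) wB])
    also have "\<dots> = word_eval F (\<lambda>b. b) w" using g(2) wB by (rule word_eval_cong)
    finally show ?thesis by (simp add: w(2))
  qed
  have "inj_on k (carrier F)" by (rule inj_on_inverseI[of _ h]) (rule hk)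
  with k(1) have embed: "\<exists>k \<in> hom F G. inj_on k (carrier F)" by blast
  have approx: "\<exists>h \<in> hom G F. inj_on h A" if A: "finite A" "A \<subseteq> carrier G" for A
  proof -
    obtain F' :: "'u monoid" and h' where F': "is_free_group F'" "h' \<in> hom G F'" "inj_on h' A"
      using frf A unfolding fully_residually_free_def by blast
    obtain B' where B': "free_basis (?im F' h') B'" using ex_basis[OF F'(1,2)] ..
    \<comment> \<open>The image of \<open>h'\<close> has rank at most that of \<open>F\<close>, so
      it embeds in \<open>F\<close>; the composite is still injective on \<open>A\<close>.\<close>
    have "card B' \<le> card B" using max[of "card B'"] F'(1,2) B' B(2) unfolding P_def by blast
    then obtain e where e: "e \<in> hom (?im F' h') F" "inj_on e (carrier (?im F' h'))"
      using free_basis_embed[OF B(1) B' \<open>finite B\<close>] basis[OF F'(1,2) B'] by (auto simp: F_def)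
    have "e \<circ> h' \<in> hom G F" using hom_onto_image[OF F'(2)] e(1) by (rule hom_compose)
    moreover have "inj_on e (h' ` A)" using A(2) by (intro inj_on_subset[OF e(2)]) auto
    then have "inj_on (e \<circ> h') A" using F'(3) by (simp add: comp_inj_on_iff)
    ultimately show ?thesis by blast
  qed
  from free fg embed approx show ?thesis by blast
qed

section \<open>Separating sequences and convergence of marked groups\<close>

lemma countable_exhaustion:
  assumes "countable X"
  shows "\<exists>A :: nat \<Rightarrow> 'a set. (\<forall>i. finite (A i) \<and> A i \<subseteq> X) \<and> (\<forall>x \<in> X. \<forall>\<^sub>F i in sequentially. x \<in> A i)"
proof (intro exI conjI allI ballI)
  let ?A = "\<lambda>i. {x \<in> X. to_nat_on X x \<le> i}"
  show "finite (?A i)" for i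
  proof (rule inj_on_finite)
    show "inj_on (to_nat_on X) (?A i)" using inj_on_to_nat_on[OF assms] by (rule inj_on_subset) auto
    show "to_nat_on X ` ?A i \<subseteq> {..i}" by auto
  qed simp
  show "?A i \<subseteq> X" for i by auto
  show "\<forall>\<^sub>F i in sequentially. x \<in> ?A i" if "x \<in> X" for x
    using that eventually_ge_at_top[of "to_nat_on X x"] by simp
qed

lemma countable_finitely_generated:
  assumes "group G" "finitely_generated G"
  shows "countable (carrier G)"
proof -
  obtain S where S: "set S \<subseteq> carrier G" "generate G (set S) = carrier G"
    using finitely_generated_list[OF assms(2)] .
  have "(!) S ` {..<length S} = set S" by (auto simp: set_conv_nth)
  then have "carrier G = word_eval G ((!) S) ` carrier (free_group {..<length S})"
    using word_eval_image[where X = "{..<length S}" and f = "(!) S", OF assms(1)] S by auto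
  then show ?thesis by (metis countableI_type countable_image)
qed

text \<open>Take \<open>h i\<close> injective on the i-th set of an exhaustion by finite sets; any
  two given elements belong to all later sets.\<close>

lemma separating_sequence:
  assumes "countable (carrier G)"
    and "\<And>A. finite A \<Longrightarrow> A \<subseteq> carrier G \<Longrightarrow> \<exists>h \<in> hom G F. inj_on h A"
  shows "\<exists>h. (\<forall>i :: nat. h i \<in> hom G F) \<and> (\<forall>x \<in> carrier G. \<forall>y \<in> carrier G.
    x \<noteq> y \<longrightarrow> (\<forall>\<^sub>F i in sequentially. h i x \<noteq> h i y))"
proof -
  obtain A :: "nat \<Rightarrow> _ set" where A: "\<And>i. finite (A i)" "\<And>i. A i \<subseteq> carrier G"
    "\<And>x. x \<in> carrier G \<Longrightarrow> \<forall>\<^sub>F i in sequentially. x \<in> A i"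
    using countable_exhaustion[OF assms(1)] by blast
  have "\<forall>i. \<exists>h. h \<in> hom G F \<and> inj_on h (A i)" using assms(2)[OF A(1,2)] by blast
  from choice[OF this] obtain h where h: "\<And>i. h i \<in> hom G F" "\<And>i. inj_on (h i) (A i)" by blast
  show ?thesis
  proof (intro exI[of _ h] conjI allI ballI impI)
    fix x y assume xy: "x \<in> carrier G" "y \<in> carrier G" "x \<noteq> y"
    show "\<forall>\<^sub>F i in sequentially. h i x \<noteq> h i y"
      using A(3)[OF xy(1)] A(3)[OF xy(2)]
      by eventually_elim (use h(2) xy(3) in \<open>auto dest: inj_onD\<close>)
  qed (rule h(1))
qed

text \<open>Normal subgroups converge when their indicator functions converge in a product of
  discrete spaces, and that can be tested one word at a time.\<close>

lemma limitin_marked_group_space: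
  assumes N: "N \<lhd> free_group {..<n}" and M: "\<And>i. M i \<lhd> free_group {..<n}"
  shows "limitin (marked_group_space n) M N \<omega> \<longleftrightarrow>
    (\<forall>w \<in> carrier (free_group {..<n}). \<forall>\<^sub>F i in \<omega>. w \<in> M i \<longleftrightarrow> w \<in> N)"
proof -
  let ?W = "carrier (free_group {..<n})" and ?D = "\<lambda>_. discrete_topology (UNIV :: bool set)"
  let ?f = "\<lambda>N. \<lambda>w \<in> ?W. w \<in> N"
  have "limitin (marked_group_space n) M N \<omega> \<longleftrightarrow>
      limitin (product_topology ?D ?W) (\<lambda>i. ?f (M i)) (?f N) \<omega>"
  proof
    assume L: "limitin (marked_group_space n) M N \<omega>"
    show "limitin (product_topology ?D ?W) (\<lambda>i. ?f (M i)) (?f N) \<omega>"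
      unfolding limitin_def
    proof (intro conjI allI impI)
      fix U assume U: "openin (product_topology ?D ?W) U \<and> ?f N \<in> U"
      have "openin (marked_group_space n) (?f -` U \<inter> {N. N \<lhd> free_group {..<n}})"
        unfolding marked_group_space_def openin_pullback_topology using U by blast
      from limitinD[OF L this] U N
      have "\<forall>\<^sub>F i in \<omega>. M i \<in> ?f -` U \<inter> {N. N \<lhd> free_group {..<n}}" by auto
      then show "\<forall>\<^sub>F i in \<omega>. ?f (M i) \<in> U" by eventually_elim auto
    qed simp
  next
    assume L: "limitin (product_topology ?D ?W) (\<lambda>i. ?f (M i)) (?f N) \<omega>"
    show "limitin (marked_group_space n) M N \<omega>"
      unfolding limitin_def
    proof (intro conjI allI impI)
      show "N \<in> topspace (marked_group_space n)"
        using N by (simp add: marked_group_space_def topspace_pullback_topology)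
      fix V assume V: "openin (marked_group_space n) V \<and> N \<in> V"
      then obtain U where U: "openin (product_topology ?D ?W) U"
        "V = ?f -` U \<inter> {N. N \<lhd> free_group {..<n}}"
        unfolding marked_group_space_def openin_pullback_topology by blast
      with V have "?f N \<in> U" by auto
      from limitinD[OF L U(1) this] show "\<forall>\<^sub>F i in \<omega>. M i \<in> V"
        using M by (simp add: U(2))
    qed
  qed
  also have "\<dots> \<longleftrightarrow> (\<forall>w \<in> ?W. limitin (discrete_topology UNIV) (\<lambda>i. w \<in> M i) (w \<in> N) \<omega>)"
    by (simp add: limitin_componentwise)
  also have "\<dots> \<longleftrightarrow> (\<forall>w \<in> ?W. \<forall>\<^sub>F i in \<omega>. w \<in> M i \<longleftrightarrow> w \<in> N)"
  proof (intro ball_cong refl)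
    fix w
    show "limitin (discrete_topology UNIV) (\<lambda>i. w \<in> M i) (w \<in> N) \<omega> \<longleftrightarrow> (\<forall>\<^sub>F i in \<omega>. w \<in> M i \<longleftrightarrow> w \<in> N)"
    proof
      assume L: "limitin (discrete_topology UNIV) (\<lambda>i. w \<in> M i) (w \<in> N) \<omega>"
      from limitinD[OF L, of "{w \<in> N}"] show "\<forall>\<^sub>F i in \<omega>. w \<in> M i \<longleftrightarrow> w \<in> N" by simp
    next
      assume E: "\<forall>\<^sub>F i in \<omega>. w \<in> M i \<longleftrightarrow> w \<in> N"
      show "limitin (discrete_topology UNIV) (\<lambda>i. w \<in> M i) (w \<in> N) \<omega>"
        using E by (intro limitin_eventually) auto
    qed
  qed
  finally show ?thesis .
qed

text \<open>Push the marking forward along homomorphisms that are injective on larger and larger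
  finite sets. The targets are cut down to the images of \<open>G\<close>, so that the marking still
  generates; these images are free as subgroups of free groups.\<close>

lemma fully_residually_free_imp_limit_of_free_markings:
  fixes G :: "('a, 'm) monoid_scheme"
  assumes "group G" "fully_residually_free TYPE('u) G" "N \<in> markings n G"
  shows "limit_of_free_markings TYPE('u) n N"
proof -
  obtain S where N: "N = marked_kernel G S" and S: "length S = n" "set S \<subseteq> carrier G"
    "generate G (set S) = carrier G"
    using assms(3) by (auto simp: markings_def)
  have "finitely_generated G" using S by (auto simp: finitely_generated_def)
  from countable_exhaustion[OF countable_finitely_generated[OF assms(1) this]]
  obtain A :: "nat \<Rightarrow> 'a set" where A: "\<And>i. finite (A i)" "\<And>i. A i \<subseteq> carrier G"
    "\<And>x. x \<in> carrier G \<Longrightarrow> \<forall>\<^sub>F i in sequentially. x \<in> A i" by blast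
  have "\<exists>(F :: 'u monoid) h. is_free_group F \<and> h \<in> hom G F \<and> inj_on h (A i)" for i
    using assms(2)[unfolded fully_residually_free_def, rule_format, of "A i"] A(1,2)[of i] by blast
  then obtain F :: "nat \<Rightarrow> 'u monoid" and h where F: "\<And>i. is_free_group (F i)"
    "\<And>i. h i \<in> hom G (F i)" "\<And>i. inj_on (h i) (A i)" by metis
  define F' where "F' i = F i\<lparr>carrier := h i ` carrier G\<rparr>" for i
  have F': "is_free_group (F' i)" "group (F' i)" "h i \<in> hom G (F' i)" for i
    using is_free_group_image[OF F(1) assms(1) F(2)] hom_onto_image[OF F(2)]
    by (auto simp: F'_def is_free_group_imp_group)
  define M where "M i = marked_kernel (F' i) (map (h i) S)" for i
  have M: "M i \<in> markings n (F' i)" for i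
    unfolding markings_def
  proof (intro CollectI exI conjI)
    show "M i = marked_kernel (F' i) (map (h i) S)" by (simp add: M_def)
    show "set (map (h i) S) \<subseteq> carrier (F' i)" using S(2) by (auto simp: F'_def)
    show "generate (F' i) (set (map (h i) S)) = carrier (F' i)"
      using generate_image[OF assms(1) is_free_group_imp_group[OF F(1)] F(2) S(2,3)]
      by (simp add: F'_def)
  qed (simp add: S(1))
  have "limitin (marked_group_space n) M N sequentially"
    unfolding limitin_marked_group_space[OF markings_normal[OF assms(1,3)] markings_normal[OF F'(2) M]]
  proof
    fix w assume w: "w \<in> carrier (free_group {..<n})"
    then have wn: "set w \<subseteq> {..<n} \<times> UNIV" by (simp add: free_group_def)
    have Sc: "S ! i \<in> carrier G" if "i \<in> {..<n}" for i using S that by auto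
    let ?g = "word_eval G ((!) S) w"
    have g: "?g \<in> carrier G" by (rule word_eval_closed[OF assms(1) Sc wn])
    have one: "\<one>\<^bsub>G\<^esub> \<in> carrier G" using assms(1) by (simp add: group.is_monoid)
    \<comment> \<open>Triviality is phrased as coincidence with the image of the identity, so that
      injectivity on \<open>A i\<close> decides it as soon as both elements lie in
      \<open>A i\<close>.\<close>
    have M_iff: "w \<in> M i \<longleftrightarrow> h i ?g = h i \<one>\<^bsub>G\<^esub>" for i
    proof -
      have "word_eval (F' i) (\<lambda>j. map (h i) S ! j) w = word_eval (F' i) (\<lambda>j. h i (S ! j)) w"
        using wn S(1) by (intro word_eval_cong[of "{..<n}"]) auto
      also have "\<dots> = h i ?g" by (rule hom_word_eval[OF assms(1) F'(2,3) Sc wn, symmetric])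
      finally show ?thesis
        using w S(1) hom_one[OF F'(3) assms(1) F'(2)] by (simp add: M_def marked_kernel_def kernel_def)
    qed
    have N_iff: "w \<in> N \<longleftrightarrow> ?g = \<one>\<^bsub>G\<^esub>" using w S(1) by (simp add: N marked_kernel_def kernel_def)
    show "\<forall>\<^sub>F i in sequentially. w \<in> M i \<longleftrightarrow> w \<in> N"
      using A(3)[OF g] A(3)[OF one]
      by eventually_elim (use inj_onD[OF F(3)] in \<open>auto simp: M_iff N_iff\<close>)
  qed
  with F'(1) M show ?thesis unfolding limit_of_free_markings_def by blast
qed

text \<open>An instance of \<open>fully_residually_free_of_limit\<close>, with the evaluations of
  words at the markings as \<open>q\<close> and \<open>p i\<close>.\<close>

lemma limit_of_free_markings_imp_fully_residually_free:
  fixes G :: "('a, 'm) monoid_scheme"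
  assumes "group G" "N \<in> markings n G" "limit_of_free_markings TYPE('u) n N"
  shows "fully_residually_free TYPE('u) G"
proof -
  obtain S where N: "N = marked_kernel G S" and S: "length S = n" "set S \<subseteq> carrier G"
    "generate G (set S) = carrier G"
    using assms(2) by (auto simp: markings_def)
  have fg: "finitely_generated G" using S by (auto simp: finitely_generated_def)
  obtain M where "\<forall>i :: nat. \<exists>F :: 'u monoid. is_free_group F \<and> M i \<in> markings n F"
    and lim: "limitin (marked_group_space n) M N sequentially"
    using assms(3) by (auto simp: limit_of_free_markings_def)
  then obtain F :: "nat \<Rightarrow> 'u monoid" where F: "\<And>i. is_free_group (F i)" "\<And>i. M i \<in> markings n (F i)"
    by metis
  have FG: "group (F i)" for i using F(1) by (rule is_free_group_imp_group)
  have "\<exists>T. M i = marked_kernel (F i) T \<and> length T = n \<and> set T \<subseteq> carrier (F i)" for i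
    using F(2)[of i] by (auto simp: markings_def)
  then obtain T where T: "\<And>i. M i = marked_kernel (F i) (T i)" "\<And>i. length (T i) = n"
    "\<And>i. set (T i) \<subseteq> carrier (F i)" by metis
  let ?FS = "free_group {..<n}"
  have Sc: "S ! i \<in> carrier G" if "i \<in> {..<n}" for i using S that by auto
  have "(!) S ` {..<n} = set S" using S(1) by (auto simp: set_conv_nth)
  then have img: "word_eval G ((!) S) ` carrier ?FS = carrier G"
    using word_eval_image[where X = "{..<n}" and f = "(!) S", OF assms(1) Sc] S(3) by auto
  show ?thesis
  proof (rule fully_residually_free_of_limit[OF assms(1) fg group_free_group assms(1)])
    show "word_eval G ((!) S) \<in> hom ?FS G" using Sc by (rule word_eval_hom[OF assms(1)])
    show "(\<lambda>x. x) \<in> hom G G" by (auto simp: hom_def)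
    show "(\<lambda>x. x) ` carrier G \<subseteq> word_eval G ((!) S) ` carrier ?FS" by (simp add: img)
    show "is_free_group (F i)" for i by (rule F(1))
    show "word_eval (F i) ((!) (T i)) \<in> hom ?FS (F i)" for i
      using T(2,3)[of i] by (intro word_eval_hom[OF FG]) auto
    fix w assume w: "w \<in> carrier ?FS"
    have "\<forall>\<^sub>F i in sequentially. w \<in> M i \<longleftrightarrow> w \<in> N"
      using lim[unfolded limitin_marked_group_space[OF markings_normal[OF assms(1,2)] markings_normal[OF FG F(2)]]]
        w by blast
    then show "\<forall>\<^sub>F i in sequentially. word_eval (F i) ((!) (T i)) w = \<one>\<^bsub>F i\<^esub>
        \<longleftrightarrow> word_eval G ((!) S) w = \<one>\<^bsub>G\<^esub>"
      by eventually_elim (use w T(2) S(1) in \<open>simp add: T(1) N marked_kernel_def kernel_def\<close>)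
  qed simp_all
qed

section \<open>Limit groups in the sense of Sela, and universal theories\<close>

text \<open>An instance of \<open>fully_residually_free_of_limit\<close>, with the coset map of the
  stable kernel as \<open>q\<close>. The kernel is normal because finitely many eventual equations
  hold together.\<close>

lemma sela_limit_group_imp_fully_residually_free:
  fixes G :: "('a, 'm) monoid_scheme"
  assumes "group G" "finitely_generated G" "sela_limit_group TYPE('u) G"
  shows "fully_residually_free TYPE('u) G"
proof -
  obtain E F :: "'u monoid" and h where E: "group E" and F: "is_free_group F"
    and stable: "stable_sequence E F h" and iso: "G \<cong> E Mod stable_kernel E F h"
    using assms(3) unfolding sela_limit_group_def by blast
  let ?K = "stable_kernel E F h"
  have FG: "group F" using F by (rule is_free_group_imp_group)
  have h: "h i \<in> hom E F" for i using stable by (simp add: stable_sequence_def)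
  interpret h: group_hom E F "h i" for i
    using E FG h by (simp add: group_hom_def group_hom_axioms_def)
  have "?K \<lhd> E"
  proof (rule h.G.normal_invI)
    show "subgroup ?K E"
    proof (rule h.G.subgroupI)
      have "\<one>\<^bsub>E\<^esub> \<in> ?K" by (simp add: stable_kernel_def)
      then show "?K \<noteq> {}" by blast
      fix x assume x: "x \<in> ?K"
      then have "x \<in> carrier E" "\<forall>\<^sub>F i in sequentially. h i x = \<one>\<^bsub>F\<^esub>"
        by (simp_all add: stable_kernel_def)
      from this(2) have "\<forall>\<^sub>F i in sequentially. h i (inv\<^bsub>E\<^esub> x) = \<one>\<^bsub>F\<^esub>"
        by eventually_elim (use \<open>x \<in> carrier E\<close> in simp)
      with \<open>x \<in> carrier E\<close> show "inv\<^bsub>E\<^esub> x \<in> ?K" by (simp add: stable_kernel_def)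
      fix y assume "y \<in> ?K"
      then have "y \<in> carrier E" "\<forall>\<^sub>F i in sequentially. h i y = \<one>\<^bsub>F\<^esub>"
        by (simp_all add: stable_kernel_def)
      from this(2) \<open>\<forall>\<^sub>F i in sequentially. h i x = \<one>\<^bsub>F\<^esub>\<close>
      have "\<forall>\<^sub>F i in sequentially. h i (x \<otimes>\<^bsub>E\<^esub> y) = \<one>\<^bsub>F\<^esub>"
        by eventually_elim (use \<open>x \<in> carrier E\<close> \<open>y \<in> carrier E\<close> in simp)
      with \<open>x \<in> carrier E\<close> \<open>y \<in> carrier E\<close> show "x \<otimes>\<^bsub>E\<^esub> y \<in> ?K" by (simp add: stable_kernel_def)
    qed (auto simp: stable_kernel_def)
    fix x k assume x: "x \<in> carrier E" and "k \<in> ?K"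
    then have "k \<in> carrier E" "\<forall>\<^sub>F i in sequentially. h i k = \<one>\<^bsub>F\<^esub>"
      by (simp_all add: stable_kernel_def)
    from this(2) have "\<forall>\<^sub>F i in sequentially. h i (x \<otimes>\<^bsub>E\<^esub> k \<otimes>\<^bsub>E\<^esub> inv\<^bsub>E\<^esub> x) = \<one>\<^bsub>F\<^esub>"
      by eventually_elim (use x \<open>k \<in> carrier E\<close> in simp)
    with x \<open>k \<in> carrier E\<close> show "x \<otimes>\<^bsub>E\<^esub> k \<otimes>\<^bsub>E\<^esub> inv\<^bsub>E\<^esub> x \<in> ?K" by (simp add: stable_kernel_def)
  qed
  then interpret K: normal ?K E .
  obtain \<phi> where \<phi>: "\<phi> \<in> iso G (E Mod ?K)" using iso by (auto simp: is_iso_def)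
  let ?q = "\<lambda>x. ?K #>\<^bsub>E\<^esub> x"
  have img: "?q ` carrier E = carrier (E Mod ?K)" by (auto simp: FactGroup_def RCOSETS_def)
  show ?thesis
  proof (rule fully_residually_free_of_limit[OF assms(1,2) E K.factorgroup_is_group])
    show "?q \<in> hom E (E Mod ?K)" by (rule K.r_coset_hom_Mod)
    show "\<phi> \<in> hom G (E Mod ?K)" "inj_on \<phi> (carrier G)" using \<phi> by (auto simp: iso_def bij_betw_def)
    show "\<phi> ` carrier G \<subseteq> ?q ` carrier E" using \<phi> by (simp add: img iso_def bij_betw_def)
    show "is_free_group F" "h i \<in> hom E F" for i by (fact F, fact h)
    fix x assume x: "x \<in> carrier E"
    have q: "?K #>\<^bsub>E\<^esub> x = \<one>\<^bsub>E Mod ?K\<^esub> \<longleftrightarrow> x \<in> ?K"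
      using h.G.coset_join1[OF _ x K.subgroup_axioms] h.G.coset_join2[OF x K.subgroup_axioms]
      by (auto simp: FactGroup_def)
    \<comment> \<open>Stability is what turns "not eventually trivial" into "eventually nontrivial"
      for elements outside the kernel.\<close>
    have dich: "(\<forall>\<^sub>F i in sequentially. h i x = \<one>\<^bsub>F\<^esub>) \<or> (\<forall>\<^sub>F i in sequentially. h i x \<noteq> \<one>\<^bsub>F\<^esub>)"
      using stable x by (simp add: stable_sequence_def)
    show "\<forall>\<^sub>F i in sequentially. h i x = \<one>\<^bsub>F\<^esub> \<longleftrightarrow> ?K #>\<^bsub>E\<^esub> x = \<one>\<^bsub>E Mod ?K\<^esub>"
    proof (cases "x \<in> ?K")
      case False
      then have "\<not> (\<forall>\<^sub>F i in sequentially. h i x = \<one>\<^bsub>F\<^esub>)" using x unfolding stable_kernel_def by blast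
      with dich have "\<forall>\<^sub>F i in sequentially. h i x \<noteq> \<one>\<^bsub>F\<^esub>" by (simp only: simp_thms)
      then show ?thesis by eventually_elim (use q False in blast)
    next
      case True
      then have "\<forall>\<^sub>F i in sequentially. h i x = \<one>\<^bsub>F\<^esub>" unfolding stable_kernel_def by blast
      then show ?thesis by eventually_elim (use q True in blast)
    qed
  qed simp
qed

lemma isomorphic_copy:
  fixes G :: "('a, 'm) monoid_scheme" and j :: "'a \<Rightarrow> 'u"
  assumes "group G" and j: "inj_on j (carrier G)"
  shows "\<exists>E :: 'u monoid. group E \<and> j \<in> iso G E"
proof -
  interpret group G by fact
  let ?k = "inv_into (carrier G) j"
  define E where "E = \<lparr>carrier = j ` carrier G, monoid.mult = (\<lambda>x y. j (?k x \<otimes>\<^bsub>G\<^esub> ?k y)), one = j \<one>\<^bsub>G\<^esub>\<rparr>"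
  have "group E"
  proof (rule groupI)
    fix x assume "x \<in> carrier E"
    then obtain g where "g \<in> carrier G" "x = j g" by (auto simp: E_def)
    then show "\<exists>y \<in> carrier E. y \<otimes>\<^bsub>E\<^esub> x = \<one>\<^bsub>E\<^esub>"
      using j by (intro bexI[of _ "j (inv\<^bsub>G\<^esub> g)"]) (auto simp: E_def)
  qed (use j in \<open>auto simp: E_def m_assoc\<close>)
  moreover have "j \<in> iso G E" using j by (auto simp: iso_def hom_def bij_betw_def E_def)
  ultimately show ?thesis by blast
qed

lemma finitely_generated_image:
  assumes "group G" "group H" "\<phi> \<in> iso G H" "finitely_generated G"
  shows "finitely_generated H"
proof -
  interpret group_hom G H \<phi>
    using assms by (simp add: group_hom_def group_hom_axioms_def iso_def)
  obtain S where "finite S" "S \<subseteq> carrier G" "generate G S = carrier G"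
    using assms(4) by (auto simp: finitely_generated_def)
  moreover have "\<phi> ` carrier G = carrier H" using assms(3) by (simp add: iso_def bij_betw_def)
  ultimately show ?thesis
    unfolding finitely_generated_def using generate_img[of S]
    by (intro exI[of _ "\<phi> ` S"]) auto
qed

text \<open>\<open>G\<close> itself can serve as \<open>E\<close>: a separating sequence is stable
  with trivial stable kernel. Since \<open>E\<close> must live on \<open>'u\<close>, a copy of the
  countable group \<open>G\<close> is placed there, and this is where an infinite type
  enters.\<close>

lemma fully_residually_free_imp_sela_limit_group:
  fixes G :: "('a, 'm) monoid_scheme"
  assumes "group G" "finitely_generated G" "fully_residually_free TYPE('u :: infinite) G"
  shows "sela_limit_group TYPE('u) G"
proof -
  obtain F :: "'u monoid" where F: "is_free_group F" "finitely_generated F"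
    "\<And>A. finite A \<Longrightarrow> A \<subseteq> carrier G \<Longrightarrow> \<exists>h \<in> hom G F. inj_on h A"
    using fully_residually_free_uniform[OF assms] by blast
  have FG: "group F" using F(1) by (rule is_free_group_imp_group)
  have count: "countable (carrier G)" by (rule countable_finitely_generated[OF assms(1,2)])
  obtain h where h: "\<And>i :: nat. h i \<in> hom G F"
    "\<And>x y. x \<in> carrier G \<Longrightarrow> y \<in> carrier G \<Longrightarrow> x \<noteq> y \<Longrightarrow> \<forall>\<^sub>F i in sequentially. h i x \<noteq> h i y"
    using separating_sequence[OF count F(3)] by blast
  obtain f :: "nat \<Rightarrow> 'u" where f: "inj f"
    using infinite_countable_subset[OF infinite_UNIV] by blast
  have "inj_on (f \<circ> to_nat_on (carrier G)) (carrier G)"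
    by (rule comp_inj_on[OF inj_on_to_nat_on[OF count] inj_on_subset[OF f]]) simp
  from isomorphic_copy[OF assms(1) this]
  obtain E :: "'u monoid" and j where E: "group E" and j: "j \<in> iso G E" by blast
  define k where "k = inv_into (carrier G) j"
  have k: "k \<in> iso E G" unfolding k_def by (rule group.iso_set_sym[OF assms(1) j])
  interpret k: group_hom E G k
    using E assms(1) k by (simp add: group_hom_def group_hom_axioms_def iso_def)
  let ?h = "\<lambda>i. h i \<circ> k"
  have hom: "?h i \<in> hom E F" for i using k.homh h(1) by (rule hom_compose)
  have h_one: "h i \<one>\<^bsub>G\<^esub> = \<one>\<^bsub>F\<^esub>" for i by (rule hom_one[OF h(1) assms(1) FG])
  have ev: "\<forall>\<^sub>F i in sequentially. ?h i x \<noteq> \<one>\<^bsub>F\<^esub>" if "x \<in> carrier E" "k x \<noteq> \<one>\<^bsub>G\<^esub>" for x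
    using h(2)[of "k x" "\<one>\<^bsub>G\<^esub>"] that by (simp add: h_one)
  have stable: "stable_sequence E F ?h"
    unfolding stable_sequence_def
  proof (intro conjI allI ballI hom)
    fix x assume "x \<in> carrier E"
    then show "(\<forall>\<^sub>F i in sequentially. ?h i x = \<one>\<^bsub>F\<^esub>) \<or> (\<forall>\<^sub>F i in sequentially. ?h i x \<noteq> \<one>\<^bsub>F\<^esub>)"
      using ev[of x] by (cases "k x = \<one>\<^bsub>G\<^esub>") (auto simp: h_one)
  qed
  have kernel: "stable_kernel E F ?h = kernel E G k"
  proof -
    have "(\<forall>\<^sub>F i in sequentially. ?h i x = \<one>\<^bsub>F\<^esub>) \<longleftrightarrow> k x = \<one>\<^bsub>G\<^esub>" if x: "x \<in> carrier E" for x
    proof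
      assume "\<forall>\<^sub>F i in sequentially. ?h i x = \<one>\<^bsub>F\<^esub>"
      show "k x = \<one>\<^bsub>G\<^esub>"
      proof (rule ccontr)
        assume "k x \<noteq> \<one>\<^bsub>G\<^esub>"
        from ev[OF x this] \<open>\<forall>\<^sub>F i in sequentially. ?h i x = \<one>\<^bsub>F\<^esub>\<close>
        have "\<forall>\<^sub>F i :: nat in sequentially. False" by eventually_elim simp
        then show False by simp
      qed
    qed (simp add: h_one)
    then show ?thesis by (auto simp: stable_kernel_def kernel_def)
  qed
  have iso: "G \<cong> E Mod kernel E G k"
  proof (rule group.iso_sym)
    show "group (E Mod kernel E G k)" by (rule normal.factorgroup_is_group[OF k.normal_kernel])
    show "E Mod kernel E G k \<cong> G"
      using k by (intro k.FactGroup_iso) (simp add: iso_def bij_betw_def)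
  qed
  show ?thesis
    unfolding sela_limit_group_def
  proof (intro exI conjI)
    show "G \<cong> E Mod stable_kernel E F ?h" unfolding kernel by (rule iso)
  qed (fact E finitely_generated_image[OF assms(1) E j assms(2)] F(1) F(2) stable)+
qed

section \<open>Universal theories\<close>

fun formula_terms :: "qf_formula \<Rightarrow> gterm set" where
  "formula_terms (Eq s t) = {s, t}"
| "formula_terms (Neg p) = formula_terms p"
| "formula_terms (Conj p q) = formula_terms p \<union> formula_terms q"
| "formula_terms (Disj p q) = formula_terms p \<union> formula_terms q"

lemma finite_formula_terms: "finite (formula_terms p)"
  by (induction p) auto

lemma formula_terms_vars: "t \<in> formula_terms p \<Longrightarrow> term_vars t \<subseteq> formula_vars p"
  by (induction p) auto

lemma term_value_closed:
  assumes "group G" "v \<in> V \<rightarrow> carrier G" "term_vars t \<subseteq> V"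
  shows "term_value G v t \<in> carrier G"
proof -
  interpret group G by fact
  show ?thesis using assms(3) by (induction t) (use assms(2) in auto)
qed

lemma term_value_hom:
  assumes "group G" "group H" "h \<in> hom G H" "v \<in> V \<rightarrow> carrier G" "term_vars t \<subseteq> V"
  shows "term_value H (\<lambda>i. h (v i)) t = h (term_value G v t)"
proof -
  interpret group_hom G H h using assms by (simp add: group_hom_def group_hom_axioms_def)
  show ?thesis using assms(5) by (induction t) (use term_value_closed[OF assms(1,4)] in auto)
qed

text \<open>Injectivity on the values of both sides of each equation preserves its truth in both
  directions, so negations cause no trouble.\<close>

lemma satisfies_hom:
  assumes "group G" "group H" "h \<in> hom G H" "v \<in> V \<rightarrow> carrier G" "formula_vars p \<subseteq> V"
    and "inj_on h (term_value G v ` formula_terms p)"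
  shows "satisfies H (\<lambda>i. h (v i)) p \<longleftrightarrow> satisfies G v p"
  using assms(5,6)
proof (induction p)
  case (Eq s t)
  then have "h (term_value G v s) = h (term_value G v t) \<longleftrightarrow> term_value G v s = term_value G v t"
    by (intro inj_on_eq_iff[OF Eq.prems(2)]) simp_all
  with Eq.prems(1) show ?case
    using term_value_hom[OF assms(1-4), of s] term_value_hom[OF assms(1-4), of t] by simp
next
  case (Conj p q)
  then have "inj_on h (term_value G v ` formula_terms p)" "inj_on h (term_value G v ` formula_terms q)"
    by (auto elim!: inj_on_subset)
  with Conj show ?case by simp
next
  case (Disj p q)
  then have "inj_on h (term_value G v ` formula_terms p)" "inj_on h (term_value G v ` formula_terms q)"
    by (auto elim!: inj_on_subset)
  with Disj show ?case by simp
qed simp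

text \<open>An assignment in \<open>G\<close> that violates a sentence involves finitely many term
  values; a homomorphism injective on them carries it to a violation in \<open>H\<close>.\<close>

lemma universal_theory_mono:
  assumes "group G" "group H" "\<And>A. finite A \<Longrightarrow> A \<subseteq> carrier G \<Longrightarrow> \<exists>h \<in> hom G H. inj_on h A"
  shows "universal_theory H \<subseteq> universal_theory G"
proof
  fix x assume x: "x \<in> universal_theory H"
  obtain n p where np: "x = (n, p)" by (cases x)
  have vars: "formula_vars p \<subseteq> {..<n}" and sat: "\<And>v. v \<in> {..<n} \<rightarrow> carrier H \<Longrightarrow> satisfies H v p"
    using x by (auto simp: np universal_theory_def)
  have "satisfies G v p" if v: "v \<in> {..<n} \<rightarrow> carrier G" for v
  proof -
    have "term_value G v ` formula_terms p \<subseteq> carrier G"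
      using formula_terms_vars vars by (auto intro!: term_value_closed[OF assms(1) v])
    then obtain h where h: "h \<in> hom G H" "inj_on h (term_value G v ` formula_terms p)"
      using assms(3)[OF finite_imageI[OF finite_formula_terms]] by blast
    have "satisfies H (\<lambda>i. h (v i)) p" using v hom_in_carrier[OF h(1)] by (intro sat) auto
    then show ?thesis using satisfies_hom[OF assms(1,2) h(1) v vars h(2)] by blast
  qed
  with vars show "x \<in> universal_theory G" by (simp add: np universal_theory_def)
qed

lemma fully_residually_free_imp_universal_theory:
  fixes G :: "('a, 'm) monoid_scheme"
  assumes "group G" "finitely_generated G" "fully_residually_free TYPE('u) G"
  shows "\<exists>F :: 'u monoid. is_free_group F \<and> universal_theory G = universal_theory F"
proof -
  from fully_residually_free_uniform[OF assms]
  obtain F :: "'u monoid" and k where F: "is_free_group F" "k \<in> hom F G" "inj_on k (carrier F)"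
    and approx: "\<forall>A. finite A \<and> A \<subseteq> carrier G \<longrightarrow> (\<exists>h \<in> hom G F. inj_on h A)"
    by (elim exE conjE bexE)
  have FG: "group F" using F(1) by (rule is_free_group_imp_group)
  have "universal_theory G \<subseteq> universal_theory F"
  proof (rule universal_theory_mono[OF FG assms(1)])
    fix A assume "A \<subseteq> carrier F"
    then show "\<exists>k \<in> hom F G. inj_on k A" by (intro bexI[OF _ F(2)]) (rule inj_on_subset[OF F(3)])
  qed
  moreover have "universal_theory F \<subseteq> universal_theory G"
    using approx by (intro universal_theory_mono[OF assms(1) FG]) blast
  ultimately show ?thesis using F(1) by blast
qed

primrec word_term :: "nat fword \<Rightarrow> gterm" where
  "word_term [] = One"
| "word_term (l # w) = Mult (if snd l then Var (fst l) else Inv (Var (fst l))) (word_term w)"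

lemma term_value_word_term: "term_value G v (word_term w) = word_eval G v w"
  by (induction w) (auto simp: word_eval_Cons)

lemma term_vars_word_term: "term_vars (word_term w) = fst ` set w"
  by (induction w) auto

text \<open>The same formula is evaluated in \<open>G\<close> and in \<open>F\<close>. A quantifier
  inside a statement ranges over one type, so the equivalence is stated for two types of
  groups.\<close>

lemma qf_formula_conj:
  assumes "finite W"
  shows "\<exists>p. formula_vars p \<subseteq> (\<Union>w \<in> W. formula_vars (f w)) \<and>
    (\<forall>(G :: ('a, 'm) monoid_scheme) v. satisfies G v p \<longleftrightarrow> (\<forall>w \<in> W. satisfies G v (f w))) \<and>
    (\<forall>(G :: ('b, 'k) monoid_scheme) v. satisfies G v p \<longleftrightarrow> (\<forall>w \<in> W. satisfies G v (f w)))"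
  using assms
proof induction
  case empty
  show ?case by (intro exI[of _ "Eq One One"]) simp
next
  case (insert w W)
  then obtain p where "formula_vars p \<subseteq> (\<Union>w \<in> W. formula_vars (f w))"
    "\<forall>(G :: ('a, 'm) monoid_scheme) v. satisfies G v p \<longleftrightarrow> (\<forall>w \<in> W. satisfies G v (f w))"
    "\<forall>(G :: ('b, 'k) monoid_scheme) v. satisfies G v p \<longleftrightarrow> (\<forall>w \<in> W. satisfies G v (f w))" by blast
  then show ?case by (intro exI[of _ "Conj (f w) p"]) auto
qed

text \<open>The pattern of trivial and nontrivial words in \<open>W\<close> is a quantifier-free
  formula \<open>p\<close> that holds for the generators. Thus the universal sentence with matrix
  \<open>Neg p\<close> fails in \<open>G\<close>, hence in \<open>F\<close>, and a violating
  assignment in \<open>F\<close> is the tuple wanted.\<close>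

lemma universal_theory_imp_fully_residually_free:
  fixes G :: "('a, 'm) monoid_scheme" and F :: "'u monoid"
  assumes "group G" "finitely_generated G" "is_free_group F" "universal_theory G = universal_theory F"
  shows "fully_residually_free TYPE('u) G"
proof -
  obtain S where S: "set S \<subseteq> carrier G" "generate G (set S) = carrier G"
    using finitely_generated_list[OF assms(2)] .
  show ?thesis
  proof (rule fully_residually_freeI[OF assms(1) S])
    fix W assume W: "finite W" "W \<subseteq> carrier (free_group {..<length S})"
    define f where "f w = (if word_eval G ((!) S) w = \<one>\<^bsub>G\<^esub> then Eq (word_term w) One
      else Neg (Eq (word_term w) One))" for w
    from qf_formula_conj[OF W(1), where f = f]
    obtain p where vars_p: "formula_vars p \<subseteq> (\<Union>w \<in> W. formula_vars (f w))"
      and sat_G: "\<forall>(G :: ('a, 'm) monoid_scheme) v. satisfies G v p \<longleftrightarrow> (\<forall>w \<in> W. satisfies G v (f w))"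
      and sat_F: "\<forall>(F :: 'u monoid) v. satisfies F v p \<longleftrightarrow> (\<forall>w \<in> W. satisfies F v (f w))"
      by (elim exE conjE)
    have "formula_vars (f w) \<subseteq> {..<length S}" if "w \<in> W" for w
    proof -
      have "set w \<subseteq> {..<length S} \<times> UNIV" using W(2) that by (auto simp: free_group_def)
      then have "fst ` set w \<subseteq> {..<length S}" by auto
      then show ?thesis by (simp add: f_def term_vars_word_term)
    qed
    with vars_p have vars: "formula_vars (Neg p) \<subseteq> {..<length S}" by auto
    have "satisfies G ((!) S) p" by (auto simp: sat_G f_def term_value_word_term)
    moreover have "(!) S \<in> {..<length S} \<rightarrow> carrier G" using S(1) by auto
    ultimately have "(length S, Neg p) \<notin> universal_theory G" by (auto simp: universal_theory_def)
    then have "(length S, Neg p) \<notin> universal_theory F" unfolding assms(4) .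
    with vars obtain v where v: "v \<in> {..<length S} \<rightarrow> carrier F" "satisfies F v p"
      by (auto simp: universal_theory_def)
    then have "\<forall>w \<in> W. word_eval F v w = \<one>\<^bsub>F\<^esub> \<longleftrightarrow> word_eval G ((!) S) w = \<one>\<^bsub>G\<^esub>"
      by (auto simp: sat_F f_def term_value_word_term split: if_splits)
    with assms(3) v(1)
    show "\<exists>(F :: 'u monoid) t. is_free_group F \<and> t \<in> {..<length S} \<rightarrow> carrier F \<and>
        (\<forall>w \<in> W. word_eval F t w = \<one>\<^bsub>F\<^esub> \<longleftrightarrow> word_eval G ((!) S) w = \<one>\<^bsub>G\<^esub>)" by blast
  qed
qed

section \<open>Non-standard free groups\<close>

text \<open>Zorn's lemma applied to families of sets whose finite intersections are infinite. Asking
  for infinite instead of nonempty intersections makes the resulting ultrafilter nonprincipal and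
  finer than \<open>sequentially\<close>.\<close>

lemma nonprincipal_ultrafilter_exists:
  "\<exists>\<omega> :: nat filter. nonprincipal_ultrafilter \<omega> \<and> \<omega> \<le> sequentially"
proof -
  define \<A> where "\<A> = {S :: nat set set. \<forall>T \<subseteq> S. finite T \<longrightarrow> infinite (\<Inter> T)}"
  have "{} \<in> \<A>" by (simp add: \<A>_def)
  then have "\<A> \<noteq> {}" by blast
  then have "\<exists>M \<in> \<A>. \<forall>S \<in> \<A>. M \<subseteq> S \<longrightarrow> S = M"
  proof (rule subset_Zorn_nonempty)
    fix C assume C: "C \<noteq> {}" "subset.chain \<A> C"
    show "\<Union> C \<in> \<A>"
      unfolding \<A>_def
    proof (intro CollectI allI impI)
      fix T assume T: "T \<subseteq> \<Union> C" "finite T"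
      obtain S where "S \<in> C" "T \<subseteq> S" using finite_subset_Union_chain[OF T(2,1) C] .
      then show "infinite (\<Inter> T)" using C(2) T(2) by (auto simp: subset_chain_def \<A>_def)
    qed
  qed
  then obtain M where M: "M \<in> \<A>" and max: "\<And>S. S \<in> \<A> \<Longrightarrow> M \<subseteq> S \<Longrightarrow> S = M" by blast
  have fip: "infinite (\<Inter> T)" if "T \<subseteq> M" "finite T" for T
    using M that unfolding \<A>_def by simp
  define \<omega> where "\<omega> = (INF A \<in> M. principal A)"
  have ev: "eventually P \<omega> \<longleftrightarrow> (\<exists>T \<subseteq> M. finite T \<and> (\<forall>i \<in> \<Inter> T. P i))" for P
  proof -
    have "eventually P \<omega> \<longleftrightarrow> (\<exists>T \<subseteq> M. finite T \<and> eventually P (INF A \<in> T. principal A))"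
      unfolding \<omega>_def by (rule eventually_INF)
    also have "\<dots> \<longleftrightarrow> (\<exists>T \<subseteq> M. finite T \<and> (\<forall>i \<in> \<Inter> T. P i))"
      by (intro ex_cong1 conj_cong refl) (simp add: INF_principal_finite eventually_principal)
    finally show ?thesis .
  qed
  have inf: "infinite {i. P i}" if P: "eventually P \<omega>" for P
  proof -
    obtain T where "T \<subseteq> M" "finite T" "\<Inter> T \<subseteq> {i. P i}" using P unfolding ev by blast
    moreover from this(1,2) have "infinite (\<Inter> T)" by (rule fip)
    ultimately show ?thesis using finite_subset by blast
  qed
  have in_M: "eventually (\<lambda>i. i \<in> A) \<omega>" if "A \<in> M" for A
    unfolding ev using that by (intro exI[of _ "{A}"]) auto
  have ultra: "eventually P \<omega> \<or> eventually (\<lambda>i. \<not> P i) \<omega>" for P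
  proof (rule ccontr)
    assume neg: "\<not> ?thesis"
    \<comment> \<open>By maximality, a set outside \<open>M\<close> cannot be added, so it meets
      some finite intersection of members of \<open>M\<close> in a finite set.\<close>
    have *: "\<exists>T \<subseteq> M. finite T \<and> finite (A \<inter> \<Inter> T)" if A: "A \<notin> M" for A
    proof -
      have "insert A M \<notin> \<A>" using max[of "insert A M"] A by auto
      then obtain T where T: "T \<subseteq> insert A M" "finite T" "finite (\<Inter> T)" unfolding \<A>_def by blast
      have "finite (A \<inter> \<Inter> (T - {A}))" by (rule finite_subset[OF _ T(3)]) blast
      with T(1,2) show ?thesis by (intro exI[of _ "T - {A}"]) auto
    qed
    have "{i. P i} \<notin> M" "{i. \<not> P i} \<notin> M" using neg in_M[of "{i. P i}"] in_M[of "{i. \<not> P i}"] by auto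
    then obtain T T' where T: "T \<subseteq> M" "finite T" "finite ({i. P i} \<inter> \<Inter> T)"
      and T': "T' \<subseteq> M" "finite T'" "finite ({i. \<not> P i} \<inter> \<Inter> T')" using * by meson
    have "\<Inter> (T \<union> T') \<subseteq> ({i. P i} \<inter> \<Inter> T) \<union> ({i. \<not> P i} \<inter> \<Inter> T')" by blast
    then have "finite (\<Inter> (T \<union> T'))" using T(3) T'(3) by (meson finite_UnI finite_subset)
    moreover have "infinite (\<Inter> (T \<union> T'))" using T(1,2) T'(1,2) by (intro fip) auto
    ultimately show False by blast
  qed
  have nonprincipal: "\<not> eventually (\<lambda>i. i = j) \<omega>" for j
    using inf[of "\<lambda>i. i = j"] by auto
  have "\<omega> \<noteq> bot" using inf[of "\<lambda>_. False"] by auto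
  moreover have "\<omega> \<le> sequentially"
  proof (rule filter_leI)
    fix P :: "nat \<Rightarrow> bool" assume "eventually P sequentially"
    then obtain k where "\<And>i. k \<le> i \<Longrightarrow> P i" by (auto simp: eventually_sequentially)
    then have "{i. \<not> P i} \<subseteq> {..<k}" by (auto simp: not_le[symmetric])
    then have "finite {i. \<not> P i}" by (rule finite_subset) simp
    then show "eventually P \<omega>" using ultra[of P] inf[of "\<lambda>i. \<not> P i"] by blast
  qed
  ultimately show ?thesis using ultra nonprincipal by (auto simp: nonprincipal_ultrafilter_def)
qed

lemma restrict_UNIV [simp]: "restrict f UNIV = f"
  by (simp add: restrict_def)

definition ultra_class :: "nat filter \<Rightarrow> ('a, 'm) monoid_scheme \<Rightarrow> (nat \<Rightarrow> 'a) \<Rightarrow> (nat \<Rightarrow> 'a) set" where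
  "ultra_class \<omega> F x = ultra_rel \<omega> F `` {x}"

lemma equiv_ultra_rel: "equiv (UNIV \<rightarrow> carrier F) (ultra_rel \<omega> F)"
proof (rule equivI)
  show "trans (ultra_rel \<omega> F)"
  proof (rule transI)
    fix x y z assume "(x, y) \<in> ultra_rel \<omega> F" "(y, z) \<in> ultra_rel \<omega> F"
    then have c: "x \<in> UNIV \<rightarrow> carrier F" "z \<in> UNIV \<rightarrow> carrier F"
      and "\<forall>\<^sub>F i in \<omega>. x i = y i" "\<forall>\<^sub>F i in \<omega>. y i = z i" by (simp_all add: ultra_rel_def)
    from this(3,4) have "\<forall>\<^sub>F i in \<omega>. x i = z i" by eventually_elim simp
    with c show "(x, z) \<in> ultra_rel \<omega> F" by (simp add: ultra_rel_def)
  qed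
qed (auto simp: ultra_rel_def refl_on_def sym_def eq_commute)

lemma ultra_class_eq_iff:
  assumes "x \<in> UNIV \<rightarrow> carrier F" "y \<in> UNIV \<rightarrow> carrier F"
  shows "ultra_class \<omega> F x = ultra_class \<omega> F y \<longleftrightarrow> (\<forall>\<^sub>F i in \<omega>. x i = y i)"
  unfolding ultra_class_def eq_equiv_class_iff[OF equiv_ultra_rel assms]
  using assms by (simp add: ultra_rel_def)

lemma carrier_ultrapower: "carrier (ultrapower \<omega> F) = ultra_class \<omega> F ` (UNIV \<rightarrow> carrier F)"
  by (auto simp: ultrapower_def Let_def ultra_class_def quotient_def PiE_UNIV_domain)

lemma one_ultrapower: "\<one>\<^bsub>ultrapower \<omega> F\<^esub> = ultra_class \<omega> F (\<lambda>_. \<one>\<^bsub>F\<^esub>)"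
  by (simp add: ultrapower_def Let_def ultra_class_def)

lemma mult_ultrapower:
  assumes "group F" and x: "x \<in> UNIV \<rightarrow> carrier F" and y: "y \<in> UNIV \<rightarrow> carrier F"
  shows "ultra_class \<omega> F x \<otimes>\<^bsub>ultrapower \<omega> F\<^esub> ultra_class \<omega> F y = ultra_class \<omega> F (\<lambda>i. x i \<otimes>\<^bsub>F\<^esub> y i)"
proof -
  interpret group F by fact
  have self: "x \<in> ultra_class \<omega> F x" "y \<in> ultra_class \<omega> F y"
    using x y by (simp_all add: ultra_class_def ultra_rel_def)
  have "ultra_class \<omega> F (\<lambda>i. a i \<otimes>\<^bsub>F\<^esub> b i) = ultra_class \<omega> F (\<lambda>i. x i \<otimes>\<^bsub>F\<^esub> y i)"
    if "a \<in> ultra_class \<omega> F x" "b \<in> ultra_class \<omega> F y" for a b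
  proof -
    have ab: "a \<in> UNIV \<rightarrow> carrier F" "b \<in> UNIV \<rightarrow> carrier F"
      "\<forall>\<^sub>F i in \<omega>. x i = a i" "\<forall>\<^sub>F i in \<omega>. y i = b i"
      using that by (simp_all add: ultra_class_def ultra_rel_def)
    from ab(3,4) have "\<forall>\<^sub>F i in \<omega>. a i \<otimes>\<^bsub>F\<^esub> b i = x i \<otimes>\<^bsub>F\<^esub> y i" by eventually_elim simp
    moreover have "(\<lambda>i. a i \<otimes>\<^bsub>F\<^esub> b i) \<in> UNIV \<rightarrow> carrier F" "(\<lambda>i. x i \<otimes>\<^bsub>F\<^esub> y i) \<in> UNIV \<rightarrow> carrier F"
      using ab x y by auto
    ultimately show ?thesis by (simp add: ultra_class_eq_iff)
  qed
  then have "(\<Union>a \<in> ultra_class \<omega> F x. \<Union>b \<in> ultra_class \<omega> F y. ultra_class \<omega> F (\<lambda>i. a i \<otimes>\<^bsub>F\<^esub> b i))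
      = ultra_class \<omega> F (\<lambda>i. x i \<otimes>\<^bsub>F\<^esub> y i)"
    using self by blast
  then show ?thesis by (simp add: ultrapower_def Let_def ultra_class_def)
qed

lemma ultra_class_hom:
  assumes "group F"
  shows "ultra_class \<omega> F \<in> hom (product_group UNIV (\<lambda>_. F)) (ultrapower \<omega> F)"
  using assms by (intro homI) (auto simp: carrier_ultrapower mult_ultrapower PiE_UNIV_domain)

text \<open>The ultrapower is the image of the product group under the multiplicative map
  \<open>ultra_class\<close>, so the group laws are inherited.\<close>

lemma group_ultrapower:
  assumes "group F"
  shows "group (ultrapower \<omega> F)"
proof -
  let ?P = "product_group UNIV (\<lambda>_ :: nat. F)" and ?U = "ultrapower \<omega> F"
  have P: "group ?P" using assms by simp
  have "?U\<lparr>carrier := ultra_class \<omega> F ` carrier ?P, one := ultra_class \<omega> F \<one>\<^bsub>?P\<^esub>\<rparr> = ?U"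
    by (simp add: PiE_UNIV_domain flip: carrier_ultrapower one_ultrapower)
  with group.hom_imp_img_group[OF P ultra_class_hom[OF assms]] show ?thesis by metis
qed

text \<open>An instance of \<open>fully_residually_free_of_limit\<close>: the coordinate projections
  of the power of \<open>F\<close> approximate the quotient map to the ultrapower. The ultrafilter
  decides for each coordinate sequence whether it is trivial at most indices.\<close>

lemma embeds_imp_fully_residually_free:
  fixes G :: "('a, 'm) monoid_scheme"
  assumes "group G" "finitely_generated G" "embeds_in_nonstandard_free_group TYPE('u) G"
  shows "fully_residually_free TYPE('u) G"
proof -
  obtain F :: "'u monoid" and \<omega> H where F: "is_free_group F" and \<omega>: "nonprincipal_ultrafilter \<omega>"
    and H: "subgroup H (ultrapower \<omega> F)" and iso: "G \<cong> (ultrapower \<omega> F)\<lparr>carrier := H\<rparr>"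
    using assms(3) unfolding embeds_in_nonstandard_free_group_def by blast
  let ?P = "product_group UNIV (\<lambda>_ :: nat. F)" and ?U = "ultrapower \<omega> F"
  have FG: "group F" using F by (rule is_free_group_imp_group)
  have P: "group ?P" using FG by simp
  obtain \<phi> where \<phi>: "\<phi> \<in> iso G (?U\<lparr>carrier := H\<rparr>)" using iso by (auto simp: is_iso_def)
  have HU: "H \<subseteq> carrier ?U" by (rule subgroup.subset[OF H])
  have \<phi>H: "\<phi> ` carrier G = H" using \<phi> by (simp add: iso_def bij_betw_def)
  show ?thesis
  proof (rule fully_residually_free_of_limit[OF assms(1,2) P group_ultrapower[OF FG]])
    show "ultra_class \<omega> F \<in> hom ?P ?U" by (rule ultra_class_hom[OF FG])
    show "\<phi> \<in> hom G ?U" using \<phi> HU by (auto simp: iso_def hom_def)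
    show "inj_on \<phi> (carrier G)" using \<phi> by (simp add: iso_def bij_betw_def)
    show "\<phi> ` carrier G \<subseteq> ultra_class \<omega> F ` carrier ?P"
      using HU by (simp add: \<phi>H carrier_ultrapower PiE_UNIV_domain)
    show "is_free_group F" by (rule F)
    show "(\<lambda>x. x i) \<in> hom ?P F" for i by (auto simp: hom_def)
    show "\<omega> \<noteq> bot" using \<omega> by (simp add: nonprincipal_ultrafilter_def)
    fix x assume "x \<in> carrier ?P"
    then have x: "x \<in> UNIV \<rightarrow> carrier F" by (simp add: PiE_UNIV_domain)
    have "ultra_class \<omega> F x = \<one>\<^bsub>?U\<^esub> \<longleftrightarrow> (\<forall>\<^sub>F i in \<omega>. x i = \<one>\<^bsub>F\<^esub>)"
      unfolding one_ultrapower using FG by (intro ultra_class_eq_iff x) (simp add: group.is_monoid)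
    moreover have "(\<forall>\<^sub>F i in \<omega>. x i = \<one>\<^bsub>F\<^esub>) \<or> (\<forall>\<^sub>F i in \<omega>. x i \<noteq> \<one>\<^bsub>F\<^esub>)"
      using \<omega> unfolding nonprincipal_ultrafilter_def by blast
    ultimately show "\<forall>\<^sub>F i in \<omega>. x i = \<one>\<^bsub>F\<^esub> \<longleftrightarrow> ultra_class \<omega> F x = \<one>\<^bsub>?U\<^esub>"
      by (cases "ultra_class \<omega> F x = \<one>\<^bsub>?U\<^esub>") simp_all
  qed
qed

text \<open>Send \<open>g\<close> to the class of the values \<open>h i g\<close> of a separating
  sequence. Since \<open>\<omega>\<close> is finer than \<open>sequentially\<close>, elements
  separated from some index on have different classes.\<close>

lemma fully_residually_free_imp_embeds:
  fixes G :: "('a, 'm) monoid_scheme"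
  assumes "group G" "finitely_generated G" "fully_residually_free TYPE('u) G"
  shows "embeds_in_nonstandard_free_group TYPE('u) G"
proof -
  from fully_residually_free_uniform[OF assms]
  obtain F :: "'u monoid" where F: "is_free_group F"
    and approx: "\<forall>A. finite A \<and> A \<subseteq> carrier G \<longrightarrow> (\<exists>h \<in> hom G F. inj_on h A)"
    by (elim exE conjE bexE)
  have "\<exists>h. (\<forall>i :: nat. h i \<in> hom G F) \<and> (\<forall>x \<in> carrier G. \<forall>y \<in> carrier G.
      x \<noteq> y \<longrightarrow> (\<forall>\<^sub>F i in sequentially. h i x \<noteq> h i y))"
    by (rule separating_sequence[OF countable_finitely_generated[OF assms(1,2)]])
      (use approx in blast)
  then obtain h where h: "\<And>i :: nat. h i \<in> hom G F" and sep: "\<forall>x \<in> carrier G. \<forall>y \<in> carrier G.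
      x \<noteq> y \<longrightarrow> (\<forall>\<^sub>F i in sequentially. h i x \<noteq> h i y)" by (elim exE conjE) blast
  obtain \<omega> :: "nat filter" where \<omega>: "nonprincipal_ultrafilter \<omega>" "\<omega> \<le> sequentially"
    using nonprincipal_ultrafilter_exists by blast
  let ?U = "ultrapower \<omega> F"
  have FG: "group F" using F by (rule is_free_group_imp_group)
  have U: "group ?U" by (rule group_ultrapower[OF FG])
  define \<Psi> where "\<Psi> g = ultra_class \<omega> F (\<lambda>i. h i g)" for g
  have hc: "(\<lambda>i. h i g) \<in> UNIV \<rightarrow> carrier F" if "g \<in> carrier G" for g
    using hom_in_carrier[OF h that] by auto
  have \<Psi>: "\<Psi> \<in> hom G ?U"
  proof (rule homI)
    show "\<Psi> g \<in> carrier ?U" if "g \<in> carrier G" for g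
      using hc[OF that] by (simp add: \<Psi>_def carrier_ultrapower)
    fix g g' assume g: "g \<in> carrier G" "g' \<in> carrier G"
    have "(\<lambda>i. h i (g \<otimes>\<^bsub>G\<^esub> g')) = (\<lambda>i. h i g \<otimes>\<^bsub>F\<^esub> h i g')" using hom_mult[OF h g] by simp
    then show "\<Psi> (g \<otimes>\<^bsub>G\<^esub> g') = \<Psi> g \<otimes>\<^bsub>?U\<^esub> \<Psi> g'"
      by (simp add: \<Psi>_def mult_ultrapower[OF FG hc[OF g(1)] hc[OF g(2)]])
  qed
  have inj: "inj_on \<Psi> (carrier G)"
  proof (rule inj_onI, rule ccontr)
    fix g g' assume g: "g \<in> carrier G" "g' \<in> carrier G" "\<Psi> g = \<Psi> g'" "g \<noteq> g'"
    have "\<forall>\<^sub>F i in \<omega>. h i g = h i g'"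
      using g(3) ultra_class_eq_iff[OF hc[OF g(1)] hc[OF g(2)], of \<omega>] by (simp add: \<Psi>_def)
    moreover have "\<forall>\<^sub>F i in \<omega>. h i g \<noteq> h i g'"
      using sep g by (intro filter_leD[OF \<omega>(2)]) blast
    ultimately have "\<forall>\<^sub>F i in \<omega>. False" by eventually_elim simp
    then show False using \<omega>(1) by (simp add: nonprincipal_ultrafilter_def)
  qed
  interpret group_hom G ?U \<Psi>
    using assms(1) U \<Psi> by (simp add: group_hom_def group_hom_axioms_def)
  have "\<Psi> \<in> iso G (?U\<lparr>carrier := \<Psi> ` carrier G\<rparr>)"
    using hom_onto_image[OF \<Psi>] inj by (simp add: iso_def bij_betw_def)
  then have "G \<cong> ?U\<lparr>carrier := \<Psi> ` carrier G\<rparr>" by (auto simp: is_iso_def)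
  with F \<omega>(1) img_is_subgroup show ?thesis
    unfolding embeds_in_nonstandard_free_group_def by blast
qed

lemma ex_marking:
  assumes "finitely_generated G"
  shows "\<exists>n. \<exists>N. N \<in> markings n G"
proof -
  obtain S where "set S \<subseteq> carrier G" "generate G (set S) = carrier G"
    using finitely_generated_list[OF assms] .
  then have "marked_kernel G S \<in> markings (length S) G" unfolding markings_def by blast
  then show ?thesis by blast
qed

theorem theorem1p1:
  fixes G :: "('a, 'm) monoid_scheme"
  assumes "group G" and "finitely_generated G"
  shows
    "(sela_limit_group TYPE('u :: infinite) G
       \<longleftrightarrow> (\<exists>n. \<exists>N \<in> markings n G. limit_of_free_markings TYPE('u) n N)) \<and>
     ((\<exists>n. \<exists>N \<in> markings n G. limit_of_free_markings TYPE('u) n N)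
       \<longleftrightarrow> (\<forall>n. \<forall>N \<in> markings n G. limit_of_free_markings TYPE('u) n N)) \<and>
     ((\<forall>n. \<forall>N \<in> markings n G. limit_of_free_markings TYPE('u) n N)
       \<longleftrightarrow> (\<exists>F :: 'u monoid. is_free_group F \<and> universal_theory G = universal_theory F)) \<and>
     ((\<exists>F :: 'u monoid. is_free_group F \<and> universal_theory G = universal_theory F)
       \<longleftrightarrow> embeds_in_nonstandard_free_group TYPE('u) G) \<and>
     (embeds_in_nonstandard_free_group TYPE('u) G
       \<longleftrightarrow> fully_residually_free TYPE('u) G)"
proof -
  let ?frf = "fully_residually_free TYPE('u) G"
  have 1: "sela_limit_group TYPE('u) G \<longleftrightarrow> ?frf"
    using sela_limit_group_imp_fully_residually_free[OF assms]
      fully_residually_free_imp_sela_limit_group[OF assms] by blast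
  have frf_all: "?frf \<Longrightarrow> \<forall>n. \<forall>N \<in> markings n G. limit_of_free_markings TYPE('u) n N"
    using fully_residually_free_imp_limit_of_free_markings[OF assms(1)] by blast
  have ex_frf: "\<exists>n. \<exists>N \<in> markings n G. limit_of_free_markings TYPE('u) n N \<Longrightarrow> ?frf"
    using limit_of_free_markings_imp_fully_residually_free[OF assms(1)] by blast
  \<comment> \<open>Finite generation provides a marking, so the universal form is not
    vacuous.\<close>
  have all_ex: "\<exists>n. \<exists>N \<in> markings n G. limit_of_free_markings TYPE('u) n N"
    if "\<forall>n. \<forall>N \<in> markings n G. limit_of_free_markings TYPE('u) n N"
    using that ex_marking[OF assms(2)] by blast
  have 3: "(\<exists>F :: 'u monoid. is_free_group F \<and> universal_theory G = universal_theory F) \<longleftrightarrow> ?frf"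
    using universal_theory_imp_fully_residually_free[OF assms]
      fully_residually_free_imp_universal_theory[OF assms] by blast
  have 4: "embeds_in_nonstandard_free_group TYPE('u) G \<longleftrightarrow> ?frf"
    using embeds_imp_fully_residually_free[OF assms] fully_residually_free_imp_embeds[OF assms] by blast
  from 1 3 4 frf_all ex_frf all_ex show ?thesis by argo
qed

end
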